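(* Let $\langle \mathscr{A} \mid \mathscr{R} \rangle$ be a finite monoid presentation which is weakly $C(4)$. Then the relation $$\lbrace (u, v) \in \mathscr{A}^* \times \mathscr{A}^* \mid u \equiv v \rbrace$$ is deterministic rational and reverse deterministic rational. Moreover, one can, starting from the presentation, effectively compute 2-tape deterministic automata recognising this relation and its reverse.
   Context: A finite monoid presentation $\langle \mathscr{A} \mid \mathscr{R} \rangle$ consists of a finite alphabet $\mathscr{A}$ and a finite set $\mathscr{R} \subseteq \mathscr{A}^* \times \mathscr{A}^*$ of relations. For $u,v\in\mathscr{A}^*$, $u \equiv v$ means that $u$ and $v$ represent the same element of the monoid presented. A relation word is a word which occurs as one side of a relation in the presentation. A piece is a word which occurs as a factor of two distinct relation words, or in two different (possibly overlapping) places within one relation word; by convention the empty word is always a piece. The presentation is weakly $C(n)$, for a positive integer $n$, if no relation word can be written as a product of strictly fewer than $n$ pieces. A 2-tape deterministic automaton is a finite automaton with two read-only one-way input tapes, each containing an input word followed by an end-marker $\$\notin\mathscr{A}$, whose finite state set is partitioned into states which read from the first tape and states which read from the second tape, with a single initial state, a set of accepting states, and a (partial) transition function giving at most one successor state for each state and each symbol of $\mathscr{A} \cup \{\$\}$ read from the tape associated with that state. It recognises the set of pairs $(u,v)$ such that, on input $(u\$, v\$)$, it reaches an accepting state having read both tapes completely. A relation $\rho \subseteq \mathscr{A}^* \times \mathscr{A}^*$ is deterministic rational if it is recognised by some 2-tape deterministic automaton. The reverse of $\rho$ is $\{(u^{\mathrm{rev}}, v^{\mathrm{rev}}) \mid (u,v)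 \in \rho\}$, where $w^{\mathrm{rev}}$ is $w$ written backwards, and $\rho$ is reverse deterministic rational if its reverse is deterministic rational. *)

theory Defs
  imports "HOL-Library.Nat_Bijection"
begin

section \<open>Monoid presentations and pieces\<close>

definition finite_presentation :: "'a set \<Rightarrow> ('a list \<times> 'a list) set \<Rightarrow> bool" where
  "finite_presentation A R \<longleftrightarrow> finite A \<and> finite R \<and> R \<subseteq> lists A \<times> lists A"

text \<open>The least congruence on the free monoid \<open>lists A\<close> containing \<open>R\<close>; the monoid
  presented by \<open>A\<close> and \<open>R\<close> is the quotient of \<open>lists A\<close> by it.\<close>

inductive_set word_equiv :: "'a set \<Rightarrow> ('a list \<times> 'a list) set \<Rightarrow> ('a list \<times> 'a list) set"
  for A :: "'a set" and R :: "('a list \<times> 'a list) set" where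
  rel: "(u, v) \<in> R \<Longrightarrow> (u, v) \<in> word_equiv A R"
| refl: "u \<in> lists A \<Longrightarrow> (u, u) \<in> word_equiv A R"
| sym: "(u, v) \<in> word_equiv A R \<Longrightarrow> (v, u) \<in> word_equiv A R"
| trans: "(u, v) \<in> word_equiv A R \<Longrightarrow> (v, w) \<in> word_equiv A R \<Longrightarrow> (u, w) \<in> word_equiv A R"
| mult: "(u, v) \<in> word_equiv A R \<Longrightarrow> (u', v') \<in> word_equiv A R \<Longrightarrow>
    (u @ u', v @ v') \<in> word_equiv A R"

definition relation_words :: "('a list \<times> 'a list) set \<Rightarrow> 'a list set" where
  "relation_words R = fst ` R \<union> snd ` R"

text \<open>The prefix preceding an occurrence identifies its place within a given relation word.\<close>

definition piece :: "('a list \<times> 'a list) set \<Rightarrow> 'a list \<Rightarrow> bool" where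
  "piece R p \<longleftrightarrow>
     p = [] \<or>
     (\<exists>w\<in>relation_words R. \<exists>w'\<in>relation_words R. w \<noteq> w' \<and>
        (\<exists>x y. w = x @ p @ y) \<and> (\<exists>x' y'. w' = x' @ p @ y')) \<or>
     (\<exists>w\<in>relation_words R. \<exists>x y x' y'. x \<noteq> x' \<and> w = x @ p @ y \<and> w = x' @ p @ y')"

definition weakly_C :: "nat \<Rightarrow> ('a list \<times> 'a list) set \<Rightarrow> bool" where
  "weakly_C n R \<longleftrightarrow>
     (\<forall>w\<in>relation_words R. \<not> (\<exists>ps. length ps < n \<and> (\<forall>p\<in>set ps. piece R p) \<and> w = concat ps))"


section \<open>Two-tape deterministic automata\<close>

datatype 'a tape_symbol = Letter 'a | End_Marker

record ('q, 'a) two_tape =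
  states1 :: "'q set"
  states2 :: "'q set"
  initial :: 'q
  accepting :: "'q set"
  next_state :: "'q \<Rightarrow> 'a tape_symbol \<Rightarrow> 'q option"

definition two_tape_automaton :: "'a set \<Rightarrow> ('q, 'a) two_tape \<Rightarrow> bool" where
  "two_tape_automaton A M \<longleftrightarrow>
     finite (states1 M) \<and> finite (states2 M) \<and> states1 M \<inter> states2 M = {} \<and>
     initial M \<in> states1 M \<union> states2 M \<and>
     accepting M \<subseteq> states1 M \<union> states2 M \<and>
     (\<forall>q s q'. next_state M q s = Some q' \<longrightarrow>
        q \<in> states1 M \<union> states2 M \<and> s \<in> insert End_Marker (Letter ` A) \<and>
        q' \<in> states1 M \<union> states2 M)"

text \<open>A configuration consists of the current state and the unread parts of the two tapes.\<close>

inductive step :: "('q, 'a) two_tape \<Rightarrow>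
    'q \<times> 'a tape_symbol list \<times> 'a tape_symbol list \<Rightarrow>
    'q \<times> 'a tape_symbol list \<times> 'a tape_symbol list \<Rightarrow> bool"
  for M :: "('q, 'a) two_tape" where
  read1: "q \<in> states1 M \<Longrightarrow> next_state M q s = Some q' \<Longrightarrow> step M (q, s # x, y) (q', x, y)"
| read2: "q \<in> states2 M \<Longrightarrow> next_state M q s = Some q' \<Longrightarrow> step M (q, x, s # y) (q', x, y)"

definition tape :: "'a list \<Rightarrow> 'a tape_symbol list" where
  "tape w = map Letter w @ [End_Marker]"

definition recognised :: "('q, 'a) two_tape \<Rightarrow> ('a list \<times> 'a list) set" where
  "recognised M =
     {(u, v). \<exists>q\<in>accepting M. (step M)\<^sup>*\<^sup>* (initial M, tape u, tape v) (q, [], [])}"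

text \<open>State sets are finite, so taking states from \<^typ>\<open>nat\<close> is no restriction.\<close>

definition deterministic_rational :: "'a set \<Rightarrow> ('a list \<times> 'a list) set \<Rightarrow> bool" where
  "deterministic_rational A \<rho> \<longleftrightarrow>
     (\<exists>M :: (nat, 'a) two_tape. two_tape_automaton A M \<and> recognised M = \<rho>)"

definition reverse :: "('a list \<times> 'a list) set \<Rightarrow> ('a list \<times> 'a list) set" where
  "reverse \<rho> = {(rev u, rev v) | u v. (u, v) \<in> \<rho>}"

definition reverse_deterministic_rational :: "'a set \<Rightarrow> ('a list \<times> 'a list) set \<Rightarrow> bool" where
  "reverse_deterministic_rational A \<rho> \<longleftrightarrow> deterministic_rational A (reverse \<rho>)"


section \<open>Effective computability\<close>

text \<open>The unary partial recursive functions, with further arguments packed into one number by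
  the Cantor pairing function \<^const>\<open>prod_encode\<close>. The value \<^const>\<open>None\<close> means
  divergence, so minimisation requires all earlier values to be defined and nonzero.\<close>

definition minimise :: "(nat \<Rightarrow> nat option) \<Rightarrow> nat \<Rightarrow> nat option" where
  "minimise f a =
     (if \<exists>n. f (prod_encode (a, n)) = Some 0 \<and>
             (\<forall>m<n. \<exists>k. f (prod_encode (a, m)) = Some (Suc k))
      then Some (LEAST n. f (prod_encode (a, n)) = Some 0)
      else None)"

primrec prim_rec ::
  "(nat \<Rightarrow> nat option) \<Rightarrow> (nat \<Rightarrow> nat option) \<Rightarrow> nat \<Rightarrow> nat \<Rightarrow> nat option" where
  "prim_rec f g a 0 = f a"
| "prim_rec f g a (Suc n) =
     Option.bind (prim_rec f g a n) (\<lambda>r. g (prod_encode (a, prod_encode (n, r))))"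

inductive partial_recursive :: "(nat \<Rightarrow> nat option) \<Rightarrow> bool" where
  zero: "partial_recursive (\<lambda>_. Some 0)"
| succ: "partial_recursive (\<lambda>n. Some (Suc n))"
| left: "partial_recursive (\<lambda>n. Some (fst (prod_decode n)))"
| right: "partial_recursive (\<lambda>n. Some (snd (prod_decode n)))"
| pair: "partial_recursive f \<Longrightarrow> partial_recursive g \<Longrightarrow>
    partial_recursive
      (\<lambda>n. Option.bind (f n) (\<lambda>a. Option.bind (g n) (\<lambda>b. Some (prod_encode (a, b)))))"
| comp: "partial_recursive f \<Longrightarrow> partial_recursive g \<Longrightarrow>
    partial_recursive (\<lambda>n. Option.bind (g n) f)"
| prim_rec: "partial_recursive f \<Longrightarrow> partial_recursive g \<Longrightarrow>
    partial_recursive (\<lambda>n. case prod_decode n of (a, k) \<Rightarrow> prim_rec f g a k)"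
| minimise: "partial_recursive f \<Longrightarrow> partial_recursive (minimise f)"

definition presentation_code :: "nat list \<Rightarrow> (nat list \<times> nat list) list \<Rightarrow> nat" where
  "presentation_code as rs =
     prod_encode (list_encode as,
       list_encode (map (\<lambda>(l, r). prod_encode (list_encode l, list_encode r)) rs))"

primrec symbol_code :: "nat tape_symbol \<Rightarrow> nat" where
  "symbol_code End_Marker = 0"
| "symbol_code (Letter a) = Suc a"

text \<open>A code lists the two parts of the state set, the initial state, the accepting states and
  the graph of the transition function. The lists may be in any order and contain repetitions;
  a code nevertheless determines the automaton.\<close>

definition codes_automaton :: "nat \<Rightarrow> (nat, nat) two_tape \<Rightarrow> bool" where
  "codes_automaton c M \<longleftrightarrow>
     (\<exists>qs1 qs2 fs ts.
        set qs1 = states1 M \<and> set qs2 = states2 M \<and> set fs = accepting M \<and>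
        set ts = {(q, s, q'). next_state M q s = Some q'} \<and>
        c = prod_encode (list_encode qs1, prod_encode (list_encode qs2,
              prod_encode (initial M, prod_encode (list_encode fs,
                list_encode (map (\<lambda>(q, s, q').
                  prod_encode (q, prod_encode (symbol_code s, q'))) ts))))))"

end

theory Submission
  imports Defs "HOL-Library.Sublist"
begin

text \<open>Split every relation word as \<open>r = H r @ Z r\<close>, where \<open>Z r\<close> is its longest suffix that is a piece.
  Occurrences of the stems \<open>H r\<close> are rigid: if a word starts with a stem that no other stem overlaps
  from the right, then every equivalent word starts with the stem of a relation word of the same
  class, and otherwise the first letter is common to all equivalent words. Whether the continuations
  after two such stems make the words equivalent can be reduced, by inspecting a bounded prefix, to
  the same kind of question further along the words, where also the first word may be required to
  be equivalent to one starting with a given piece. So two buffers of bounded length and one piece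
  are enough memory for a deterministic automaton: it reads from a tape until both buffers are
  long enough to be reduced. The automaton is obtained from the presentation by functional
  programs on lists, and these are compiled to recursive functions. The reversed relation is the
  word problem of the reversed presentation, which is again weakly \<open>C(4)\<close>.\<close>

section \<open>Pieces, stems and tails\<close>

text \<open>In the word combinatorics weak \<open>C(4)\<close> acts through one fact: as the tail is
  a piece, a stem is not a product of two pieces. So a stem occurs only once among all relation
  words, and if a piece is cut off its front, what is left still determines its place. The second
  consequence is behind the uniqueness of the active suffix. The obstacle is that the tail behind a
  stem need not be visible: it may appear only after rewriting further right, at a stem that begins
  inside the tail. Whether a stem can be completed (\<open>realised\<close>) is therefore not a
  local property. It is replaced by the necessary condition \<open>clean\<close>, which a bounded
  prefix decides, and reduction is arranged so that this weaker test gives exact answers. When both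
  tails are hidden, the suffix they have to share is not written anywhere on the tapes; this is the
  origin of the piece in the state. A reduction can lengthen a buffer, so neither termination nor
  finiteness of the state set can rest on lengths alone.\<close>

lemma append_cmp:
  assumes "a @ b = c @ d"
  obtains e where "c = a @ e" "b = e @ d" | e where "a = c @ e" "d = e @ b" "e \<noteq> []"
proof -
  obtain e where "a = c @ e \<and> e @ b = d \<or> a @ e = c \<and> b = e @ d"
    using assms unfolding append_eq_append_conv2 by blast
  then show thesis using that by (cases "e = []") auto
qed

lemma append_cmp_length:
  assumes "a @ b = c @ d" "length a \<le> length c"
  obtains e where "c = a @ e" "b = e @ d"
  using assms by (auto simp: append_eq_append_conv2)

text \<open>In the literature a relation word is written \<open>XYZ\<close> with \<open>X\<close> and \<open>Z\<close> its longest piece prefix and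
  suffix. Only \<open>XY\<close>, the stem, and \<open>Z\<close>, the tail, are needed: a piece is a prefix of \<open>X\<close> if and only if it is a
  prefix of \<open>XYZ\<close>.\<close>

definition stem_length :: "('a list \<times> 'a list) set \<Rightarrow> 'a list \<Rightarrow> nat" where
  "stem_length R r = (LEAST n. piece R (drop n r))"

definition stem :: "('a list \<times> 'a list) set \<Rightarrow> 'a list \<Rightarrow> 'a list" where
  "stem R r = take (stem_length R r) r"

definition tail :: "('a list \<times> 'a list) set \<Rightarrow> 'a list \<Rightarrow> 'a list" where
  "tail R r = drop (stem_length R r) r"

section \<open>Classes of relation words and the rewriting they generate\<close>

definition sim :: "('a list \<times> 'a list) set \<Rightarrow> 'a list \<Rightarrow> 'a list \<Rightarrow> bool" where
  "sim R r r' \<longleftrightarrow> r \<in> relation_words R \<and> (r, r') \<in> (R \<union> R\<inverse>)\<^sup>*"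

text \<open>One step exchanges a relation word for any word of its class, so the path taken inside
  the class does not matter.\<close>

inductive rewrite :: "('a list \<times> 'a list) set \<Rightarrow> 'a list \<Rightarrow> 'a list \<Rightarrow> bool" for R where
  "sim R r r' \<Longrightarrow> rewrite R (w @ r @ q) (w @ r' @ q)"

abbreviation eqv :: "('a list \<times> 'a list) set \<Rightarrow> 'a list \<Rightarrow> 'a list \<Rightarrow> bool" where
  "eqv R \<equiv> (rewrite R)\<^sup>*\<^sup>*"

lemma stem_tail: "stem R r @ tail R r = r"
  by (simp add: stem_def tail_def)

lemma stem_tail_append: "stem R r @ tail R r @ q = r @ q"
  by (simp add: stem_def tail_def)

lemma piece_Nil [simp]: "piece R []"
  by (simp add: piece_def)

lemma pieceI:
  assumes "w \<in> relation_words R" "w' \<in> relation_words R" "w = x @ p @ y" "w' = x' @ p @ y'"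
    "w \<noteq> w' \<or> x \<noteq> x'"
  shows "piece R p"
  unfolding piece_def using assms by blast

lemma pieceE:
  assumes "piece R p" "p \<noteq> []"
  obtains w w' x y x' y' where "w \<in> relation_words R" "w' \<in> relation_words R"
    "w = x @ p @ y" "w' = x' @ p @ y'" "w \<noteq> w' \<or> x \<noteq> x'"
proof -
  have "(\<exists>w\<in>relation_words R. \<exists>w'\<in>relation_words R. w \<noteq> w' \<and>
        (\<exists>x y. w = x @ p @ y) \<and> (\<exists>x' y'. w' = x' @ p @ y')) \<or>
     (\<exists>w\<in>relation_words R. \<exists>x y x' y'. x \<noteq> x' \<and> w = x @ p @ y \<and> w = x' @ p @ y')"
    using assms unfolding piece_def by blast
  then show ?thesis
  proof (elim disjE bexE exE conjE, goal_cases)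
    case (1 w w' x x' y y')
    then show ?case using that by metis
  next
    case (2 w x y x' y')
    then show ?case using that by metis
  qed
qed

lemma piece_factor:
  assumes "piece R (a @ p @ b)"
  shows "piece R p"
proof (cases "p = []")
  case False
  then have "a @ p @ b \<noteq> []" by simp
  with assms obtain w w' x y x' y' where *: "w \<in> relation_words R" "w' \<in> relation_words R"
    "w = x @ (a @ p @ b) @ y" "w' = x' @ (a @ p @ b) @ y'" "w \<noteq> w' \<or> x \<noteq> x'"
    by (rule pieceE)
  show ?thesis
    by (rule pieceI[of w R w' "x @ a" p "b @ y" "x' @ a" "b @ y'"]) (use * in auto)
qed simp

lemma piece_prefix: "piece R (p @ b) \<Longrightarrow> piece R p"
  using piece_factor[of R "[]" p b] by simp

lemma piece_suffix: "piece R (a @ p) \<Longrightarrow> piece R p"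
  using piece_factor[of R a p "[]"] by simp

lemma piece_tail: "piece R (tail R r)"
  unfolding tail_def stem_length_def by (rule LeastI[of _ "length r"]) simp

lemma tail_longest:
  assumes "r = c @ t" "piece R t"
  shows "length t \<le> length (tail R r)"
proof -
  have "piece R (drop (length c) r)" using assms by simp
  then have "stem_length R r \<le> length c" unfolding stem_length_def by (rule Least_le)
  then show ?thesis using assms by (simp add: tail_def)
qed

lemma sim_left: "sim R r s \<Longrightarrow> r \<in> relation_words R"
  by (simp add: sim_def)

lemma sim_right: "sim R r s \<Longrightarrow> s \<in> relation_words R"
proof -
  have "(r, s) \<in> (R \<union> R\<inverse>)\<^sup>* \<Longrightarrow> r \<in> relation_words R \<Longrightarrow> s \<in> relation_words R"
    by (induction rule: rtrancl_induct) (force simp: relation_words_def)+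
  then show "sim R r s \<Longrightarrow> s \<in> relation_words R" by (simp add: sim_def)
qed

lemma sim_refl: "r \<in> relation_words R \<Longrightarrow> sim R r r"
  by (simp add: sim_def)

lemma sim_sym: "sim R r s \<Longrightarrow> sim R s r"
  using sim_right[of R r s] symD[OF sym_rtrancl[OF sym_Un_converse[of R]]]
  by (auto simp: sim_def)

lemma sim_trans: "sim R r s \<Longrightarrow> sim R s t \<Longrightarrow> sim R r t"
  by (auto simp: sim_def)

lemma rewrite_sym: "rewrite R u v \<Longrightarrow> rewrite R v u"
  by (auto elim!: rewrite.cases intro!: rewrite.intros sim_sym)

lemma rewrite_context: "rewrite R u v \<Longrightarrow> rewrite R (a @ u @ b) (a @ v @ b)"
proof (elim rewrite.cases)
  fix r r' w q assume "u = w @ r @ q" "v = w @ r' @ q" "sim R r r'"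
  then show ?thesis using rewrite.intros[of R r r' "a @ w" "q @ b"] by simp
qed

lemma rewrite_prepend: "rewrite R u v \<Longrightarrow> rewrite R (a @ u) (a @ v)"
  using rewrite_context[of R u v a "[]"] by simp

lemma rewrites_prepend: "(rewrite R ^^ k) u v \<Longrightarrow> (rewrite R ^^ k) (a @ u) (a @ v)"
  by (induction k arbitrary: v) (auto intro: rewrite_prepend)

lemma eqv_sym: "eqv R u v \<Longrightarrow> eqv R v u"
  by (metis rewrite_sym sympI symp_rtranclp sympD)

lemma eqv_context: "eqv R u v \<Longrightarrow> eqv R (a @ u @ b) (a @ v @ b)"
  by (induction rule: rtranclp_induct) (auto intro: rewrite_context rtranclp.rtrancl_into_rtrancl)

lemma eqv_prepend: "eqv R u v \<Longrightarrow> eqv R (a @ u) (a @ v)"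
  using eqv_context[of R u v a "[]"] by simp

lemma eqv_append: "eqv R u v \<Longrightarrow> eqv R (u @ b) (v @ b)"
  using eqv_context[of R u v "[]" b] by simp

lemma eqv_sim: "sim R r s \<Longrightarrow> eqv R (r @ q) (s @ q)"
  using rewrite.intros[of R r s "[]" q] by auto

section \<open>Rigidity of stems and their overlaps\<close>

locale small_overlap =
  fixes R :: "('a list \<times> 'a list) set"
  assumes C4: "weakly_C 4 R"
begin

abbreviation "W \<equiv> relation_words R"
abbreviation "H \<equiv> stem R"
abbreviation "Z \<equiv> tail R"
abbreviation "P \<equiv> piece R"
abbreviation E (infix \<open>\<approx>\<close> 50) where "u \<approx> v \<equiv> eqv R u v"

lemma not_three_pieces:
  assumes "r \<in> W" "P a" "P b" "P c"
  shows "r \<noteq> a @ b @ c"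
proof
  assume "r = a @ b @ c"
  then have "length [a, b, c] < 4 \<and> (\<forall>p\<in>set [a, b, c]. P p) \<and> r = concat [a, b, c]"
    using assms by simp
  then show False using C4 assms(1) unfolding weakly_C_def by blast
qed

text \<open>Together with the tail, two pieces would make three, fewer than the four that weak
  \<open>C(4)\<close> demands.\<close>

lemma stem_not_two_pieces: "r \<in> W \<Longrightarrow> P a \<Longrightarrow> P b \<Longrightarrow> H r \<noteq> a @ b"
  using not_three_pieces[of r a b "Z r"] piece_tail[of R r] stem_tail[of R r]
  by (metis append.assoc)

lemma stem_not_piece: "r \<in> W \<Longrightarrow> \<not> P (H r)"
  using stem_not_two_pieces[of r "H r" "[]"] by auto

lemma stem_not_Nil: "r \<in> W \<Longrightarrow> H r \<noteq> []"
  using stem_not_piece[of r] by auto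

text \<open>A word with two places among the relation words is a piece, and \<open>H r\<close>
  already has its place at the front of \<open>r\<close>.\<close>

lemma stem_occurs:
  assumes "r \<in> W" "s \<in> W" "s = x @ H r @ y"
  shows "s = r" "x = []"
proof -
  have "\<not> (r \<noteq> s \<or> [] \<noteq> x)"
  proof
    assume ne: "r \<noteq> s \<or> [] \<noteq> x"
    have "r = [] @ H r @ Z r" by (simp add: stem_tail)
    from pieceI[OF assms(1,2) this assms(3) ne] show False using stem_not_piece[OF assms(1)] by blast
  qed
  then show "s = r" "x = []" by auto
qed

lemma stem_unique:
  assumes "r \<in> W" "s \<in> W" "H r @ u = H s @ v"
  shows "r = s"
  using assms(3)
proof (rule append_cmp)
  fix e assume "H s = H r @ e"
  then show ?thesis using stem_occurs[OF assms(1,2), of "[]" "e @ Z s"] stem_tail[of R s] by simp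
next
  fix e assume "H r = H s @ e"
  then show ?thesis using stem_occurs[OF assms(2,1), of "[]" "e @ Z r"] stem_tail[of R r] by simp
qed

text \<open>By rigidity \<open>H s\<close> cannot lie inside \<open>h\<close>, so it sticks out on
  the right, and the common part \<open>d\<close> has one place in \<open>h @ k\<close> and another
  at the front of \<open>s\<close>. The word \<open>h\<close> is sometimes a stem and sometimes a
  whole relation word, whence the extra \<open>k\<close>.\<close>

lemma overlap:
  assumes W: "h @ k \<in> W" "s \<in> W" and eq: "h @ q = c @ H s @ y" and c: "c \<noteq> []" "length c < length h"
  obtains d e where "h = c @ d" "H s = d @ e" "d \<noteq> []" "P d" "q = e @ y"
proof -
  obtain d where d: "h = c @ d" "H s @ y = d @ q"
    using append_cmp_length[of c "H s @ y" h q] eq c by auto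
  have "d \<noteq> []" using c d by auto
  from d(2) show thesis
  proof (rule append_cmp)
    fix e assume "d = H s @ e"
    then have "h @ k = c @ H s @ (e @ k)" using d by simp
    then show thesis using stem_occurs[OF W(2,1)] c by blast
  next
    fix e assume e: "H s = d @ e" "q = e @ y"
    have "P d"
      by (rule pieceI[OF W(1) W(2), of c d k "[]" "e @ Z s"]) (use d e c stem_tail[of R s] in auto)
    then show thesis using that d e \<open>d \<noteq> []\<close> by blast
  qed
qed

text \<open>An occurrence of a stem that can be completed to a relation word within its class cannot
  be overlapped from the right by another stem.\<close>

lemma overlap_contradiction:
  assumes W: "r \<in> W" "s \<in> W" and eq: "H r = c @ d" "H s = d @ e" and ne: "c \<noteq> []" "d \<noteq> []"
    and alt: "e @ y = Z r @ q \<or>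
      (\<exists>b t t' u v. t \<in> W \<and> t' \<in> W \<and> e @ y = b @ H t @ u \<and> Z r @ q = b @ H t' @ v)"
  shows False
proof -
  have no_ez: False if "Z r = e @ f" for f
    using stem_occurs[OF W(2,1), of c f] that eq ne stem_tail[of R r] by simp
  have no_ze: False if "e = Z r @ f" for f
  proof -
    have "P (d @ Z r)"
      by (rule pieceI[OF W, of c "d @ Z r" "[]" "[]" "f @ Z s"])
        (use that eq ne stem_tail[of R r] stem_tail[of R s] in auto)
    then show False
      using tail_longest[of r c "d @ Z r" R] ne eq stem_tail[of R r] by simp
  qed
  \<comment> \<open>Neither of \<open>e\<close> and \<open>Z r\<close> is a prefix of the other:
    otherwise the stem of \<open>s\<close> occurs inside \<open>r\<close>, or \<open>d @ Z r\<close>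
    is a piece suffix of \<open>r\<close> longer than its tail.\<close>
  have no_cmp: False if "e @ f = Z r @ g" for f g
    using that by (rule append_cmp) (use no_ez no_ze in auto)
  from alt show False
  proof (elim disjE exE conjE)
    assume "e @ y = Z r @ q"
    then show False by (rule no_cmp)
  next
    fix b t t' u v assume t: "t \<in> W" "t' \<in> W" and *: "e @ y = b @ H t @ u" "Z r @ q = b @ H t' @ v"
    from *(1) show False
    proof (rule append_cmp)
      fix f assume f: "b = e @ f"
      then have "Z r @ q = e @ f @ H t' @ v" using * by simp
      then show False using no_cmp by metis
    next
      fix e' assume e': "e = b @ e'" "e' \<noteq> []"
      from *(2) show False
      proof (rule append_cmp)
        fix f assume f: "b = Z r @ f"
        then show False using no_ze e' by simp
      next
        fix z' assume z': "Z r = b @ z'"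
        \<comment> \<open>The word \<open>b\<close> is a common prefix of \<open>e\<close> and
          \<open>Z r\<close>, so \<open>d @ b\<close> occurs in \<open>r\<close> behind
          \<open>c\<close> and at the front of \<open>s\<close>. The rest of \<open>H s\<close> is
          overlapped by \<open>H t\<close> and hence a piece too, which makes \<open>H s\<close> a
          product of two pieces.\<close>
        have pb: "P (d @ b)"
          by (rule pieceI[OF W, of c "d @ b" z' "[]" "e' @ Z s"])
            (use z' e' eq ne stem_tail[of R r] stem_tail[of R s] in auto)
        have eq': "H s @ y = (d @ b) @ H t @ u" using eq * by simp
        have "H s @ Z s \<in> W" using W stem_tail by metis
        then obtain d' where d': "H s = (d @ b) @ d'" "P d'"
          using overlap[OF _ t(1) eq'] ne e' eq by force
        then show False using stem_not_two_pieces[OF W(2) pb d'(2)] by simp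
      qed
    qed
  qed
qed

section \<open>The leftmost stem rewritten in a derivation\<close>

abbreviation chain where
  "chain r \<equiv> (\<lambda>q q'. \<exists>s. sim R r s \<and> Z s @ q \<approx> Z s @ q')\<^sup>*\<^sup>*"

text \<open>The prefix \<open>b\<close> is never touched; \<open>r\<close> and \<open>r'\<close> are
  the relation words at the leftmost rewritten stem before its first and after its last rewriting.
  So \<open>u'\<close> is rewritten until it starts with the tail of \<open>r\<close>, and, read
  backwards, \<open>v'\<close> until it starts with the tail of \<open>r'\<close>. A link of
  \<open>chain\<close> is what happens behind the stem between two consecutive rewritings at it, the
  tail of the current word \<open>s\<close> being present both times.\<close>

abbreviation leftmost where
  "leftmost n u v b r r' u' v' q q' \<equiv> sim R r r' \<and> u = b @ H r @ u' \<and> v = b @ H r' @ v' \<and>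
    (\<exists>k<n. (rewrite R ^^ k) u' (Z r @ q)) \<and> (\<exists>k<n. (rewrite R ^^ k) v' (Z r' @ q')) \<and>
    (\<exists>k\<le>n. (rewrite R ^^ k) (H r @ u') (H r' @ v')) \<and> chain r q q'"

lemma leftmostI:
  assumes "sim R r r'" "u = b @ H r @ u'" "v = b @ H r' @ v'" "i < n"
    "(rewrite R ^^ i) u' (Z r @ q)" "j < n" "(rewrite R ^^ j) v' (Z r' @ q')" "k \<le> n"
    "(rewrite R ^^ k) (H r @ u') (H r' @ v')" "chain r q q'"
  shows "\<exists>b r r' u' v' q q'. leftmost n u v b r r' u' v' q q'"
  using assms by blast

text \<open>The bounds on the lengths of derivations only serve to make the induction work: the
  derivation from \<open>v'\<close> to \<open>Z r' @ q'\<close> is shorter than the one from \<open>u\<close> to \<open>v\<close>, so the induction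
  hypothesis applies to it and excludes rewriting steps overlapping the stem of \<open>r'\<close>.\<close>

lemma rewrites_leftmost:
  assumes "(rewrite R ^^ n) u v"
  shows "u = v \<or> (\<exists>b r r' u' v' q q'. leftmost n u v b r r' u' v' q q')"
  using assms
proof (induction n arbitrary: u v rule: less_induct)
  case (less n)
  show ?case
  proof (cases n)
    case 0
    then show ?thesis using less.prems by simp
  next
    case (Suc m)
    obtain v0 where v0: "(rewrite R ^^ m) u v0" "rewrite R v0 v"
      using less.prems Suc by auto
    from v0(2) obtain g g' w q1 where g: "sim R g g'" "v0 = w @ g @ q1" "v = w @ g' @ q1"
      by (auto elim: rewrite.cases)
    have gW: "g \<in> W" using g(1) sim_left by metis
    consider "u = v0" | b r r' u' v' q q' where "leftmost m u v0 b r r' u' v' q q'"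
    proof -
      have "u = v0 \<or> (\<exists>b r r' u' v' q q'. leftmost m u v0 b r r' u' v' q q')"
        by (rule less.IH) (use v0(1) Suc in auto)
      then show thesis
      proof (elim disjE exE)
        fix b r r' u' v' q q' assume "leftmost m u v0 b r r' u' v' q q'"
        then show thesis by (rule that(2))
      qed (rule that(1))
    qed
    then show ?thesis
    proof cases
      case 1
      have st: "(rewrite R ^^ 1) (H g @ Z g @ q1) (H g' @ Z g' @ q1)"
        using rewrite.intros[OF g(1), of "[]" q1] by (simp add: stem_tail_append eq_OO del: One_nat_def)
      show ?thesis
        by (rule disjI2, rule leftmostI[OF g(1) _ _ _ _ _ _ _ st, of u w v 0 n q1 0 q1])
          (use 1 g Suc in \<open>simp_all add: stem_tail_append\<close>)
    next
      case 2
      then have r: "sim R r r'" and u: "u = b @ H r @ u'" and v0_eq: "v0 = b @ H r' @ v'"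
        and ch: "chain r q q'" by auto
      obtain k1 where k1: "k1 < m" "(rewrite R ^^ k1) u' (Z r @ q)" using 2 by auto
      obtain k2 where k2: "k2 < m" "(rewrite R ^^ k2) v' (Z r' @ q')" using 2 by auto
      obtain k3 where k3: "k3 \<le> m" "(rewrite R ^^ k3) (H r @ u') (H r' @ v')" using 2 by auto
      have r'W: "r' \<in> W" using r sim_right by metis
      have eq: "b @ H r' @ v' = w @ H g @ Z g @ q1"
        using v0_eq g(2) by (simp add: stem_tail_append)
      consider "w = b" | c where "w = b @ c" "c \<noteq> []" | c where "b = w @ c" "c \<noteq> []"
        using eq append_eq_append_conv2[of b "H r' @ v'" w "H g @ Z g @ q1"]
        by (metis append_Nil2)
      then show ?thesis
      proof cases
        case 1
        with eq have "H r' @ v' = H g @ Z g @ q1" by simp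
        then have "r' = g" using stem_unique[OF r'W gW] by blast
        with eq 1 have v': "v' = Z g @ q1" by simp
        \<comment> \<open>The new step rewrites the leftmost stem again. Since the previous
          rewriting the text behind it went from \<open>Z g @ q'\<close> to \<open>Z g @ q1\<close>,
          which adds one link to the chain.\<close>
        have "Z g @ q' \<approx> Z g @ q1"
          using k2(2) v' \<open>r' = g\<close> by (metis eqv_sym relpowp_imp_rtranclp)
        then have ch': "chain r q q1" using ch r \<open>r' = g\<close>
          by (metis (mono_tags, lifting) rtranclp.rtrancl_into_rtrancl)
        have "rewrite R (H g @ Z g @ q1) (H g' @ Z g' @ q1)"
          using rewrite.intros[OF g(1), of "[]" q1] by (simp add: stem_tail_append)
        then have st: "(rewrite R ^^ Suc k3) (H r @ u') (H g' @ Z g' @ q1)"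
          using k3(2) \<open>r' = g\<close> v' by auto
        have "sim R r g'" using r \<open>r' = g\<close> g(1) sim_trans by metis
        then show ?thesis
          by (intro disjI2, elim leftmostI[OF _ u _ _ k1(2) _ _ _ st ch', where j = 0])
            (use g(3) 1 k1(1) k3(1) Suc in \<open>simp_all add: stem_tail_append\<close>)
      next
        case 2
        with eq have eq': "H r' @ v' = c @ H g @ Z g @ q1" by simp
        have "length (H r') \<le> length c"
        proof (rule ccontr)
          assume "\<not> ?thesis"
          then obtain d e where *: "H r' = c @ d" "H g = d @ e" "d \<noteq> []" "v' = e @ Z g @ q1"
            using overlap[OF _ gW eq' \<open>c \<noteq> []\<close>, of "Z r'"] r'W unfolding stem_tail not_le by metis
          have "v' = Z r' @ q' \<or> (\<exists>b s s' x y q1 q2. leftmost k2 v' (Z r' @ q') b s s' x y q1 q2)"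
            by (rule less.IH) (use k2 Suc in auto)
          then have "e @ (Z g @ q1) = Z r' @ q' \<or>
            (\<exists>b t t' u v. t \<in> W \<and> t' \<in> W \<and> e @ Z g @ q1 = b @ H t @ u \<and> Z r' @ q' = b @ H t' @ v)"
            unfolding *(4) by (metis sim_left sim_right)
          then show False
            using overlap_contradiction[OF r'W gW *(1,2) \<open>c \<noteq> []\<close> *(3)] by blast
        qed
        then obtain c' where c': "c = H r' @ c'" "v' = c' @ H g @ Z g @ q1"
          using append_cmp_length[OF eq'] by metis
        have v'eq: "v' = c' @ g @ q1" using c' by (simp add: stem_tail_append)
        have st: "rewrite R v' (c' @ g' @ q1)" unfolding v'eq by (rule rewrite.intros[OF g(1)])
        have st2: "(rewrite R ^^ Suc k2) (c' @ g' @ q1) (Z r' @ q')"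
          using relpowp_Suc_I2[of "rewrite R", OF rewrite_sym[OF st] k2(2)] .
        have st3: "(rewrite R ^^ Suc k3) (H r @ u') (H r' @ c' @ g' @ q1)"
          using k3(2) rewrite_prepend[OF st, of "H r'"] by auto
        show ?thesis
          by (intro disjI2 leftmostI[OF r u _ _ k1(2) _ st2 _ st3 ch])
            (use g(3) 2 c' k1(1) k2(1) k3(1) Suc in simp_all)
      next
        case 3
        with eq have eq': "g @ q1 = c @ H r' @ v'"
          by (simp add: stem_tail_append)
        \<comment> \<open>Now \<open>g\<close> becomes the leftmost word. The old leftmost stem
          cannot begin inside \<open>H g\<close>, as the overlap would be a piece suffix of
          \<open>g\<close> longer than its tail. So it lies behind \<open>H g\<close>, and the
          earlier derivation becomes the one that produces the tail of \<open>g\<close>.\<close>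
        have "length (H g) \<le> length c"
        proof (rule ccontr)
          assume less: "\<not> ?thesis"
          then have "length c < length g" using stem_tail[of R g] by (metis length_append trans_less_add1 not_le)
          then obtain d e where *: "g = c @ d" "P d"
            using overlap[of g "[]" r' q1 c v'] gW r'W eq' \<open>c \<noteq> []\<close> by auto
          show False
            using tail_longest[OF *] less arg_cong[OF stem_tail[of R g], of length] * by simp
        qed
        then obtain c' where c': "c = H g @ c'" "Z g @ q1 = c' @ H r' @ v'"
          using append_cmp_length[of "H g" "Z g @ q1" c "H r' @ v'"] eq' stem_tail_append[of R g q1]
          by metis
        have k3': "(rewrite R ^^ k3) (c' @ H r @ u') (Z g @ q1)"
          unfolding c'(2) by (rule rewrites_prepend[OF k3(2)])
        have st: "(rewrite R ^^ Suc k3) (H g @ c' @ H r @ u') (H g' @ Z g' @ q1)"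
        proof -
          have "rewrite R (H g @ Z g @ q1) (H g' @ Z g' @ q1)"
            using rewrite.intros[OF g(1), of "[]" q1] by (simp add: stem_tail_append)
          then show ?thesis using rewrites_prepend[OF k3', of "H g"] by auto
        qed
        show ?thesis
          by (intro disjI2 leftmostI[OF g(1) _ _ _ k3' _ _ _ st, where j = 0 and q' = q1])
            (use g(3) u 3 c' k3(1) Suc in \<open>simp_all add: stem_tail_append\<close>)
      qed
    qed
  qed
qed

end

section \<open>Equivalence of words starting with a stem\<close>

text \<open>The substitute for \<open>realised\<close> that a bounded prefix decides. It is only
  necessary for it, but it already confines where a leftmost rewriting can take place.\<close>

definition clean :: "('a list \<times> 'a list) set \<Rightarrow> 'a list \<Rightarrow> 'a list \<Rightarrow> bool" where
  "clean R u r \<longleftrightarrow> prefix (stem R r) u \<and>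
    \<not> (\<exists>s\<in>relation_words R. \<exists>i. 0 < i \<and> i < length (stem R r) \<and> prefix (stem R s) (drop i u))"

text \<open>The decidable counterpart of \<open>active\<close>: it leaves open whether the stem can
  be completed.\<close>

definition starts_stem :: "('a list \<times> 'a list) set \<Rightarrow> 'a list \<Rightarrow> 'a list \<Rightarrow> bool" where
  "starts_stem R z q \<longleftrightarrow> z \<noteq> [] \<and> (\<exists>t\<in>relation_words R. prefix (stem R t) (z @ q))"

context small_overlap
begin

lemma eqv_leftmost:
  assumes "u \<approx> v"
  obtains (eq) "u = v"
  | (rewritten) b r r' u' v' q q' where "sim R r r'" "u = b @ H r @ u'" "v = b @ H r' @ v'"
    "u' \<approx> Z r @ q" "v' \<approx> Z r' @ q'" "H r @ u' \<approx> H r' @ v'" "chain r q q'"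
proof -
  obtain n where "(rewrite R ^^ n) u v" using assms rtranclp_imp_relpowp by metis
  from rewrites_leftmost[OF this] show thesis
  proof (elim disjE exE conjE, goal_cases)
    case (2 b r r' u' v' q q' k1 k2 k3)
    show thesis
      by (rule rewritten[of r r' b u' v' q q']) (use 2 relpowp_imp_rtranclp in auto)
  qed (rule eq)
qed

definition realised where
  "realised r u \<longleftrightarrow> r \<in> W \<and> (\<exists>u' q. u = H r @ u' \<and> u' \<approx> Z r @ q)"

lemma realised_clean:
  assumes "realised r u"
  shows "clean R u r"
proof -
  obtain u' q where r: "r \<in> W" and u: "u = H r @ u'" "u' \<approx> Z r @ q"
    using assms by (auto simp: realised_def)
  have False if s: "s \<in> W" and i: "0 < i" "i < length (H r)" "prefix (H s) (drop i u)" for s i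
  proof -
    obtain y where "drop i u = H s @ y" using i(3) by (auto elim: prefixE)
    then have eq: "H r @ u' = take i u @ H s @ y" using u(1) by (metis append_take_drop_id)
    have c: "take i u \<noteq> []" "length (take i u) < length (H r)" using i u(1) by auto
    obtain d e where *: "H r = take i u @ d" "H s = d @ e" "d \<noteq> []" "u' = e @ y"
      using overlap[OF _ s eq c, of "Z r"] r unfolding stem_tail by metis
    have "e @ y = Z r @ q \<or>
      (\<exists>b t t' u v. t \<in> W \<and> t' \<in> W \<and> e @ y = b @ H t @ u \<and> Z r @ q = b @ H t' @ v)"
      using u(2)
    proof (cases rule: eqv_leftmost)
      case (rewritten b t t' v w)
      then show ?thesis using sim_left sim_right unfolding *(4) by blast
    qed (use *(4) in simp)
    then show False
      using overlap_contradiction[OF r s *(1,2) c(1) *(3)] by blast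
  qed
  then show ?thesis using u by (auto simp: clean_def)
qed

text \<open>No stem starts strictly inside a clean one, so a leftmost rewriting away from the front
  happens behind it and leaves it intact.\<close>

lemma clean_leftmost:
  assumes "clean R u r" "u = b @ H s @ y" "s \<in> W" "b \<noteq> []"
  obtains b' where "b = H r @ b'"
proof -
  have "length (H r) \<le> length b"
  proof (rule ccontr)
    assume "\<not> ?thesis"
    then have "length b < length (H r)" "0 < length b" using assms(4) by auto
    moreover have "prefix (H s) (drop (length b) u)" using assms(2) by simp
    ultimately show False using assms(1,3) unfolding clean_def by blast
  qed
  moreover obtain u' where "u = H r @ u'" using assms(1) by (auto simp: clean_def elim: prefixE)
  ultimately show thesis using that append_cmp_length[of "H r" u' b "H s @ y"] assms(2) by metis
qed

section \<open>Active suffixes and links\<close>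

definition active where
  "active z q \<longleftrightarrow> z \<noteq> [] \<and> (\<exists>t. realised t (z @ q))"

lemma active_starts_stem: "active z q \<Longrightarrow> starts_stem R z q"
  unfolding active_def starts_stem_def realised_def by (metis prefixI)

text \<open>The stem starting at \<open>y\<close> reaches past the piece \<open>y\<close> by some
  \<open>h\<close> at the front of \<open>q\<close> that is not a piece. Two such remainders are
  comparable as prefixes of \<open>q\<close>; the shorter one has only one place among the relation
  words, and this forces the texts in front of it to agree.\<close>

lemma starts_stem_unique:
  assumes "starts_stem R y q" "starts_stem R z q" "P y" "P z"
  shows "y = z"
proof -
  have split: "\<exists>t h x. t \<in> W \<and> H t = y @ h \<and> q = h @ x \<and> \<not> P h" if y: "starts_stem R y q" "P y" for y
  proof -
    obtain t x where t: "t \<in> W" "y @ q = H t @ x"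
      using y by (auto simp: starts_stem_def elim!: prefixE)
    from t(2) show ?thesis
    proof (rule append_cmp)
      fix h assume h: "H t = y @ h" "q = h @ x"
      then show ?thesis using stem_not_two_pieces[OF t(1) y(2)] t(1) by blast
    next
      fix h assume "y = H t @ h"
      then show ?thesis using stem_not_piece[OF t(1)] piece_prefix y(2) by metis
    qed
  qed
  obtain t h x where t: "t \<in> W" "H t = y @ h" "q = h @ x" "\<not> P h" using split assms by blast
  obtain t' h' x' where t': "t' \<in> W" "H t' = z @ h'" "q = h' @ x'" "\<not> P h'"
    using split assms by blast
  from t(3) t'(3) have "h @ x = h' @ x'" by simp
  then show ?thesis
  proof (rule append_cmp)
    fix e assume "h' = h @ e"
    then show ?thesis
      using pieceI[OF t(1) t'(1), of y h "Z t" z "e @ Z t'"] t t' stem_tail[of R t] stem_tail[of R t']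
      by auto
  next
    fix e assume "h = h' @ e"
    then show ?thesis
      using pieceI[OF t(1) t'(1), of y h' "e @ Z t" z "Z t'"] t t' stem_tail[of R t] stem_tail[of R t']
      by auto
  qed
qed

text \<open>Repeated rewriting at one stem uses the tails of several relation words of its class one after
  another. By uniqueness of the active suffix a single one of them suffices, which makes the
  relation below transitive.\<close>

definition link where
  "link r q q' \<longleftrightarrow> q \<approx> q' \<or>
    (\<exists>z s. sim R r s \<and> suffix z (Z s) \<and> active z q \<and> active z q' \<and> z @ q \<approx> z @ q')"

lemma link_sim: "sim R r s \<Longrightarrow> link r = link s"
  unfolding link_def by (intro ext) (meson sim_sym sim_trans)

lemma link_sym: "link r q q' \<Longrightarrow> link r q' q"
  unfolding link_def by (meson eqv_sym)

lemma link_eqv: "q \<approx> q' \<Longrightarrow> link r q q'"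
  by (simp add: link_def)

text \<open>The leftmost rewritten stem starts either behind \<open>y\<close>, which is then kept,
  or inside \<open>y\<close>, and then only the part \<open>b\<close> in front of it is
  kept.\<close>

lemma eqv_split:
  assumes "y @ q \<approx> v"
  obtains q' where "v = y @ q'" "q \<approx> q'"
  | b z t t' q' where "y = b @ z" "z \<noteq> []" "sim R t t'" "realised t (z @ q)" "realised t' q'"
    "v = b @ q'" "z @ q \<approx> q'"
proof -
  show thesis using assms
  proof (cases rule: eqv_leftmost)
    case eq
    then show ?thesis using that(1) by blast
  next
    case 2: (rewritten b r r' u' v' p p')
    from 2(2) show thesis
    proof (rule append_cmp)
      fix e assume e: "b = y @ e" "q = e @ H r @ u'"
      show thesis by (rule that(1)[of "e @ H r' @ v'"]) (use e 2 eqv_prepend in auto)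
    next
      fix e assume e: "y = b @ e" "H r @ u' = e @ q" "e \<noteq> []"
      have "realised r (H r @ u')" "realised r' (H r' @ v')"
        using 2 sim_left sim_right by (auto simp: realised_def)
      then show thesis using that(2)[OF e(1,3) 2(1)] 2 unfolding e(2) by blast
    qed
  qed
qed

text \<open>A leftmost rewriting at the front exchanges the stem within its class; a later one
  happens behind the clean stem and keeps its tail reachable.\<close>

lemma realised_eqv:
  assumes "realised t u" "u \<approx> v"
  shows "\<exists>t'. realised t' v"
  using assms(2)
proof (cases rule: eqv_leftmost)
  case (rewritten b s s' x y q q')
  obtain u' p where t: "t \<in> W" "u = H t @ u'" "u' \<approx> Z t @ p"
    using assms(1) by (auto simp: realised_def)
  show ?thesis
  proof (cases "b = []")
    case True
    then show ?thesis using rewritten sim_right by (auto simp: realised_def)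
  next
    case False
    obtain b' where b': "b = H t @ b'"
      using clean_leftmost[OF realised_clean[OF assms(1)] rewritten(2) sim_left[OF rewritten(1)] False] .
    then have "u' = b' @ H s @ x" using t rewritten by simp
    then have "b' @ H s' @ y \<approx> u'" using rewritten eqv_prepend eqv_sym by metis
    then have "b' @ H s' @ y \<approx> Z t @ p" using t(3) by simp
    then show ?thesis using t rewritten b' by (auto simp: realised_def)
  qed
qed (use assms in blast)

lemma active_eqv: "active z q \<Longrightarrow> z @ q \<approx> z @ q' \<Longrightarrow> active z q'"
  using realised_eqv by (auto simp: active_def)

lemma active_unique: "active y q \<Longrightarrow> active z q \<Longrightarrow> P y \<Longrightarrow> P z \<Longrightarrow> y = z"
  using starts_stem_unique active_starts_stem by blast

lemma piece_suffix_tail: "suffix z (Z r) \<Longrightarrow> P z"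
  using piece_tail piece_suffix by (metis suffixE)

text \<open>Either the tail is untouched and can be cancelled, or the leftmost rewriting begins
  inside it, and the suffix from there on is active.\<close>

lemma tail_cancel:
  assumes "sim R r s" "Z s @ q \<approx> Z s @ q'"
  shows "link r q q'"
  using assms(2)
proof (cases rule: eqv_split)
  case (2 b z t t' w)
  then have "w = z @ q'" by simp
  then show ?thesis using 2 assms(1) unfolding link_def active_def suffix_def by metis
qed (simp add: link_def)

lemma link_trans:
  assumes "link r a b" "link r b c"
  shows "link r a c"
proof -
  consider "a \<approx> b" "b \<approx> c" |
    z s where "a \<approx> b" "sim R r s" "suffix z (Z s)" "active z b" "z @ b \<approx> z @ c" |
    z s where "b \<approx> c" "sim R r s" "suffix z (Z s)" "active z a" "active z b" "z @ a \<approx> z @ b" |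
    z s z' s' where "sim R r s" "suffix z (Z s)" "active z a" "active z b" "z @ a \<approx> z @ b"
      "suffix z' (Z s')" "active z' b" "active z' c" "z' @ b \<approx> z' @ c"
    using assms unfolding link_def by blast
  then show ?thesis
  proof cases
    case 1
    then have "a \<approx> c" by (rule rtranclp_trans)
    then show ?thesis by (simp add: link_def)
  next
    case 2
    have "z @ a \<approx> z @ b" using 2 eqv_prepend by blast
    then have "z @ a \<approx> z @ c" "active z a" "active z c"
      using 2 active_eqv eqv_sym rtranclp_trans by metis+
    then show ?thesis using 2 by (auto simp: link_def)
  next
    case 3
    have "z @ b \<approx> z @ c" using 3 eqv_prepend by blast
    then have "z @ a \<approx> z @ c" "active z c"
      using 3 active_eqv rtranclp_trans by metis+
    then show ?thesis using 3 by (auto simp: link_def)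
  next
    case 4
    \<comment> \<open>Both suffixes are active in front of the same word \<open>b\<close>.\<close>
    have "z = z'" using 4 active_unique piece_suffix_tail by metis
    then have "z @ a \<approx> z @ c" using 4 rtranclp_trans by metis
    then show ?thesis using 4 \<open>z = z'\<close> by (auto simp: link_def)
  qed
qed

lemma chain_link: "chain r q q' \<Longrightarrow> link r q q'"
proof (induction rule: rtranclp_induct)
  case base
  then show ?case by (simp add: link_def)
next
  case (step y z)
  then show ?case using tail_cancel link_trans by blast
qed

section \<open>Equivalence behind two stems of one class\<close>

lemma link_tail:
  assumes "r \<in> W" "link r q q'"
  obtains s where "sim R r s" "Z s @ q \<approx> Z s @ q'"
proof -
  from assms(2) consider "q \<approx> q'" | z s b where "sim R r s" "Z s = b @ z" "z @ q \<approx> z @ q'"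
    unfolding link_def by (auto elim!: suffixE)
  then show thesis
  proof cases
    case 1
    then show ?thesis using that[of r] assms sim_refl eqv_prepend by blast
  next
    case 2
    then show ?thesis using that[of s] eqv_prepend[of R "z @ q" "z @ q'" b] by simp
  qed
qed

text \<open>Equivalence through actual rewriting at the stem: each side has to be able to produce
  its tail, and the rests are linked.\<close>

definition paired where
  "paired r r' u v \<longleftrightarrow> (\<exists>q q'. u \<approx> Z r @ q \<and> v \<approx> Z r' @ q' \<and> link r q q')"

lemma paired_sym: "sim R r r' \<Longrightarrow> paired r r' u v \<Longrightarrow> paired r' r v u"
  unfolding paired_def using link_sim[of r r'] link_sym[of r'] by metis

text \<open>The leftmost rewriting is either at the front, where its chain yields a link, or behind
  the clean stem.\<close>

lemma eqv_clean:
  assumes "r \<in> W" "clean R (H r @ u') r" "H r @ u' \<approx> v"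
  obtains r' v' where "sim R r r'" "v = H r' @ v'" "r' = r \<and> u' \<approx> v' \<or> paired r r' u' v'"
  using assms(3)
proof (cases rule: eqv_leftmost)
  case eq
  then show ?thesis using that[of r u'] assms sim_refl by auto
next
  case (rewritten b s s' x y q q')
  show ?thesis
  proof (cases "b = []")
    case True
    then have eq: "H r @ u' = H s @ x" using rewritten by simp
    have "r = s" using stem_unique[OF assms(1) sim_left[OF rewritten(1)] eq] .
    then show ?thesis
      using that[of s' y] rewritten True chain_link[OF rewritten(7)] by (auto simp: paired_def)
  next
    case False
    obtain b' where b': "b = H r @ b'"
      using clean_leftmost[OF assms(2) rewritten(2) sim_left[OF rewritten(1)] False] .
    then have "u' = b' @ H s @ x" using rewritten by simp
    then have "u' \<approx> b' @ H s' @ y" using rewritten eqv_prepend by metis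
    then show ?thesis using that[OF sim_refl[OF assms(1)], of "b' @ H s' @ y"] rewritten b' by simp
  qed
qed

text \<open>Both stems are completed, and a class member \<open>s\<close> whose tail makes the rests
  equivalent serves as a bridge: \<open>H r @ u\<close>, \<open>r @ q\<close>, \<open>s @ q\<close>,
  \<open>s @ q'\<close>, \<open>r' @ q'\<close>, \<open>H r' @ v\<close>.\<close>

lemma paired_eqv:
  assumes "sim R r r'" "paired r r' u v"
  shows "H r @ u \<approx> H r' @ v"
proof -
  obtain q q' where q: "u \<approx> Z r @ q" "v \<approx> Z r' @ q'" "link r q q'"
    using assms(2) by (auto simp: paired_def)
  obtain s where s: "sim R r s" "Z s @ q \<approx> Z s @ q'"
    using link_tail[OF sim_left[OF assms(1)] q(3)] .
  have "H r @ u \<approx> r @ q" using eqv_prepend[OF q(1), of "H r"] by (simp add: stem_tail_append)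
  also have "r @ q \<approx> s @ q" using s(1) eqv_sim by blast
  also have "s @ q \<approx> s @ q'" using eqv_prepend[OF s(2), of "H s"] by (simp add: stem_tail_append)
  also have "s @ q' \<approx> r' @ q'" using s(1) assms(1) sim_sym sim_trans eqv_sim by metis
  also have "r' @ q' \<approx> H r' @ v"
    using eqv_sym[OF eqv_prepend[OF q(2), of "H r'"]] by (simp add: stem_tail_append)
  finally (rtranclp_trans) show ?thesis .
qed

text \<open>A rewriting at the front would need a realised, hence clean, stem there.\<close>

lemma eqv_not_clean:
  assumes "\<not> (\<exists>r\<in>W. clean R (a # u) r)" "a # u \<approx> v"
  obtains v' where "v = a # v'" "u \<approx> v'"
  using assms(2)
proof (cases rule: eqv_leftmost)
  case eq
  then show ?thesis using that by blast
next
  case (rewritten b s s' x y q q')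
  have "b \<noteq> []"
  proof
    assume "b = []"
    then have "realised s (a # u)" using rewritten sim_left by (auto simp: realised_def)
    then show False using assms(1) realised_clean rewritten(1) sim_left by blast
  qed
  then obtain b' where "b = a # b'" using rewritten by (cases b) auto
  then show ?thesis
    using that[of "b' @ H s' @ y"] rewritten eqv_prepend[OF rewritten(6), of b'] by simp
qed

lemma eqv_Nil: "[] \<approx> v \<Longrightarrow> v = []"
  by (erule eqv_leftmost) (use stem_not_Nil sim_left in auto)

lemma paired_both:
  assumes "sim R r r'"
  shows "paired r r' (Z r @ u) (Z r' @ v) \<longleftrightarrow> link r u v"
proof
  assume "paired r r' (Z r @ u) (Z r' @ v)"
  then obtain q q' where "Z r @ u \<approx> Z r @ q" "Z r' @ v \<approx> Z r' @ q'" "link r q q'"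
    by (auto simp: paired_def)
  then show "link r u v"
    using tail_cancel sim_refl[OF sim_left[OF assms]] assms link_sym link_trans by metis
qed (auto simp: paired_def)

lemma eqv_not_prefix:
  assumes "v \<approx> y @ q" "\<not> prefix y v"
  obtains b z w where "y = b @ z" "active z q" "v = b @ w" "w \<approx> z @ q"
  using eqv_sym[OF assms(1)]
proof (cases rule: eqv_split)
  case 1
  then show ?thesis using assms(2) by simp
next
  case (2 b z t t' w)
  then show ?thesis using that[of b z w] eqv_sym by (auto simp: active_def)
qed

lemma suffix_tailI: "Z r = b @ z \<Longrightarrow> suffix z (Z r)"
  by (simp add: suffix_def)

text \<open>Since \<open>v\<close> does not show the tail, it must come from a rewriting that starts
  inside it, so some suffix of \<open>Z r'\<close> is active before \<open>q'\<close>. If the link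
  uses an active suffix, it is this one by uniqueness, and the link extends to all of
  \<open>Z r'\<close>.\<close>

lemma paired_left:
  assumes "sim R r r'" "\<not> prefix (Z r') v"
  shows "paired r r' (Z r @ u) v \<longleftrightarrow> v \<approx> Z r' @ u"
proof
  assume "paired r r' (Z r @ u) v"
  then obtain q q' where q: "Z r @ u \<approx> Z r @ q" "v \<approx> Z r' @ q'" "link r q q'"
    by (auto simp: paired_def)
  have "link r u q'"
    using tail_cancel[OF sim_refl[OF sim_left[OF assms(1)]] q(1)] q(3) by (rule link_trans)
  moreover have "Z r' @ u \<approx> Z r' @ q'"
    if z: "suffix z (Z s)" "active z q'" "z @ u \<approx> z @ q'" for z s
  proof -
    obtain b y w where y: "Z r' = b @ y" "active y q'"
      using eqv_not_prefix[OF q(2) assms(2)] by metis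
    then have "y = z"
      using active_unique z piece_suffix_tail suffix_tailI by metis
    then show ?thesis using y z eqv_prepend[of R "z @ u" "z @ q'" b] by simp
  qed
  ultimately have "Z r' @ u \<approx> Z r' @ q'" using eqv_prepend by (auto simp: link_def)
  then show "v \<approx> Z r' @ u" using q(2) eqv_sym rtranclp_trans by metis
next
  assume "v \<approx> Z r' @ u"
  then show "paired r r' (Z r @ u) v" by (auto simp: paired_def intro!: exI[of _ u] link_eqv)
qed

lemma paired_right:
  assumes "sim R r r'" "\<not> prefix (Z r) u"
  shows "paired r r' u (Z r' @ v) \<longleftrightarrow> u \<approx> Z r @ v"
  using paired_left[OF sim_sym[OF assms(1)] assms(2)] paired_sym assms(1) sim_sym by metis

text \<open>Each tail has an active suffix, and by the link and uniqueness these are the same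
  \<open>z\<close>. That \<open>u'\<close> can be brought to start with \<open>z\<close> is an
  obligation that remains; it becomes the required piece.\<close>

lemma paired_neither:
  assumes "sim R r r'" "\<not> prefix (Z r) u" "\<not> prefix (Z r') v" "paired r r' u v"
  obtains b b' z u' v' q where "Z r = b @ z" "Z r' = b' @ z" "u = b @ u'" "v = b' @ v'"
    "u' \<approx> v'" "u' \<approx> z @ q"
proof -
  obtain q q' where q: "u \<approx> Z r @ q" "v \<approx> Z r' @ q'" "link r q q'"
    using assms(4) by (auto simp: paired_def)
  obtain b z u' where u: "Z r = b @ z" "active z q" "u = b @ u'" "u' \<approx> z @ q"
    using eqv_not_prefix[OF q(1) assms(2)] .
  obtain b' z' v' where v: "Z r' = b' @ z'" "active z' q'" "v = b' @ v'" "v' \<approx> z' @ q'"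
    using eqv_not_prefix[OF q(2) assms(3)] .
  have P: "P z" "P z'" using u v piece_suffix_tail suffix_tailI by metis+
  have "z = z' \<and> z @ q \<approx> z @ q'"
    using q(3) unfolding link_def
  proof (elim disjE exE conjE)
    assume "q \<approx> q'"
    then have "z @ q \<approx> z @ q'" using eqv_prepend by blast
    then show ?thesis using active_eqv u v P active_unique by metis
  next
    fix y s assume "suffix y (Z s)" "active y q" "active y q'" "y @ q \<approx> y @ q'"
    then show ?thesis using u v P active_unique piece_suffix_tail by metis
  qed
  then have "u' \<approx> v'" using u(4) v(4) eqv_sym rtranclp_trans by metis
  then show thesis using that u v \<open>z = z' \<and> _\<close> by metis
qed

end

section \<open>Reducing a pair of words\<close>

definition word_list :: "('a list \<times> 'a list) list \<Rightarrow> 'a list list" where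
  "word_list rs = map fst rs @ map snd rs"

lemma set_word_list [simp]: "set (word_list rs) = relation_words (set rs)"
  by (simp add: word_list_def relation_words_def)

definition tails :: "'a list \<Rightarrow> 'a list list" where
  "tails xs = map (\<lambda>n. drop n xs) [0..<Suc (length xs)]"

lemma set_tails [simp]: "set (tails xs) = {ys. suffix ys xs}"
proof -
  have "\<exists>n\<le>length xs. ys = drop n xs" if "suffix ys xs" for ys
    using that by (intro exI[of _ "length xs - length ys"]) (auto simp: suffix_def)
  then show ?thesis
    by (fastforce simp: tails_def suffix_drop less_Suc_eq_le simp del: upt_Suc)
qed

definition tail_suffixes :: "('a list \<times> 'a list) list \<Rightarrow> 'a list \<Rightarrow> 'a list list" where
  "tail_suffixes rs r =
     concat (map (\<lambda>s. tails (tail (set rs) s)) (filter (sim (set rs) r) (word_list rs)))"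

lemma set_tail_suffixes:
  "set (tail_suffixes rs r) = {z. \<exists>s. sim (set rs) r s \<and> suffix z (tail (set rs) s)}"
  using sim_right by (fastforce simp: tail_suffixes_def)

definition unshared_length :: "'a list \<Rightarrow> 'a list \<Rightarrow> nat" where
  "unshared_length x y = (LEAST n. suffix (drop n x) y)"

lemma unshared_length:
  assumes "suffix z x" "suffix z y"
  shows "suffix (drop (unshared_length x y) x) y"
    "suffix z (drop (unshared_length x y) x)"
    "unshared_length x y \<le> length x"
proof -
  obtain b where x: "x = b @ z" using assms(1) by (auto simp: suffix_def)
  have *: "suffix (drop (length b) x) y" using x assms(2) by simp
  show "suffix (drop (unshared_length x y) x) y"
    unfolding unshared_length_def by (rule LeastI[of "\<lambda>n. suffix (drop n x) y", OF *])
  have le: "unshared_length x y \<le> length b"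
    unfolding unshared_length_def by (rule Least_le[of "\<lambda>n. suffix (drop n x) y", OF *])
  then show "suffix z (drop (unshared_length x y) x)" using x by (simp add: suffix_def)
  show "unshared_length x y \<le> length x" using le x by simp
qed

text \<open>Here \<open>u\<close> and \<open>v\<close> are what follows the stems of the equivalent relation words \<open>r\<close> and \<open>r'\<close>. If both tails
  are present, an active suffix of some tail of the class has to be restored. If one tail is
  missing, it can only arise by rewriting, so it is moved to the other side; if both are, their
  longest common suffix becomes the new required piece.\<close>

definition reduce_stem where
  "reduce_stem rs r r' p u v =
    (let z = tail (set rs) r; z' = tail (set rs) r'; u1 = drop (length z) u; v1 = drop (length z') v;
       n = unshared_length z z'; c = drop n z; n' = length z' - length c
     in if prefix z u \<and> prefix z' v then
          (case find (\<lambda>y. starts_stem (set rs) y u1) (tail_suffixes rs r) of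
             None \<Rightarrow> Some (u1, v1, []) | Some y \<Rightarrow> Some (y @ u1, y @ v1, []))
        else if prefix z u then Some (z' @ u1, v, [])
        else if prefix z' v then Some (u, z @ v1, [])
        else if r = r' \<and> prefix p r then Some (u, v, [])
        else if prefix (take n z) u \<and> prefix (take n' z') v then Some (drop n u, drop n' v, c)
        else None)"

text \<open>A required piece can only be met inside a stem of the class, so it is tested here and
  then mostly forgotten; \<open>reduce_stem\<close> consults \<open>p\<close> again only when the
  stem may have to stay as it is.\<close>

definition reduce where
  "reduce rs u v p =
    (case find (clean (set rs) u) (word_list rs) of
       None \<Rightarrow> if u \<noteq> [] \<and> v \<noteq> [] \<and> hd u = hd v \<and> (p = [] \<or> hd p = hd u)
         then Some (tl u, tl v, tl p) else None
     | Some r \<Rightarrow>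
         (case find (\<lambda>s. sim (set rs) r s \<and> prefix (stem (set rs) s) v) (word_list rs) of
            None \<Rightarrow> None
          | Some r' \<Rightarrow> if \<exists>s\<in>set (word_list rs). sim (set rs) r s \<and> prefix p s
              then reduce_stem rs r r' p (drop (length (stem (set rs) r)) u)
                (drop (length (stem (set rs) r')) v)
              else None))"

definition prefixed_eqv where
  "prefixed_eqv R p u v \<longleftrightarrow> eqv R u v \<and> (\<exists>q. eqv R u (p @ q))"

lemma prefixed_eqv_Nil: "prefixed_eqv R [] u v \<longleftrightarrow> eqv R u v"
  by (auto simp: prefixed_eqv_def)

text \<open>The value \<open>None\<close> stands for a reduction that has refuted the
  condition.\<close>

definition holds where
  "holds R x \<longleftrightarrow> (case x of None \<Rightarrow> False | Some (u, v, p) \<Rightarrow> prefixed_eqv R p u v)"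

lemma holds_simps [simp]:
  "\<not> holds R None" "holds R (Some (u, v, p)) \<longleftrightarrow> prefixed_eqv R p u v"
  by (simp_all add: holds_def)

section \<open>Correctness of the reduction\<close>

context small_overlap
begin

lemma piece_before_stem:
  assumes "p @ q = H t @ w" "P p" "t \<in> W"
  shows "prefix p (H t)"
  using assms(1)
proof (rule append_cmp)
  fix e assume "p = H t @ e"
  then show ?thesis using assms stem_not_piece piece_prefix by metis
qed simp

text \<open>If the words are paired, \<open>H r @ u\<close> is equivalent to a word starting with
  \<open>r\<close>, hence to one starting with \<open>s\<close>, and the condition on
  \<open>p\<close> is automatic. If not, the stem of \<open>r\<close> stays at the front of every
  equivalent word, and a piece in front of a word starting with a stem is a prefix of that
  stem.\<close>

lemma prefixed_eqv_stem:
  assumes "clean R (H r @ u) r" "sim R r r'" "P p" "sim R r s" "prefix p s"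
  shows "prefixed_eqv R p (H r @ u) (H r' @ v) \<longleftrightarrow>
    r = r' \<and> prefix p r \<and> u \<approx> v \<or> paired r r' u v"
proof -
  have W: "r \<in> W" "r' \<in> W" "s \<in> W" using assms sim_left sim_right by auto
  have stem_prefix: "prefix p t \<longleftrightarrow> prefix p (H t)" if "t \<in> W" for t
  proof
    assume "prefix p t"
    moreover have "prefix (H t) t" using stem_tail prefixI by metis
    ultimately consider "prefix p (H t)" | "prefix (H t) p" using prefix_same_cases by blast
    then show "prefix p (H t)"
      using stem_not_piece[OF that] assms(3) piece_prefix by cases (auto elim!: prefixE)
  next
    assume "prefix p (H t)"
    then show "prefix p t" using stem_tail prefixI prefix_order.trans by metis
  qed
  have "paired r r u' v' \<Longrightarrow> \<exists>q. H r @ u' \<approx> p @ q" for u' v'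
  proof -
    assume "paired r r u' v'"
    then obtain q where "u' \<approx> Z r @ q" by (auto simp: paired_def)
    then have "H r @ u' \<approx> r @ q" using eqv_prepend[of R u' "Z r @ q" "H r"] by (simp add: stem_tail_append)
    moreover have "r @ q \<approx> s @ q" using assms(4) eqv_sim by blast
    ultimately have "H r @ u' \<approx> s @ q" by (rule rtranclp_trans)
    moreover obtain k where "s = p @ k" using assms(5) by (auto elim: prefixE)
    ultimately show ?thesis by auto
  qed
  moreover have "paired r t u' v' \<Longrightarrow> paired r r u' u'" for t u' v'
    using link_eqv[of _ _ r] unfolding paired_def by blast
  ultimately have paired_prefix: "paired r t u' v' \<Longrightarrow> \<exists>q. H r @ u' \<approx> p @ q" for t u' v'
    by blast
  show ?thesis
  proof
    assume L: "prefixed_eqv R p (H r @ u) (H r' @ v)"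
    then have "H r @ u \<approx> H r' @ v" by (simp add: prefixed_eqv_def)
    then obtain t w where t: "sim R r t" "H r' @ v = H t @ w" "t = r \<and> u \<approx> w \<or> paired r t u w"
      using eqv_clean[OF W(1) assms(1)] by metis
    have "t = r'" using stem_unique[OF sim_right[OF t(1)] W(2)] t(2) by metis
    with t have t: "r' = r \<and> u \<approx> v \<or> paired r r' u v" by auto
    show "r = r' \<and> prefix p r \<and> u \<approx> v \<or> paired r r' u v"
    proof (cases "paired r r' u v \<or> prefix p r")
      case True
      then show ?thesis using t by auto
    next
      case False
      then have r: "r' = r" "u \<approx> v" using t by auto
      obtain q where "H r @ u \<approx> p @ q" using L by (auto simp: prefixed_eqv_def)
      then obtain t' w where t': "sim R r t'" "p @ q = H t' @ w" "t' = r \<and> u \<approx> w \<or> paired r t' u w"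
        using eqv_clean[OF W(1) assms(1)] by metis
      have "prefix p (H t')"
        using piece_before_stem[OF t'(2) assms(3) sim_right[OF t'(1)]] .
      then have "t' \<noteq> r" using False stem_prefix W by auto
      then obtain a where a: "u \<approx> Z r @ a" using t' by (auto simp: paired_def)
      then have "v \<approx> Z r @ a" using rtranclp_trans[OF eqv_sym[OF r(2)]] by blast
      then have "paired r r u v" using a link_eqv[of a a r] unfolding paired_def by blast
      then show ?thesis using r by simp
    qed
  next
    assume "r = r' \<and> prefix p r \<and> u \<approx> v \<or> paired r r' u v"
    then show "prefixed_eqv R p (H r @ u) (H r' @ v)"
    proof
      assume *: "r = r' \<and> prefix p r \<and> u \<approx> v"
      then obtain k where "H r = p @ k" using stem_prefix W by (auto elim: prefixE)
      then have "H r @ u \<approx> p @ (k @ u)" by simp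
      then show ?thesis using * eqv_prepend unfolding prefixed_eqv_def by blast
    next
      assume "paired r r' u v"
      then show ?thesis
        using paired_eqv assms(2) paired_prefix unfolding prefixed_eqv_def by blast
    qed
  qed
qed

lemma reduce_stem_correct:
  assumes R: "R = set rs" and "clean R (H r @ u) r" "sim R r r'" "P p" "sim R r s" "prefix p s"
  shows "prefixed_eqv R p (H r @ u) (H r' @ v) \<longleftrightarrow> holds R (reduce_stem rs r r' p u v)"
  unfolding prefixed_eqv_stem[OF assms(2-)]
proof -
  have r: "r \<in> W" using assms(3) sim_left by blast
  define z z' n where "z = Z r" "z' = Z r'" "n = unshared_length z z'"
  define c where "c = drop n z"
  have c: "suffix c z" "suffix c z'"
    using unshared_length(1)[of "[]" z z'] by (auto simp: c_def z_z'_n_def suffix_drop)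
  let ?n' = "length z' - length c"
  have n: "n \<le> length z" using unshared_length(3)[of "[]" z z'] by (simp add: z_z'_n_def)
  have z: "z = take n z @ c" "z' = take ?n' z' @ c"
    using c(2) by (auto simp: c_def suffix_def)
  consider (both) "prefix z u" "prefix z' v" | (left) "prefix z u" "\<not> prefix z' v"
    | (right) "\<not> prefix z u" "prefix z' v" | (neither) "\<not> prefix z u" "\<not> prefix z' v"
    by blast
  then show "r = r' \<and> prefix p r \<and> u \<approx> v \<or> paired r r' u v \<longleftrightarrow>
    holds R (reduce_stem rs r r' p u v)"
  proof cases
    case both
    then obtain u1 v1 where uv: "u = Z r @ u1" "v = Z r' @ v1"
      by (auto simp: z_z'_n_def elim!: prefixE)
    have "paired r r' u v" if "r = r'" "u \<approx> v"
      using that uv link_eqv[of u1 u1 r] eqv_sym unfolding paired_def by blast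
    then have "r = r' \<and> prefix p r \<and> u \<approx> v \<or> paired r r' u v \<longleftrightarrow> link r u1 v1"
      using paired_both[OF assms(3), of u1 v1] uv by blast
    also have "link r u1 v1 \<longleftrightarrow> holds R (case find (\<lambda>y. starts_stem R y u1) (tail_suffixes rs r) of
             None \<Rightarrow> Some (u1, v1, []) | Some y \<Rightarrow> Some (y @ u1, y @ v1, []))"
    proof (cases "find (\<lambda>y. starts_stem R y u1) (tail_suffixes rs r)")
      case None
      then have "\<not> active y u1" if "sim R r s" "suffix y (Z s)" for s y
        using that active_starts_stem by (auto simp: find_None_iff set_tail_suffixes R)
      then show ?thesis using None by (auto simp: link_def prefixed_eqv_Nil)
    next
      case (Some y)
      then obtain s where y: "starts_stem R y u1" "sim R r s" "suffix y (Z s)"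
        using set_tail_suffixes[of rs r] unfolding find_Some_iff R by (auto simp: set_conv_nth)
      \<comment> \<open>The suffix \<open>y\<close> was found by its stem alone and need not be
        active. This does no harm: an active suffix used by the link equals \<open>y\<close> by
        uniqueness, and a link without one is an equivalence to which \<open>y\<close> can be
        prepended.\<close>
      have "y @ u1 \<approx> y @ v1" if "link r u1 v1"
        using that unfolding link_def
      proof (elim disjE exE conjE)
        fix y' s' assume y': "suffix y' (Z s')" "active y' u1" "y' @ u1 \<approx> y' @ v1"
        then have "y' = y"
          using starts_stem_unique[OF active_starts_stem y(1)] y piece_suffix_tail by blast
        then show ?thesis using y' by simp
      qed (rule eqv_prepend)
      moreover have "link r u1 v1" if "y @ u1 \<approx> y @ v1"
      proof -
        obtain b where b: "Z s = b @ y" using y(3) by (auto simp: suffix_def)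
        show ?thesis by (rule tail_cancel[OF y(2)]) (use eqv_prepend[OF that, of b] b in simp)
      qed
      ultimately show ?thesis using Some by (auto simp: prefixed_eqv_Nil)
    qed
    finally show ?thesis using both uv R
      by (simp add: reduce_stem_def Let_def z_z'_n_def cong: option.case_cong)
  next
    case left
    then obtain u1 where u: "u = Z r @ u1" by (auto simp: z_z'_n_def elim!: prefixE)
    have "paired r r' u v" if "r = r'" "u \<approx> v"
      using that u link_eqv[of u1 u1 r] eqv_sym unfolding paired_def by blast
    then have "r = r' \<and> prefix p r \<and> u \<approx> v \<or> paired r r' u v \<longleftrightarrow> Z r' @ u1 \<approx> v"
      using paired_left[OF assms(3), of v u1] u left eqv_sym unfolding z_z'_n_def by blast
    then show ?thesis using left u R by (simp add: reduce_stem_def Let_def z_z'_n_def prefixed_eqv_Nil)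
  next
    case right
    then obtain v1 where v: "v = Z r' @ v1" by (auto simp: z_z'_n_def elim!: prefixE)
    have "paired r r' u v" if "r = r'" "u \<approx> v"
      using that v link_eqv[of v1 v1 r] eqv_sym unfolding paired_def by blast
    then have "r = r' \<and> prefix p r \<and> u \<approx> v \<or> paired r r' u v \<longleftrightarrow> u \<approx> Z r @ v1"
      using paired_right[OF assms(3), of u v1] v right unfolding z_z'_n_def by blast
    then show ?thesis using right v R by (simp add: reduce_stem_def Let_def z_z'_n_def prefixed_eqv_Nil)
  next
    case neither
    \<comment> \<open>Pairing gives some common suffix \<open>y\<close> of the tails that the
      algorithm cannot know. The longest one, \<open>c\<close>, contains it; the letters of
      \<open>c\<close> in front of \<open>y\<close> are present on both sides and can be handed over
      too.\<close>
    have 1: "\<exists>u' v' q. u = take n z @ u' \<and> v = take ?n' z' @ v' \<and> u' \<approx> v' \<and> u' \<approx> c @ q"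
      if paired: "paired r r' u v"
    proof -
      obtain b b' y u' v' q where *: "Z r = b @ y" "Z r' = b' @ y" "u = b @ u'" "v = b' @ v'"
        "u' \<approx> v'" "u' \<approx> y @ q"
        using paired_neither[OF assms(3) _ _ paired] neither unfolding z_z'_n_def by metis
      then have "suffix y z" "suffix y z'" by (auto simp: z_z'_n_def suffix_def)
      then have "suffix y c" unfolding c_def z_z'_n_def(3) by (rule unshared_length(2))
      then obtain a where a: "c = a @ y" by (auto simp: suffix_def)
      have "b = take n z @ a" "b' = take ?n' z' @ a"
        using z a *(1,2) unfolding z_z'_n_def by (metis append.assoc append_same_eq)+
      then show ?thesis
        using * a eqv_prepend[OF *(5), of a] eqv_prepend[OF *(6), of a] by auto
    qed
    have 2: "paired r r' u v"
      if "u = take n z @ u'" "v = take ?n' z' @ v'" "u' \<approx> v'" "u' \<approx> c @ q" for u' v' q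
    proof -
      have "v' \<approx> c @ q" using that eqv_sym rtranclp_trans by metis
      then have "u \<approx> z @ q" "v \<approx> z' @ q"
        using that z eqv_prepend by (metis append.assoc)+
      then show ?thesis using link_eqv[of q q r] unfolding paired_def z_z'_n_def by blast
    qed
    \<comment> \<open>With equal tails the same prefix is split off on both sides, so pairing
      already implies the plain equivalence.\<close>
    have 3: "u \<approx> v" if paired: "paired r r u v" and "r = r'"
    proof -
      have "\<not> prefix (Z r) u" "\<not> prefix (Z r) v" using neither \<open>r = r'\<close> by (auto simp: z_z'_n_def)
      then obtain b b' y u' v' q where *: "Z r = b @ y" "Z r = b' @ y" "u = b @ u'" "v = b' @ v'"
        "u' \<approx> v'"
        using paired_neither[OF sim_refl[OF r] _ _ paired] by metis
      then show ?thesis using eqv_prepend by auto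
    qed
    show ?thesis
    proof (cases "r = r' \<and> prefix p r")
      case True
      then show ?thesis using 3 neither R
        by (auto simp: reduce_stem_def Let_def z_z'_n_def prefixed_eqv_Nil)
    next
      case False
      have "paired r r' u v \<longleftrightarrow> prefix (take n z) u \<and> prefix (take ?n' z') v \<and>
          prefixed_eqv R c (drop n u) (drop ?n' v)" (is "_ \<longleftrightarrow> ?rhs")
      proof
        assume "paired r r' u v"
        from 1[OF this] show ?rhs using n by (auto simp: prefixed_eqv_def min_def)
      next
        assume rhs: ?rhs
        then obtain u' v' where uv: "u = take n z @ u'" "v = take ?n' z' @ v'"
          by (auto elim!: prefixE)
        have "length (take n z) = n" "length (take ?n' z') = ?n'" using n by simp_all
        then have "drop n u = u'" "drop ?n' v = v'"
          using uv by (metis append_eq_conv_conj)+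
        then show "paired r r' u v"
          using rhs 2[OF uv] unfolding prefixed_eqv_def by auto
      qed
      then show ?thesis using False neither R
        by (auto simp: reduce_stem_def Let_def z_z'_n_def c_def)
    qed
  qed
qed

lemma reduce_correct:
  assumes R: "R = set rs" and "P p" "u \<noteq> [] \<or> v \<noteq> []"
  shows "prefixed_eqv R p u v \<longleftrightarrow> holds R (reduce rs u v p)"
proof (cases "find (clean R u) (word_list rs)")
  case None
  then have nc: "\<not> (\<exists>r\<in>W. clean R u r)" by (auto simp: find_None_iff R)
  show ?thesis
  proof (cases u)
    case Nil
    then have "\<not> u \<approx> v" using eqv_Nil assms(3) by blast
    then show ?thesis using None Nil by (simp add: reduce_def R prefixed_eqv_def)
  next
    case (Cons a u')
    have nc': "\<not> (\<exists>r\<in>W. clean R (a # u') r)" using nc Cons by simp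
    have "prefixed_eqv R p u v \<longleftrightarrow>
      v \<noteq> [] \<and> hd v = a \<and> (p = [] \<or> hd p = a) \<and> prefixed_eqv R (tl p) u' (tl v)" (is "_ \<longleftrightarrow> ?rhs")
    proof
      assume L: "prefixed_eqv R p u v"
      then have "a # u' \<approx> v" by (simp add: prefixed_eqv_def Cons)
      then obtain v' where v: "v = a # v'" "u' \<approx> v'" using eqv_not_clean[OF nc'] by blast
      obtain q where "a # u' \<approx> p @ q" using L by (auto simp: prefixed_eqv_def Cons)
      then obtain w where "p @ q = a # w" "u' \<approx> w" using eqv_not_clean[OF nc'] by blast
      then show ?rhs using v unfolding prefixed_eqv_def by (cases p) auto
    next
      assume rhs: ?rhs
      then obtain q where q: "u' \<approx> tl p @ q" by (auto simp: prefixed_eqv_def)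
      have "v = [a] @ tl v" using rhs by (cases v) auto
      moreover have "[a] @ u' \<approx> [a] @ tl v" "[a] @ u' \<approx> [a] @ tl p @ q"
        using rhs q by (auto simp: prefixed_eqv_def simp del: append_Cons intro: eqv_prepend)
      moreover have "p = [] \<or> [a] @ tl p = p" using rhs by (cases p) auto
      ultimately show "prefixed_eqv R p u v"
        unfolding prefixed_eqv_def Cons by (metis append_Cons append_Nil append.assoc)
    qed
    then show ?thesis using None Cons R by (auto simp: reduce_def)
  qed
next
  case (Some r)
  then have r: "r \<in> W" "clean R u r" unfolding find_Some_iff R by (auto simp flip: set_word_list)
  then obtain u' where u: "u = H r @ u'" by (auto simp: clean_def elim: prefixE)
  have cl: "clean R (H r @ u') r" using r u by simp
  show ?thesis
  proof (cases "find (\<lambda>s. sim R r s \<and> prefix (H s) v) (word_list rs)")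
    case None
    then have "\<not> (\<exists>s v'. sim R r s \<and> v = H s @ v')"
      using sim_right by (fastforce simp: find_None_iff R)
    then have "\<not> u \<approx> v" using eqv_clean[OF r(1) cl] u by metis
    then show ?thesis using Some None by (simp add: reduce_def R prefixed_eqv_def)
  next
    case r': (Some r')
    then obtain v' where v: "v = H r' @ v'" "sim R r r'"
      unfolding find_Some_iff by (auto elim!: prefixE)
    show ?thesis
    proof (cases "\<exists>s\<in>set (word_list rs). sim R r s \<and> prefix p s")
      case True
      then obtain s where "sim R r s" "prefix p s" by auto
      then show ?thesis
        using reduce_stem_correct[OF R cl v(2) assms(2), of s v'] Some r' True u v(1)
        by (simp add: reduce_def R)
    next
      case False
      have "\<not> u \<approx> p @ q" for q
      proof
        assume "u \<approx> p @ q"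
        then obtain t w where t: "sim R r t" "p @ q = H t @ w"
          using eqv_clean[OF r(1) cl] u by metis
        have "prefix p (H t)"
          using piece_before_stem[OF t(2) assms(2) sim_right[OF t(1)]] .
        then have "prefix p t" using stem_tail prefixI prefix_order.trans by metis
        then show False using False t(1) sim_right R by auto
      qed
      then show ?thesis using Some r' False by (auto simp: reduce_def R prefixed_eqv_def)
    qed
  qed
qed


lemma piece_tail_suffixes: "y \<in> set (tail_suffixes rs r) \<Longrightarrow> R = set rs \<Longrightarrow> P y"
  using piece_suffix_tail by (auto simp: set_tail_suffixes)

section \<open>What a reduction removes and what it puts back\<close>

lemma reduce_stem_shape:
  assumes "R = set rs" "r \<in> W" "r' \<in> W" "reduce_stem rs r r' p u v = Some (u', v', p')"
  obtains x y u1 v1 w w' where "u = x @ u1" "v = y @ v1" "u' = w @ u1" "v' = w' @ v1"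
    "prefix x (Z r)" "prefix y (Z r')" "P w" "P w'" "P p'"
proof -
  define z z' n c where "z = Z r" "z' = Z r'" "n = unshared_length z z'" "c = drop n z"
  note defs = this
  have n: "n \<le> length z" using unshared_length(3)[of "[]" z z'] by (simp add: defs)
  have "suffix c z" by (simp add: defs suffix_drop)
  then have "P c" using piece_suffix_tail by (simp add: defs)
  have pz: "P z" "P z'" by (simp_all add: defs piece_tail)
  let ?n' = "length z' - length c"
  note red = assms(4)[unfolded reduce_stem_def Let_def, folded assms(1), folded defs(1,2), folded defs(3),
      folded defs(4)]
  consider (both) "prefix z u" "prefix z' v" | (left) "prefix z u" "\<not> prefix z' v"
    | (right) "\<not> prefix z u" "prefix z' v" | (neither) "\<not> prefix z u" "\<not> prefix z' v"
    by blast
  then show thesis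
  proof cases
    case both
    then obtain u1 v1 where uv: "u = z @ u1" "v = z' @ v1" by (auto elim!: prefixE)
    show thesis
    proof (cases "find (\<lambda>y. starts_stem R y u1) (tail_suffixes rs r)")
      case None
      then have "u' = u1" "v' = v1" "p' = []" using red both uv by simp_all
      then show thesis using that[of z u1 z' v1 "[]" "[]"] uv by (simp add: defs)
    next
      case (Some y)
      then have "u' = y @ u1" "v' = y @ v1" "p' = []" using red both uv by simp_all
      moreover have "P y"
        using Some piece_tail_suffixes[OF _ assms(1)] by (metis find_Some_iff nth_mem)
      ultimately show thesis using that[of z u1 z' v1 y y] uv by (simp add: defs)
    qed
  next
    case left
    then obtain u1 where "u = z @ u1" by (auto elim!: prefixE)
    then show thesis using that[of z u1 "[]" v z' "[]"] red left pz by (simp add: defs)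
  next
    case right
    then obtain v1 where "v = z' @ v1" by (auto elim!: prefixE)
    then show thesis using that[of "[]" u z' v1 "[]" z] red right pz by (simp add: defs)
  next
    case neither
    show thesis
    proof (cases "r = r' \<and> prefix p r")
      case True
      then show thesis using that[of "[]" u "[]" v "[]" "[]"] red neither by auto
    next
      case False
      then have *: "prefix (take n z) u" "prefix (take ?n' z') v" "u' = drop n u" "v' = drop ?n' v" "p' = c"
        using red neither by (auto split: if_splits)
      obtain u1 v1 where uv: "u = take n z @ u1" "v = take ?n' z' @ v1"
        using * by (auto elim!: prefixE)
      have "length (take n z) = n" "length (take ?n' z') = ?n'" using n by simp_all
      then have "drop n u = u1" "drop ?n' v = v1"
        using uv by (metis append_eq_conv_conj)+
      then show thesis
        using that[of "take n z" u1 "take ?n' z'" v1 "[]" "[]"] uv * \<open>P c\<close>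
        by (simp add: take_is_prefix flip: defs(1,2))
    qed
  qed
qed

text \<open>This is all that termination and the finiteness of the state set require: at least a
  stem goes on either side, or one common letter, and only a piece comes back in front.\<close>

lemma reduce_shape:
  assumes R: "R = set rs" "P p" and red: "reduce rs u v p = Some (u', v', p')"
  obtains (letter) a where "u = a # u'" "v = a # v'" "P p'"
  | (stem) r r' x y u1 v1 w w' where "r \<in> W" "r' \<in> W" "u = H r @ x @ u1" "v = H r' @ y @ v1"
    "u' = w @ u1" "v' = w' @ v1" "prefix x (Z r)" "prefix y (Z r')" "P w" "P w'" "P p'"
proof (cases "find (clean R u) (word_list rs)")
  case None
  then have *: "u \<noteq> []" "v \<noteq> []" "hd u = hd v" "u' = tl u" "v' = tl v" "p' = tl p"
    using red by (auto simp: reduce_def R(1) split: if_splits)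
  have "suffix (tl p) p" by (simp add: suffix_tl)
  then have "P (tl p)" using R(2) piece_suffix by (metis suffixE)
  moreover have "u = hd u # u'" "v = hd u # v'" using * by (metis list.collapse)+
  ultimately show thesis using letter[of "hd u"] *(6) by simp
next
  case (Some r)
  then have r: "r \<in> W" "clean R u r" unfolding find_Some_iff R by (auto simp flip: set_word_list)
  then obtain u0 where u: "u = H r @ u0" by (auto simp: clean_def elim: prefixE)
  obtain r' where r': "find (\<lambda>s. sim R r s \<and> prefix (H s) v) (word_list rs) = Some r'"
    "reduce_stem rs r r' p (drop (length (H r)) u) (drop (length (H r')) v) = Some (u', v', p')"
    using red Some by (auto simp: reduce_def R split: option.splits if_splits)
  then obtain v0 where v: "v = H r' @ v0" "sim R r r'"
    unfolding find_Some_iff by (auto elim!: prefixE)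
  have r'W: "r' \<in> W" using v(2) sim_right by blast
  have "reduce_stem rs r r' p u0 v0 = Some (u', v', p')" using r'(2) u v(1) by simp
  from reduce_stem_shape[OF R(1) r(1) r'W this]
  obtain x y u1 v1 w w' where "u0 = x @ u1" "v0 = y @ v1" "u' = w @ u1" "v' = w' @ v1"
    "prefix x (Z r)" "prefix y (Z r')" "P w" "P w'" "P p'" .
  then show thesis using stem[of r r' x u1 y v1 w w'] r(1) r'W u v(1) by simp
qed

end

section \<open>Locality and termination of reduction\<close>

text \<open>Enough input is known: \<open>k\<close> letters or the end of the tape. Tests against
  words of length at most \<open>k\<close> without \<open>e\<close> are then independent of further
  input, as such a word cannot match across \<open>e\<close>.\<close>

definition long :: "'a \<Rightarrow> nat \<Rightarrow> 'a list \<Rightarrow> bool" where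
  "long e k u \<longleftrightarrow> k \<le> length u \<or> e \<in> set u"

lemma long_prefix:
  assumes "long e k u" "e \<notin> set w" "length w \<le> k"
  shows "prefix w (u @ s) \<longleftrightarrow> prefix w u"
  using assms unfolding long_def prefix_append by (auto simp flip: length_0_conv)

lemma long_drop: "long e k u \<Longrightarrow> e \<notin> set (take n u) \<Longrightarrow> long e (k - n) (drop n u)"
  unfolding long_def by (metis UnE append_take_drop_id diff_le_mono length_drop set_append)

lemma long_mono: "long e k u \<Longrightarrow> j \<le> k \<Longrightarrow> long e j u"
  by (auto simp: long_def)

lemma long_append: "long e k u \<Longrightarrow> long e k (w @ u)"
  by (auto simp: long_def)

definition ended :: "'a \<Rightarrow> 'a list \<Rightarrow> bool" where
  "ended e u \<longleftrightarrow> u \<noteq> [] \<and> last u = e \<and> e \<notin> set (butlast u)"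

lemma ended_append: "e \<notin> set x \<Longrightarrow> ended e (x @ u) \<longleftrightarrow> ended e u"
  using last_in_set[of x] by (cases "u = []"; cases "x = []") (auto simp: ended_def butlast_append)

text \<open>Reduction may replace a tail by a longer one and so lengthen a word, but the letters put in front
  form a piece. Not counting the longest piece prefix gives a measure that does not increase.\<close>

definition potential :: "('a list \<times> 'a list) set \<Rightarrow> 'a list \<Rightarrow> nat" where
  "potential R u = (LEAST k. \<exists>p s. u = p @ s \<and> piece R p \<and> length s = k)"

lemma potential_le: "piece R p \<Longrightarrow> potential R (p @ s) \<le> length s"
  unfolding potential_def by (rule Least_le) blast

lemma potential_le_length: "potential R u \<le> length u"
  using potential_le[of R "[]" u] by simp

lemma potentialE:
  obtains p s where "u = p @ s" "piece R p" "length s = potential R u"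
proof -
  have "\<exists>p s. u = p @ s \<and> piece R p \<and> length s = potential R u"
    unfolding potential_def
    by (rule LeastI[of "\<lambda>k. \<exists>p s. u = p @ s \<and> piece R p \<and> length s = k" "length u"])
      (rule exI[of _ "[]"], rule exI[of _ u], simp)
  then show thesis using that by blast
qed

lemma piece_in_word:
  assumes "piece R p" "p \<noteq> []"
  obtains r x y where "r \<in> relation_words R" "r = x @ p @ y"
  using assms by (elim pieceE) blast

context small_overlap
begin

text \<open>A stem is not a piece, so a piece prefix stops inside it, and at least one of its
  letters is counted besides \<open>y\<close>.\<close>

lemma potential_stem: "r \<in> W \<Longrightarrow> length y < potential R (H r @ y)"
proof (rule ccontr)
  assume r: "r \<in> W" and less: "\<not> length y < potential R (H r @ y)"
  obtain p s where ps: "H r @ y = p @ s" "P p" "length s = potential R (H r @ y)"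
    using potentialE .
  have "length (H r) + length y = length p + length s"
    using arg_cong[OF ps(1), of length] unfolding length_append .
  then have "length (H r) \<le> length p" using less ps(3) by linarith
  then obtain e where "p = H r @ e" using append_cmp_length[OF ps(1)] by metis
  then show False using ps(2) piece_prefix stem_not_piece[OF r] by blast
qed

lemma potential_Cons: "potential R u \<le> potential R (a # u)"
proof -
  obtain p s where ps: "a # u = p @ s" "P p" "length s = potential R (a # u)"
    using potentialE .
  show ?thesis
  proof (cases p)
    case Nil
    then show ?thesis using ps potential_le_length[of R u] by (metis append_Nil le_SucI length_Cons)
  next
    case (Cons b p')
    then have "P p'" using ps(2) piece_suffix[of R "[b]" p'] by simp
    then show ?thesis using ps Cons potential_le[of R p' s] by simp
  qed
qed

text \<open>At a stem a counted letter is lost, while the piece put in front is not counted.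
  Stripping a common letter may leave the potential unchanged but shortens both words, whence the
  alternative.\<close>

lemma reduce_potential:
  assumes "R = set rs" "P p" "reduce rs u v p = Some (u', v', p')"
  shows "potential R u' \<le> potential R u" "potential R v' \<le> potential R v"
    "potential R u' < potential R u \<or> length u' < length u \<and> length v' < length v"
proof -
  show "potential R u' \<le> potential R u" "potential R v' \<le> potential R v"
    "potential R u' < potential R u \<or> length u' < length u \<and> length v' < length v"
    using assms
  proof (atomize (full), cases rule: reduce_shape)
    case (letter a)
    then show "potential R u' \<le> potential R u \<and> potential R v' \<le> potential R v \<and>
      (potential R u' < potential R u \<or> length u' < length u \<and> length v' < length v)"
      using potential_Cons by simp
  next
    case (stem r r' x y u1 v1 w w')
    then show "potential R u' \<le> potential R u \<and> potential R v' \<le> potential R v \<and>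
      (potential R u' < potential R u \<or> length u' < length u \<and> length v' < length v)"
      using potential_stem[of r "x @ u1"] potential_stem[of r' "y @ v1"]
        potential_le[of R w u1] potential_le[of R w' v1] by simp
  qed
qed

lemma reduce_piece:
  assumes "R = set rs" "P p" "reduce rs u v p = Some (u', v', p')"
  shows "P p'"
  using assms by (cases rule: reduce_shape) auto

lemma piece_letters: "P p \<Longrightarrow> set p \<subseteq> \<Union>(set ` W)"
  by (cases "p = []") (auto elim!: piece_in_word)

lemma tail_letters: "r \<in> W \<Longrightarrow> prefix x (Z r) \<Longrightarrow> set x \<subseteq> \<Union>(set ` W)"
  using piece_letters piece_tail piece_prefix by (metis prefixE)

lemma reduce_letters:
  assumes "R = set rs" "P p" "reduce rs u v p = Some (u', v', p')"
  shows "set u' \<subseteq> set u \<union> \<Union>(set ` W)" "set v' \<subseteq> set v \<union> \<Union>(set ` W)"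
  using assms by (cases rule: reduce_shape; use piece_letters in fastforce)+

text \<open>The end-marker can only go as a common first letter, and then it was the last letter of
  both words.\<close>

lemma reduce_ended:
  assumes "R = set rs" "P p" "reduce rs u v p = Some (u', v', p')"
    "e \<notin> \<Union>(set ` W)" "ended e u" "ended e v"
  shows "ended e u' \<and> ended e v' \<or> u' = [] \<and> v' = []"
  using assms(1-3)
proof (cases rule: reduce_shape)
  case (letter a)
  then show ?thesis using assms(5,6) by (auto simp: ended_def split: if_splits)
next
  case (stem r r' x y u1 v1 w w')
  have "e \<notin> set (H s)" if "s \<in> W" for s
    using that assms(4) stem_tail[of R s] by (metis UN_I UnCI set_append)
  moreover have "e \<notin> set x" "e \<notin> set y" "e \<notin> set w" "e \<notin> set w'"
    using stem piece_letters tail_letters assms(4) by blast+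
  ultimately show ?thesis using stem assms(5,6) by (simp add: ended_append)
qed

text \<open>A stem starting inside \<open>H r\<close> ends within the first \<open>2 * m\<close>
  letters.\<close>

lemma clean_append:
  assumes "\<And>s. s \<in> W \<Longrightarrow> length s \<le> m \<and> e \<notin> set s" "r \<in> W" "long e (2 * m) u"
  shows "clean R (u @ t) r \<longleftrightarrow> clean R u r"
proof -
  have H: "length (H s) \<le> m" "e \<notin> set (H s)" if "s \<in> W" for s
    using assms(1)[OF that] stem_tail[of R s] by (metis UnCI le_add1 length_append order_trans set_append)+
  have pre: "prefix (H r) (u @ t) \<longleftrightarrow> prefix (H r) u"
    using H[OF assms(2)] assms(3) by (intro long_prefix[of e "2 * m"]) auto
  have "prefix (H s) (drop i (u @ t)) \<longleftrightarrow> prefix (H s) (drop i u)"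
    if that: "s \<in> W" "i < length (H r)" and "prefix (H r) u" for s i
  proof -
    obtain w where u: "u = H r @ w" using \<open>prefix (H r) u\<close> by (auto elim!: prefixE)
    have "take i u = take i (H r)" using that(2) u by simp
    then have "e \<notin> set (take i u)" using H(2)[OF assms(2)] by (metis in_set_takeD)
    then have lg: "long e (2 * m - i) (drop i u)" by (rule long_drop[OF assms(3)])
    have "length (H s) \<le> 2 * m - i"
      using H(1)[OF that(1)] H(1)[OF assms(2)] that(2) by linarith
    moreover have "drop i (u @ t) = drop i u @ t" using that(2) u by simp
    ultimately show ?thesis using long_prefix[OF lg H(2)[OF that(1)]] by simp
  qed
  then show ?thesis unfolding clean_def pre by blast
qed

definition extend where
  "extend s t = map_option (\<lambda>(x, y, q). (x @ s, y @ t, q))"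

lemma reduce_stem_append:
  assumes "R = set rs" "\<And>s. s \<in> W \<Longrightarrow> length s \<le> m \<and> e \<notin> set s" "r \<in> W" "r' \<in> W"
    "long e (m + length (Z r)) u" "long e (m + length (Z r')) v"
  shows "reduce_stem rs r r' p (u @ s) (v @ t) = extend s t (reduce_stem rs r r' p u v)"
proof -
  define z z' n c where "z = Z r" "z' = Z r'" "n = unshared_length z z'" "c = drop n z"
  note defs = this
  have n: "n \<le> length z" using unshared_length(3)[of "[]" z z'] by (simp add: defs)
  let ?n' = "length z' - length c"
  have e: "e \<notin> set z" "e \<notin> set z'"
    using assms(2)[OF assms(3)] assms(2)[OF assms(4)] unfolding defs by (auto simp: tail_def dest: in_set_dropD)
  note U = long_prefix[OF assms(5), of _ s, folded defs(1)]
  note V = long_prefix[OF assms(6), of _ t, folded defs(2)]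
  have pre: "prefix z (u @ s) \<longleftrightarrow> prefix z u" "prefix z' (v @ t) \<longleftrightarrow> prefix z' v"
    "prefix (take n z) (u @ s) \<longleftrightarrow> prefix (take n z) u"
    "prefix (take ?n' z') (v @ t) \<longleftrightarrow> prefix (take ?n' z') v"
    using e by (intro U V; auto dest: in_set_takeD)+
  note unf = reduce_stem_def Let_def assms(1)[symmetric] defs(1,2)[symmetric] defs(3)[symmetric]
      defs(4)[symmetric] pre
  have drop: "drop (length z) (u @ s) = drop (length z) u @ s" if "prefix z u"
    using prefix_length_le[OF that] by simp
  have drop': "drop (length z') (v @ t) = drop (length z') v @ t" if "prefix z' v"
    using prefix_length_le[OF that] by simp
  consider (both) "prefix z u" "prefix z' v" | (left) "prefix z u" "\<not> prefix z' v"
    | (right) "\<not> prefix z u" "prefix z' v" | (neither) "\<not> prefix z u" "\<not> prefix z' v"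
    by blast
  then show ?thesis
  proof cases
    case both
    then obtain u1 where u: "u = z @ u1" by (auto elim!: prefixE)
    have "long e m u1" using assms(5) e u by (auto simp: long_def defs(1))
    then have "prefix (H a) ((y @ u1) @ s) \<longleftrightarrow> prefix (H a) (y @ u1)" if "a \<in> W" for a y
      using assms(2)[OF that] stem_tail[of R a]
      by (intro long_prefix[of e m] long_append) (auto simp: stem_def dest: in_set_takeD)
    then have "starts_stem R y (u1 @ s) \<longleftrightarrow> starts_stem R y u1" for y
      by (auto simp: starts_stem_def)
    then show ?thesis
      using both drop[OF both(1)] drop'[OF both(2)] unfolding unf extend_def
      by (auto simp: u split: option.splits)
  next
    case left
    then show ?thesis using drop unfolding unf extend_def by simp
  next
    case right
    then show ?thesis using drop' unfolding unf extend_def by simp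
  next
    case neither
    have "drop n (u @ s) = drop n u @ s" if "prefix (take n z) u"
      using prefix_length_le[OF that] n by simp
    moreover have "drop ?n' (v @ t) = drop ?n' v @ t" if "prefix (take ?n' z') v"
      using prefix_length_le[OF that] by simp
    ultimately show ?thesis
      using neither unfolding unf extend_def by (cases "r = r' \<and> prefix p r") auto
  qed
qed

lemma reduce_append:
  assumes R: "R = set rs" and m: "\<And>s. s \<in> W \<Longrightarrow> length s \<le> m \<and> e \<notin> set s"
    and "long e (Suc (2 * m)) u" "long e (Suc (2 * m)) v"
  shows "reduce rs (u @ s) (v @ t) p = extend s t (reduce rs u v p)"
proof -
  have uv: "long e (2 * m) u" "long e (2 * m) v" using assms(3,4) long_mono by fastforce+
  have ne: "u \<noteq> []" "v \<noteq> []" using assms(3,4) by (auto simp: long_def)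
  have H: "length (H s) \<le> 2 * m" "e \<notin> set (H s)" if "s \<in> W" for s
    using m[OF that] by (auto simp: stem_def dest: in_set_takeD)
  have Z: "length (H s) + length (Z s) \<le> m" if "s \<in> W" for s
    using m[OF that] stem_tail[of R s] by (metis length_append)
  have cl: "find (clean R (u @ s)) (word_list rs) = find (clean R u) (word_list rs)"
    by (rule find_cong) (use clean_append[OF m _ uv(1)] R in auto)
  have pr: "find (\<lambda>a. sim R r a \<and> prefix (H a) (v @ t)) (word_list rs) =
    find (\<lambda>a. sim R r a \<and> prefix (H a) v) (word_list rs)" for r
    by (rule find_cong) (use long_prefix[OF uv(2)] H R in auto)
  have dr: "long e (m + length (Z r)) (drop (length (H r)) w)"
    if asm: "r \<in> W" "prefix (H r) w" "long e (2 * m) w" for r w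
  proof -
    obtain x where w: "w = H r @ x" using asm(2) by (auto elim!: prefixE)
    then have "long e (2 * m - length (H r)) (drop (length (H r)) w)"
      using asm H by (intro long_drop) auto
    then show ?thesis using Z[OF asm(1)] by (elim long_mono) linarith
  qed
  show ?thesis
  proof (cases "find (clean R u) (word_list rs)")
    case None
    then show ?thesis using ne cl R by (auto simp: reduce_def extend_def)
  next
    case (Some r)
    then have r: "r \<in> W" "prefix (H r) u"
      unfolding find_Some_iff R by (auto simp: clean_def simp flip: set_word_list)
    show ?thesis
    proof (cases "find (\<lambda>a. sim R r a \<and> prefix (H a) v) (word_list rs)")
      case None
      then show ?thesis using Some cl pr R by (simp add: reduce_def extend_def)
    next
      case r': (Some r')
      then have r'2: "r' \<in> W" "prefix (H r') v"
        unfolding find_Some_iff R by (auto simp flip: set_word_list)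
      have "reduce_stem rs r r' p (drop (length (H r)) (u @ s)) (drop (length (H r')) (v @ t)) =
        extend s t (reduce_stem rs r r' p (drop (length (H r)) u) (drop (length (H r')) v))"
        using reduce_stem_append[OF R m r(1) r'2(1) dr[OF r uv(1)] dr[OF r'2 uv(2)]]
          prefix_length_le[OF r(2)] prefix_length_le[OF r'2(2)] by simp
      then show ?thesis using Some r' cl pr R by (auto simp: reduce_def extend_def)
    qed
  qed
qed

end

section \<open>Normalising a pair of buffers\<close>

type_synonym 'a buffers = "'a list \<times> 'a list \<times> 'a list"

text \<open>Any bound on the lengths of relation words serves; the sum avoids a maximum over a
  possibly empty list.\<close>

definition size_bound :: "('a list \<times> 'a list) list \<Rightarrow> nat" where
  "size_bound rs = sum_list (map length (word_list rs))"

text \<open>Twice the bound covers a stem with all stems overlapping it, and a relation word with a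
  stem behind it. The additional letter keeps long buffers nonempty even when there are no
  relations.\<close>

definition window :: "('a list \<times> 'a list) list \<Rightarrow> nat" where
  "window rs = Suc (2 * size_bound rs)"

definition advance ::
  "'a \<Rightarrow> ('a list \<times> 'a list) list \<Rightarrow> 'a buffers option \<Rightarrow> 'a buffers option" where
  "advance e rs x = (case x of None \<Rightarrow> None | Some (u, v, p) \<Rightarrow>
     if long e (window rs) u \<and> long e (window rs) v then reduce rs u v p else x)"

text \<open>The potentials of good buffers add up to at most \<open>2 * window rs\<close>, and their
  lengths to less than the second factor. Hence this exceeds every \<open>weight\<close> that can
  occur.\<close>

definition fuel :: "('a list \<times> 'a list) list \<Rightarrow> nat" where
  "fuel rs = Suc (2 * window rs) * Suc (2 * (window rs + size_bound rs))"

definition normalise ::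
  "'a \<Rightarrow> ('a list \<times> 'a list) list \<Rightarrow> 'a buffers option \<Rightarrow> 'a buffers option" where
  "normalise e rs x = (advance e rs ^^ fuel rs) x"

primrec words_upto :: "'a list \<Rightarrow> nat \<Rightarrow> 'a list list" where
  "words_upto bs 0 = [[]]"
| "words_upto bs (Suc n) = [] # concat (map (\<lambda>w. map (\<lambda>b. b # w) bs) (words_upto bs n))"

lemma set_words_upto: "set (words_upto bs n) = {w. set w \<subseteq> set bs \<and> length w \<le> n}"
proof (induction n)
  case (Suc n)
  have "w \<in> set (words_upto bs (Suc n)) \<longleftrightarrow> set w \<subseteq> set bs \<and> length w \<le> Suc n" for w
    by (cases w) (auto simp: Suc)
  then show ?case by blast
qed auto

definition buffer_states :: "'a list \<Rightarrow> ('a list \<times> 'a list) list \<Rightarrow> 'a buffers list" where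
  "buffer_states bs rs =
    (let ws = words_upto bs (window rs + size_bound rs)
     in concat (map (\<lambda>u. concat (map (\<lambda>v. map (\<lambda>p. (u, v, p)) (words_upto bs (size_bound rs))) ws)) ws))"

lemma set_buffer_states:
  "set (buffer_states bs rs) = {(u, v, p). set u \<subseteq> set bs \<and> length u \<le> window rs + size_bound rs \<and>
     set v \<subseteq> set bs \<and> length v \<le> window rs + size_bound rs \<and> set p \<subseteq> set bs \<and> length p \<le> size_bound rs}"
  by (auto simp: buffer_states_def set_words_upto Let_def)

text \<open>The final membership test makes the state set closed under transitions by definition,
  also from states that no run reaches; on good buffers reading a tape letter it always
  succeeds.\<close>

definition transition ::
  "'a \<Rightarrow> 'a list \<Rightarrow> ('a list \<times> 'a list) list \<Rightarrow> 'a buffers \<Rightarrow> 'a \<Rightarrow> 'a buffers option" where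
  "transition e bs rs q s =
    (case normalise e rs (Some (if long e (window rs) (fst q)
        then (fst q, fst (snd q) @ [s], snd (snd q)) else (fst q @ [s], snd q))) of
       None \<Rightarrow> None
     | Some q' \<Rightarrow> if s \<in> set bs \<and> q' \<in> set (buffer_states bs rs) then Some q' else None)"

section \<open>Invariants of the buffers\<close>

locale buffered = small_overlap R for R :: "('a list \<times> 'a list) set" +
  fixes rs :: "('a list \<times> 'a list) list" and e :: 'a and bs :: "'a list"
  assumes R: "R = set rs"
    and end_letter: "e \<notin> \<Union>(set ` W)" "e \<in> set bs"
    and letters: "\<Union>(set ` W) \<subseteq> set bs"
begin

abbreviation "m \<equiv> size_bound rs"
abbreviation "K \<equiv> window rs"

lemma length_word: "r \<in> W \<Longrightarrow> length r \<le> m"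
  unfolding size_bound_def R by (auto intro!: member_le_sum_list simp flip: set_word_list)

lemma length_piece: "P p \<Longrightarrow> length p \<le> m"
  using length_word by (cases "p = []") (fastforce elim!: piece_in_word)+

lemma length_le_potential: "length u \<le> potential R u + m"
proof -
  obtain p s where "u = p @ s" "P p" "length s = potential R u" by (rule potentialE)
  then show ?thesis using length_piece[of p] by simp
qed

lemma end_not_in_word: "r \<in> W \<Longrightarrow> length r \<le> m \<and> e \<notin> set r"
  using length_word end_letter by blast

lemma reduce_append':
  "long e K u \<Longrightarrow> long e K v \<Longrightarrow> reduce rs (u @ s) (v @ t) p = extend s t (reduce rs u v p)"
  using reduce_append[OF R end_not_in_word] unfolding window_def by blast

definition remaining where
  "remaining u v \<longleftrightarrow> ended e u \<and> ended e v \<or> u = [] \<and> v = []"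

text \<open>Here \<open>s\<close> and \<open>t\<close> are the unread parts of the tapes. The
  potential is bounded, rather than the length, because reduction does not increase it.\<close>

definition good where
  "good s t x \<longleftrightarrow> (case x of None \<Rightarrow> True | Some (u, v, p) \<Rightarrow>
     potential R u \<le> K \<and> potential R v \<le> K \<and> P p \<and> set u \<subseteq> set bs \<and> set v \<subseteq> set bs \<and>
     remaining (u @ s) (v @ t))"

definition stable where
  "stable x \<longleftrightarrow> (case x of None \<Rightarrow> True | Some (u, v, p) \<Rightarrow> \<not> (long e K u \<and> long e K v))"

text \<open>The lexicographic order on potentials and lengths as a number: the base exceeds the
  total length of the two buffers.\<close>

definition weight where
  "weight x = (case x of None \<Rightarrow> 0 | Some (u, v, p) \<Rightarrow>
     (potential R u + potential R v) * Suc (2 * (K + m)) + length u + length v)"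

lemma long_not_Nil: "long e K u \<Longrightarrow> u \<noteq> []"
  by (auto simp: long_def window_def)

lemma advance_good:
  assumes "good s t x"
  shows "good s t (advance e rs x)"
    "holds R (extend s t (advance e rs x)) \<longleftrightarrow> holds R (extend s t x)"
    "stable x \<or> stable (advance e rs x) \<or> weight (advance e rs x) < weight x"
proof -
  have "good s t (advance e rs x) \<and>
    (holds R (extend s t (advance e rs x)) \<longleftrightarrow> holds R (extend s t x)) \<and>
    (stable x \<or> stable (advance e rs x) \<or> weight (advance e rs x) < weight x)"
  proof (cases "stable x")
    case True
    then have "advance e rs x = x"
      by (auto simp: stable_def advance_def split: option.splits)
    then show ?thesis using assms True by simp
  next
    case False
    then obtain u v p where x: "x = Some (u, v, p)" "long e K u" "long e K v"
      by (auto simp: stable_def split: option.splits)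
    have adv: "advance e rs x = reduce rs u v p" using x by (simp add: advance_def)
    have g: "potential R u \<le> K" "potential R v \<le> K" "P p" "set u \<subseteq> set bs" "set v \<subseteq> set bs"
      "remaining (u @ s) (v @ t)" using assms x by (auto simp: good_def)
    \<comment> \<open>Locality: reducing the buffers acts as reducing the whole remaining words, and
      for these correctness is known.\<close>
    have ext: "reduce rs (u @ s) (v @ t) p = extend s t (advance e rs x)"
      using reduce_append'[OF x(2,3)] adv by simp
    have "holds R (extend s t x) \<longleftrightarrow> holds R (reduce rs (u @ s) (v @ t) p)"
      using reduce_correct[OF R g(3), of "u @ s" "v @ t"] long_not_Nil[OF x(2)] x(1)
      by (simp add: extend_def)
    then have holds: "holds R (extend s t (advance e rs x)) \<longleftrightarrow> holds R (extend s t x)"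
      using ext by simp
    show ?thesis
    proof (cases "advance e rs x")
      case None
      then show ?thesis using holds by (simp add: good_def stable_def)
    next
      case (Some y)
      then obtain u' v' p' where y: "advance e rs x = Some (u', v', p')" by (cases y) auto
      then have red: "reduce rs u v p = Some (u', v', p')" using adv by simp
      have red': "reduce rs (u @ s) (v @ t) p = Some (u' @ s, v' @ t, p')"
        using ext y by (simp add: extend_def)
      note pot = reduce_potential[OF R g(3) red]
      have len: "length u' \<le> K + m" "length v' \<le> K + m"
        using length_le_potential[of u'] length_le_potential[of v'] pot(1,2) g(1,2) by linarith+
      have "remaining (u' @ s) (v' @ t)"
        using reduce_ended[OF R g(3) red' end_letter(1)] g(6) long_not_Nil[OF x(2)]
        by (auto simp: remaining_def)
      then have "good s t (advance e rs x)"
        using y g(1,2) pot(1,2) reduce_piece[OF R g(3) red]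
          order_trans[OF reduce_letters(1)[OF R g(3) red] Un_least[OF g(4) letters]]
          order_trans[OF reduce_letters(2)[OF R g(3) red] Un_least[OF g(5) letters]]
        by (simp add: good_def)
      moreover have "weight (advance e rs x) < weight x"
        using pot(3)
      proof
        let ?B = "Suc (2 * (K + m))"
        assume "potential R u' < potential R u"
        then have "Suc (potential R u' + potential R v') \<le> potential R u + potential R v"
          using pot(2) by simp
        then have "Suc (potential R u' + potential R v') * ?B \<le> (potential R u + potential R v) * ?B"
          by (rule mult_le_mono1)
        then show ?thesis using len y x(1) by (simp add: weight_def algebra_simps)
      next
        assume *: "length u' < length u \<and> length v' < length v"
        have "(potential R u' + potential R v') * Suc (2 * (K + m)) \<le>
          (potential R u + potential R v) * Suc (2 * (K + m))"
          using pot(1,2) by (intro mult_le_mono1) simp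
        then show ?thesis using * y x(1) by (simp add: weight_def)
      qed
      ultimately show ?thesis using holds by blast
    qed
  qed
  then show "good s t (advance e rs x)"
    "holds R (extend s t (advance e rs x)) \<longleftrightarrow> holds R (extend s t x)"
    "stable x \<or> stable (advance e rs x) \<or> weight (advance e rs x) < weight x" by blast+
qed

lemma advance_stable: "stable x \<Longrightarrow> advance e rs x = x"
  by (auto simp: stable_def advance_def split: option.splits)

lemma advances_good:
  assumes "good s t x"
  shows "good s t ((advance e rs ^^ n) x) \<and>
    (holds R (extend s t ((advance e rs ^^ n) x)) \<longleftrightarrow> holds R (extend s t x)) \<and>
    (stable ((advance e rs ^^ n) x) \<or> weight ((advance e rs ^^ n) x) + n \<le> weight x)"
proof (induction n)
  case (Suc n)
  let ?y = "(advance e rs ^^ n) x"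
  have y: "good s t ?y" using Suc by blast
  from advance_good[OF y] show ?case using Suc advance_stable[of ?y] by auto
qed (use assms in simp)

lemma normalise_good:
  assumes "good s t x"
  shows "good s t (normalise e rs x)" "stable (normalise e rs x)"
    "holds R (extend s t (normalise e rs x)) \<longleftrightarrow> holds R (extend s t x)"
proof -
  have "weight x < fuel rs"
  proof (cases x)
    case None
    then show ?thesis by (simp add: weight_def fuel_def)
  next
    case (Some y)
    obtain u v p where y: "y = (u, v, p)" by (cases y)
    then have pot: "potential R u \<le> K" "potential R v \<le> K" using assms Some by (auto simp: good_def)
    then have len: "length u \<le> K + m" "length v \<le> K + m"
      using length_le_potential[of u] length_le_potential[of v] by linarith+
    have "(potential R u + potential R v) * Suc (2 * (K + m)) \<le> (2 * K) * Suc (2 * (K + m))"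
      using pot by (intro mult_le_mono1) simp
    then show ?thesis using len Some y by (simp add: weight_def fuel_def)
  qed
  then show "good s t (normalise e rs x)" "stable (normalise e rs x)"
    "holds R (extend s t (normalise e rs x)) \<longleftrightarrow> holds R (extend s t x)"
    using advances_good[OF assms, of "fuel rs"] unfolding normalise_def by auto
qed

lemma good_in_states: "good s t (Some q) \<Longrightarrow> q \<in> set (buffer_states bs rs)"
proof -
  assume g: "good s t (Some q)"
  obtain u v p where q: "q = (u, v, p)" by (cases q)
  have "length u \<le> K + m" "length v \<le> K + m"
    using g q length_le_potential[of u] length_le_potential[of v] by (auto simp: good_def)
  moreover have "set p \<subseteq> set bs" "length p \<le> m"
    using g q piece_letters letters length_piece by (auto simp: good_def)
  ultimately show ?thesis using g q by (simp add: set_buffer_states good_def)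
qed

text \<open>A buffer that is not long has fewer than \<open>K\<close> letters, so one more keeps its
  length, and thereby its potential, within \<open>K\<close>.\<close>

lemma good_read:
  assumes "good (a # s) t (Some (u, v, p))" "\<not> long e K u" "a \<in> set bs"
  shows "good s t (Some (u @ [a], v, p))"
proof -
  have "potential R (u @ [a]) \<le> K"
    using potential_le_length[of R "u @ [a]"] assms(2) by (simp add: long_def)
  then show ?thesis using assms by (simp add: good_def)
qed

lemma good_read':
  assumes "good s (a # t) (Some (u, v, p))" "\<not> long e K v" "a \<in> set bs"
  shows "good s t (Some (u, v @ [a], p))"
proof -
  have "potential R (v @ [a]) \<le> K"
    using potential_le_length[of R "v @ [a]"] assms(2) by (simp add: long_def)
  then show ?thesis using assms by (simp add: good_def)
qed

lemma transition_left:
  assumes "good (a # s) t (Some (u, v, p))" "\<not> long e K u" "a \<in> set bs"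
  shows "good s t (transition e bs rs (u, v, p) a)" "stable (transition e bs rs (u, v, p) a)"
    "holds R (extend s t (transition e bs rs (u, v, p) a)) \<longleftrightarrow> prefixed_eqv R p (u @ a # s) (v @ t)"
proof -
  note g = normalise_good[OF good_read[OF assms]]
  have "transition e bs rs (u, v, p) a = normalise e rs (Some (u @ [a], v, p))"
    using assms(2,3) g(1) good_in_states
    by (auto simp: transition_def split: option.splits)
  then show "good s t (transition e bs rs (u, v, p) a)" "stable (transition e bs rs (u, v, p) a)"
    "holds R (extend s t (transition e bs rs (u, v, p) a)) \<longleftrightarrow> prefixed_eqv R p (u @ a # s) (v @ t)"
    using g by (simp_all add: extend_def)
qed

lemma transition_right:
  assumes "good s (a # t) (Some (u, v, p))" "long e K u" "\<not> long e K v" "a \<in> set bs"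
  shows "good s t (transition e bs rs (u, v, p) a)" "stable (transition e bs rs (u, v, p) a)"
    "holds R (extend s t (transition e bs rs (u, v, p) a)) \<longleftrightarrow> prefixed_eqv R p (u @ s) (v @ a # t)"
proof -
  note g = normalise_good[OF good_read'[OF assms(1,3,4)]]
  have "transition e bs rs (u, v, p) a = normalise e rs (Some (u, v @ [a], p))"
    using assms(2,4) g(1) good_in_states
    by (auto simp: transition_def split: option.splits)
  then show "good s t (transition e bs rs (u, v, p) a)" "stable (transition e bs rs (u, v, p) a)"
    "holds R (extend s t (transition e bs rs (u, v, p) a)) \<longleftrightarrow> prefixed_eqv R p (u @ s) (v @ a # t)"
    using g by (simp_all add: extend_def)
qed

text \<open>A buffer that is not long contains no end-marker; with its tape used up, only the empty
  pair can remain.\<close>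

lemma not_long_exhausted:
  assumes "remaining (u @ s) w" "\<not> long e K u" "s = []"
  shows "u = []" "w = []"
  using assms by (auto simp: remaining_def ended_def long_def)

end

section \<open>The two-tape automaton\<close>

lemma rtranclp_first_step: "x \<noteq> y \<Longrightarrow> r\<^sup>*\<^sup>* x y \<longleftrightarrow> (\<exists>z. r x z \<and> r\<^sup>*\<^sup>* z y)"
proof
  assume "x \<noteq> y" "r\<^sup>*\<^sup>* x y"
  from this(2,1) show "\<exists>z. r x z \<and> r\<^sup>*\<^sup>* z y" by (cases rule: converse_rtranclpE) blast+
qed (elim exE conjE, rule converse_rtranclp_into_rtranclp)

section \<open>Relations over the alphabet with end-marker\<close>

lemma word_equiv_lists:
  assumes "R \<subseteq> lists A \<times> lists A" "(u, v) \<in> word_equiv A R"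
  shows "u \<in> lists A" "v \<in> lists A"
  using assms(2,1) by (induction) auto

definition map_relations :: "('a list \<Rightarrow> 'b list) \<Rightarrow> ('a list \<times> 'a list) set \<Rightarrow> ('b list \<times> 'b list) set" where
  "map_relations f R = map_prod f f ` R"

lemma relation_words_map: "relation_words (map_relations f R) = f ` relation_words R"
  by (force simp: relation_words_def map_relations_def)

lemma map_eq_append3E:
  assumes "map f w = x @ p @ y"
  obtains x' p' y' where "w = x' @ p' @ y'" "x = map f x'" "p = map f p'" "y = map f y'"
proof -
  obtain x' z where "w = x' @ z" "x = map f x'" "p @ y = map f z"
    using assms unfolding map_eq_append_conv by metis
  moreover from this(3)[symmetric] obtain p' y' where "z = p' @ y'" "p = map f p'" "y = map f y'"
    unfolding map_eq_append_conv by metis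
  ultimately show thesis using that by metis
qed

lemma piece_map_Letter:
  assumes "piece (map_relations (map Letter) R) p"
  obtains p' where "p = map Letter p'" "piece R p'"
proof (cases "p = []")
  case True
  then show thesis using that[of "[]"] by simp
next
  case False
  obtain v v' x y x' y' where v: "v \<in> relation_words (map_relations (map Letter) R)"
    "v' \<in> relation_words (map_relations (map Letter) R)" "v = x @ p @ y" "v' = x' @ p @ y'"
    "v \<noteq> v' \<or> x \<noteq> x'"
    using assms False by (rule pieceE)
  obtain w w' where *: "w \<in> relation_words R" "w' \<in> relation_words R"
    "map Letter w = x @ p @ y" "map Letter w' = x' @ p @ y'" "map Letter w \<noteq> map Letter w' \<or> x \<noteq> x'"
    using v unfolding relation_words_map by blast
  have inj: "inj Letter" by (simp add: inj_def)
  obtain x0 p0 y0 where 1: "w = x0 @ p0 @ y0" "x = map Letter x0" "p = map Letter p0"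
    using *(3) by (rule map_eq_append3E)
  obtain x1 p1 y1 where 2: "w' = x1 @ p1 @ y1" "x' = map Letter x1" "p = map Letter p1"
    using *(4) by (rule map_eq_append3E)
  have "p1 = p0" using 1 2 inj_map_eq_map[OF inj] by metis
  then have "piece R p0"
    using pieceI[of w R w' x0 p0 y0 x1 y1] * 1 2 by auto
  then show thesis using that 1 by blast
qed

lemma weakly_C_map_Letter:
  assumes "weakly_C n R"
  shows "weakly_C n (map_relations (map Letter) R)"
  unfolding weakly_C_def relation_words_map
proof (intro ballI notI, elim exE conjE imageE)
  fix w ps r
  assume *: "length ps < n" "\<forall>p\<in>set ps. piece (map_relations (map Letter) R) p" "w = concat ps"
    "w = map Letter r" "r \<in> relation_words R"
  have "\<exists>qs. ps = map (map Letter) qs \<and> (\<forall>q\<in>set qs. piece R q)"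
    using *(2)
  proof (induction ps)
    case (Cons p ps)
    then obtain qs where "ps = map (map Letter) qs" "\<forall>q\<in>set qs. piece R q" by auto
    moreover obtain q where "p = map Letter q" "piece R q" using Cons piece_map_Letter by (metis list.set_intros(1))
    ultimately show ?case by (intro exI[of _ "q # qs"]) auto
  qed simp
  then obtain qs where qs: "ps = map (map Letter) qs" "\<forall>q\<in>set qs. piece R q" by blast
  have "map Letter r = map Letter (concat qs)" using * qs by (simp add: map_concat)
  then have "r = concat qs" by (simp add: inj_map_eq_map inj_def)
  moreover have "length qs < n" using qs * by simp
  ultimately show False using assms *(5) qs(2) unfolding weakly_C_def by blast
qed

lemma word_equiv_eqv:
  assumes "(u, v) \<in> word_equiv A R"
  shows "eqv (map_relations (map Letter) R) (map Letter u) (map Letter v)"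
  using assms
proof induction
  case (rel u v)
  then have "(map Letter u, map Letter v) \<in> map_relations (map Letter) R"
    by (force simp: map_relations_def)
  then have "sim (map_relations (map Letter) R) (map Letter u) (map Letter v)"
    by (force simp: sim_def relation_words_def)
  then show ?case using eqv_sim[of _ _ _ "[]"] by fastforce
next
  case (mult u v u' v')
  then show ?case
    using rtranclp_trans[OF eqv_append[OF mult(3), of "map Letter u'"]
      eqv_prepend[OF mult(4), of "map Letter v"]]
    by simp
qed (auto intro: eqv_sym)

text \<open>Tapes only rewrite to tapes: relation words contain no end-marker, and being nonempty
  they cannot be inserted behind the final one.\<close>

lemma eqv_word_equiv:
  assumes R: "R \<subseteq> lists A \<times> lists A" and ne: "[] \<notin> relation_words R"
    and eqv: "eqv (map_relations (map Letter) R) (tape u) x" and u: "u \<in> lists A"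
  shows "\<exists>v. x = tape v \<and> (u, v) \<in> word_equiv A R"
  using eqv
proof (induction)
  case base
  then show ?case by (intro exI[of _ u] conjI word_equiv.refl[OF u]) simp
next
  case (step y z)
  then obtain v where v: "y = tape v" "(u, v) \<in> word_equiv A R" by blast
  let ?L = "map_relations (map Letter) R"
  have sim: "\<exists>\<sigma>. s = map Letter \<sigma> \<and> (\<rho>, \<sigma>) \<in> word_equiv A R"
    if "sim ?L (map Letter \<rho>) s" "\<rho> \<in> relation_words R" for \<rho> s
  proof -
    have "(map Letter \<rho>, s) \<in> (?L \<union> ?L\<inverse>)\<^sup>*" using that by (simp add: sim_def)
    then show ?thesis
    proof (induction rule: rtrancl_induct)
      case base
      have "\<rho> \<in> lists A" using R that(2) by (auto simp: relation_words_def)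
      then show ?case by (intro exI[of _ \<rho>] conjI word_equiv.refl) simp
    next
      case (step s t)
      then obtain \<sigma> where \<sigma>: "s = map Letter \<sigma>" "(\<rho>, \<sigma>) \<in> word_equiv A R" by blast
      have inj: "inj Letter" by (simp add: inj_def)
      obtain \<tau> where "t = map Letter \<tau>" "(\<sigma>, \<tau>) \<in> R \<or> (\<tau>, \<sigma>) \<in> R"
        using step(2) \<sigma>(1) by (auto simp: map_relations_def inj_map_eq_map[OF inj])
      then show ?case using \<sigma> word_equiv.rel word_equiv.sym word_equiv.trans by metis
    qed
  qed
  from step(2) obtain r s w q where rw: "sim ?L r s" "y = w @ r @ q" "z = w @ s @ q"
    by (auto elim: rewrite.cases)
  obtain \<rho> where \<rho>: "r = map Letter \<rho>" "\<rho> \<in> relation_words R"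
    using sim_left[OF rw(1)] unfolding relation_words_map by blast
  then obtain \<sigma> where \<sigma>: "s = map Letter \<sigma>" "(\<rho>, \<sigma>) \<in> word_equiv A R" using sim rw(1) by blast
  have eq: "map Letter v @ [End_Marker] = w @ map Letter \<rho> @ q"
    using v(1) rw(2) \<rho>(1) by (simp add: tape_def)
  have "\<rho> \<noteq> []" using ne \<rho>(2) by auto
  have "q \<noteq> []"
  proof
    assume "q = []"
    then have "last (map Letter v @ [End_Marker]) = last (w @ map Letter \<rho>)" using eq by simp
    then show False using \<open>\<rho> \<noteq> []\<close> by (simp add: last_map)
  qed
  then obtain q' where q': "q = q' @ [End_Marker]"
    using arg_cong[OF eq, of last] by (cases q rule: rev_cases) auto
  then have "map Letter v = w @ map Letter \<rho> @ q'" using eq by simp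
  from map_eq_append3E[OF this] obtain w0 \<rho>' q0 where v': "v = w0 @ \<rho>' @ q0" "w = map Letter w0" "map Letter \<rho> = map Letter \<rho>'"
    "q' = map Letter q0"
    by blast
  have "\<rho>' = \<rho>" using v'(3) by (simp add: inj_map_eq_map inj_def)
  have "v \<in> lists A" using word_equiv_lists[OF R v(2)] by blast
  then have "(v, w0 @ \<sigma> @ q0) \<in> word_equiv A R"
    using v' \<open>\<rho>' = \<rho>\<close> \<sigma>(2) by (auto intro!: word_equiv.mult word_equiv.refl)
  moreover have "z = tape (w0 @ \<sigma> @ q0)" using rw(3) v' \<sigma>(1) q' by (simp add: tape_def)
  ultimately show ?case using v(2) word_equiv.trans by blast
qed

lemma weakly_C_Nil: "weakly_C n R \<Longrightarrow> 0 < n \<Longrightarrow> [] \<notin> relation_words R"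
  unfolding weakly_C_def by (metis concat.simps(1) empty_iff list.set(1) list.size(3))

text \<open>The end-marker is treated as a further letter that occurs in no relation word, so the tapes are
  words equivalent if and only if their contents are.\<close>

definition letter_relations where
  "letter_relations rs = map (map_prod (map Letter) (map Letter)) rs"

lemma set_letter_relations: "set (letter_relations rs) = map_relations (map Letter) (set rs)"
  by (simp add: letter_relations_def map_relations_def)

section \<open>The machine and its runs\<close>

definition tape_letters where
  "tape_letters as = End_Marker # map Letter as"

definition machine_states where
  "machine_states as rs = buffer_states (tape_letters as) (letter_relations rs)"

definition reads_second where
  "reads_second rs q \<longleftrightarrow> long End_Marker (window (letter_relations rs)) (fst q)"

definition machine_transition where
  "machine_transition as rs = transition End_Marker (tape_letters as) (letter_relations rs)"

text \<open>The numbering \<open>h\<close> is a parameter: over an arbitrary alphabet any injection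
  on the finite state set serves, over numbers the computable \<open>encode\<close> does.\<close>

definition machine ::
  "('a tape_symbol buffers \<Rightarrow> nat) \<Rightarrow> 'a list \<Rightarrow> ('a list \<times> 'a list) list \<Rightarrow> (nat, 'a) two_tape" where
  "machine h as rs =
     \<lparr>states1 = h ` {q \<in> set (machine_states as rs). \<not> reads_second rs q},
      states2 = h ` {q \<in> set (machine_states as rs). reads_second rs q},
      initial = h ([], [], []),
      accepting = {h ([], [], [])},
      next_state = (\<lambda>n s. if n \<in> h ` set (machine_states as rs)
        then map_option h (machine_transition as rs (inv_into (set (machine_states as rs)) h n) s)
        else None)\<rparr>"

locale presented_machine =
  fixes h :: "'a tape_symbol buffers \<Rightarrow> nat" and as :: "'a list" and rs :: "('a list \<times> 'a list) list"
  assumes presentation: "finite_presentation (set as) (set rs)" "weakly_C 4 (set rs)"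
    and inj: "inj_on h (set (machine_states as rs))"
begin

abbreviation "L \<equiv> map_relations (map Letter) (set rs) :: ('a tape_symbol list \<times> _) set"
abbreviation "M \<equiv> machine h as rs"
abbreviation "Q \<equiv> set (machine_states as rs)"

sublocale buffered L "letter_relations rs" End_Marker "tape_letters as"
proof
  show "weakly_C 4 L" using presentation(2) by (rule weakly_C_map_Letter)
  show "L = set (letter_relations rs)" by (simp add: set_letter_relations)
  show "End_Marker \<notin> \<Union> (set ` relation_words L)" by (auto simp: relation_words_map)
  show "End_Marker \<in> set (tape_letters as)" by (simp add: tape_letters_def)
  have "\<Union> (set ` relation_words (set rs)) \<subseteq> set as"
    using presentation(1) by (fastforce simp: finite_presentation_def relation_words_def)
  then show "\<Union> (set ` relation_words L) \<subseteq> set (tape_letters as)"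
    by (fastforce simp: relation_words_map tape_letters_def)
qed

lemma initial_state: "([], [], []) \<in> Q"
  by (simp add: machine_states_def set_buffer_states)

lemma next_state_iff:
  "next_state M n s = Some n' \<longleftrightarrow>
    (\<exists>q\<in>Q. \<exists>q'. n = h q \<and> n' = h q' \<and> machine_transition as rs q s = Some q')"
  using inj by (auto simp: machine_def)

lemma next_state_h: "q \<in> Q \<Longrightarrow> next_state M (h q) s = map_option h (machine_transition as rs q s)"
  using inj by (simp add: machine_def)

lemma transition_state:
  "machine_transition as rs q s = Some q' \<Longrightarrow> q' \<in> Q \<and> s \<in> set (tape_letters as)"
  by (auto simp: machine_transition_def transition_def machine_states_def split: option.splits if_splits)

lemma states1_h: "q \<in> Q \<Longrightarrow> h q \<in> states1 M \<longleftrightarrow> \<not> reads_second rs q"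
  using inj by (auto simp: machine_def dest: inj_onD)

lemma states2_h: "q \<in> Q \<Longrightarrow> h q \<in> states2 M \<longleftrightarrow> reads_second rs q"
  using inj by (auto simp: machine_def dest: inj_onD)

lemma automaton: "two_tape_automaton (set as) M"
  unfolding two_tape_automaton_def
proof (intro conjI allI impI)
  show "states1 M \<inter> states2 M = {}"
    using inj by (fastforce simp: machine_def dest: inj_onD)
  have un: "states1 M \<union> states2 M = h ` Q" by (auto simp: machine_def)
  show "initial M \<in> states1 M \<union> states2 M" "accepting M \<subseteq> states1 M \<union> states2 M"
    unfolding un using initial_state by (auto simp: machine_def)
  show "finite (states1 M)" "finite (states2 M)" by (auto simp: machine_def)
  fix n s n' assume *: "next_state M n s = Some n'"
  then show "n \<in> states1 M \<union> states2 M" "n' \<in> states1 M \<union> states2 M"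
    unfolding un next_state_iff using transition_state by auto
  show "s \<in> insert End_Marker (Letter ` set as)"
    using * transition_state unfolding next_state_iff tape_letters_def by fastforce
qed

lemma step_iff:
  assumes "q \<in> Q"
  shows "step M (h q, s, t) c \<longleftrightarrow>
    (\<exists>a q'. machine_transition as rs q a = Some q' \<and>
      (\<not> reads_second rs q \<and> (\<exists>s'. s = a # s' \<and> c = (h q', s', t)) \<or>
       reads_second rs q \<and> (\<exists>t'. t = a # t' \<and> c = (h q', s, t'))))"
  using assms by (auto simp: step.simps next_state_h states1_h states2_h)

text \<open>Acceptance is decided by buffered text followed by unread text, and each step preserves
  the condition. With both tapes exhausted stability forces empty buffers, and the empty word meets
  only the empty piece.\<close>

lemma accepts_iff:
  assumes "good s t (Some (u, v, p))" "stable (Some (u, v, p))"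
    "set s \<subseteq> set (tape_letters as)" "set t \<subseteq> set (tape_letters as)"
  shows "(step M)\<^sup>*\<^sup>* (h (u, v, p), s, t) (h ([], [], []), [], []) \<longleftrightarrow> prefixed_eqv L p (u @ s) (v @ t)"
  using assms
proof (induction "length s + length t" arbitrary: s t u v p rule: less_induct)
  case less
  let ?q = "(u, v, p)" and ?acc = "\<lambda>c. (step M)\<^sup>*\<^sup>* c (h ([], [], []), [], [])"
  have q: "?q \<in> Q" unfolding machine_states_def by (rule good_in_states[OF less.prems(1)])
  have rem: "remaining (u @ s) (v @ t)" using less.prems(1) by (simp add: good_def)
  have rem': "remaining (v @ t) (u @ s)" using rem by (auto simp: remaining_def)
  have IH: "?acc (h q', s', t') \<longleftrightarrow> holds L (extend s' t' (Some q'))"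
    if "length s' + length t' < length s + length t" "good s' t' (Some q')" "stable (Some q')"
      "set s' \<subseteq> set s" "set t' \<subseteq> set t" for q' s' t'
    using less.hyps[of s' t' "fst q'" "fst (snd q')" "snd (snd q')"] that less.prems(3,4)
    by (auto simp: extend_def split: prod.splits)
  show ?case
  proof (cases "s = [] \<and> t = []")
    case True
    have "\<not> long End_Marker K u \<or> \<not> long End_Marker K v"
      using less.prems(2) by (simp add: stable_def)
    then have "u = [] \<and> v = []"
    proof
      assume "\<not> long End_Marker K u"
      from not_long_exhausted[OF rem this] show ?thesis using True by blast
    next
      assume "\<not> long End_Marker K v"
      from not_long_exhausted[OF rem' this] show ?thesis using True by blast
    qed
    then have empty: "u = []" "v = []" by blast+
    have "\<not> step M (h ?q, s, t) c" for c using step_iff[OF q] True by simp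
    then have "?acc (h ?q, s, t) \<longleftrightarrow> h ?q = h ([], [], [])"
      using True rtranclp_first_step[of "(h ?q, s, t)" "(h ([], [], []), [], [])" "step M"] by auto
    also have "\<dots> \<longleftrightarrow> p = []" using inj_onD[OF inj _ q initial_state] empty by auto
    also have "\<dots> \<longleftrightarrow> prefixed_eqv L p (u @ s) (v @ t)"
      using empty True eqv_Nil by (auto simp: prefixed_eqv_def)
    finally show ?thesis .
  next
    case False
    then have step: "?acc (h ?q, s, t) \<longleftrightarrow> (\<exists>c. step M (h ?q, s, t) c \<and> ?acc c)"
      by (intro rtranclp_first_step) auto
    show ?thesis
    proof (cases "reads_second rs ?q")
      case second: False
      then have nl: "\<not> long End_Marker K u" by (simp add: reads_second_def)
      obtain a s' where s: "s = a # s'"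
        using not_long_exhausted[OF rem nl] False by (cases s) auto
      have a: "a \<in> set (tape_letters as)" using less.prems(3) s by simp
      note tr = transition_left[OF less.prems(1)[unfolded s] nl a, folded machine_transition_def]
      have "?acc (h ?q, s, t) \<longleftrightarrow>
        (\<exists>q'. machine_transition as rs ?q a = Some q' \<and> ?acc (h q', s', t))"
        unfolding step step_iff[OF q] using second s by auto
      also have "\<dots> \<longleftrightarrow> holds L (extend s' t (machine_transition as rs ?q a))"
      proof (cases "machine_transition as rs ?q a")
        case (Some q')
        then show ?thesis using IH[of s' t q'] tr(1,2) s by (auto simp: machine_transition_def)
      qed (simp add: extend_def)
      also have "\<dots> \<longleftrightarrow> prefixed_eqv L p (u @ s) (v @ t)" using tr(3) s by (simp add: machine_transition_def)
      finally show ?thesis .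
    next
      case second: True
      then have l: "long End_Marker K u" by (simp add: reads_second_def)
      then have nl: "\<not> long End_Marker K v" using less.prems(2) by (simp add: stable_def)
      obtain a t' where t: "t = a # t'"
        using not_long_exhausted[OF rem' nl] l long_not_Nil by (cases t) auto
      have a: "a \<in> set (tape_letters as)" using less.prems(4) t by simp
      note tr = transition_right[OF less.prems(1)[unfolded t] l nl a]
      have "?acc (h ?q, s, t) \<longleftrightarrow>
        (\<exists>q'. machine_transition as rs ?q a = Some q' \<and> ?acc (h q', s, t'))"
        unfolding step step_iff[OF q] using second t by auto
      also have "\<dots> \<longleftrightarrow> holds L (extend s t' (machine_transition as rs ?q a))"
      proof (cases "machine_transition as rs ?q a")
        case (Some q')
        then show ?thesis using IH[of s t' q'] tr(1,2) t by (auto simp: machine_transition_def)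
      qed (simp add: extend_def)
      also have "\<dots> \<longleftrightarrow> prefixed_eqv L p (u @ s) (v @ t)" using tr(3) t by (simp add: machine_transition_def)
      finally show ?thesis .
    qed
  qed
qed

text \<open>Transitions are undefined on letters outside the alphabet, so accepted tapes carry words
  over it.\<close>

lemma step_letters:
  "(step M)\<^sup>*\<^sup>* (n, s, t) (n', s', t') \<Longrightarrow> set s \<subseteq> set s' \<union> set (tape_letters as) \<and>
    set t \<subseteq> set t' \<union> set (tape_letters as)"
proof (induction "(n, s, t)" arbitrary: n s t rule: converse_rtranclp_induct)
  case (step y)
  have "x \<in> set (tape_letters as)" if "next_state M n x = Some n'" for n x n'
    using that transition_state unfolding next_state_iff by blast
  then show ?case using step by (auto elim!: step.cases)
qed auto

lemma recognised: "recognised M = word_equiv (set as) (set rs)"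
proof -
  have pres: "set rs \<subseteq> lists (set as) \<times> lists (set as)"
    using presentation(1) by (simp add: finite_presentation_def)
  have tape: "set (tape u) \<subseteq> set (tape_letters as) \<longleftrightarrow> u \<in> lists (set as)" for u
    by (auto simp: tape_def tape_letters_def)
  have run: "(step M)\<^sup>*\<^sup>* (h ([], [], []), tape u, tape v) (h ([], [], []), [], []) \<longleftrightarrow>
    eqv L (tape u) (tape v)" if "u \<in> lists (set as)" "v \<in> lists (set as)" for u v
  proof -
    have "ended End_Marker (tape u)" for u :: "'a list"
      by (auto simp: ended_def tape_def)
    then have "good (tape u) (tape v) (Some ([], [], []))"
      using potential_le_length[of L "[]"] by (simp add: good_def remaining_def)
    moreover have "stable (Some ([], [], []))" by (simp add: stable_def long_def window_def)
    ultimately show ?thesis using accepts_iff[of "tape u" "tape v" "[]" "[]" "[]"] that tape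
      by (simp add: prefixed_eqv_Nil)
  qed
  have "(u, v) \<in> recognised M \<longleftrightarrow> (u, v) \<in> word_equiv (set as) (set rs)" for u v
  proof
    assume "(u, v) \<in> recognised M"
    then have acc: "(step M)\<^sup>*\<^sup>* (h ([], [], []), tape u, tape v) (h ([], [], []), [], [])"
      by (auto simp: recognised_def machine_def)
    then have uv: "u \<in> lists (set as)" "v \<in> lists (set as)" using step_letters tape by fastforce+
    have "inj (map Letter :: 'a list \<Rightarrow> _)" by (simp add: inj_def)
    then have tape_inj: "tape u = tape v \<Longrightarrow> u = v" for u v :: "'a list"
      by (auto simp: tape_def inj_eq)
    have "eqv L (tape u) (tape v)" using run[OF uv] acc by blast
    then obtain v' where "tape v = tape v'" "(u, v') \<in> word_equiv (set as) (set rs)"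
      using eqv_word_equiv[OF pres weakly_C_Nil[OF presentation(2)]] uv(1)
      by (metis zero_less_numeral)
    then show "(u, v) \<in> word_equiv (set as) (set rs)" using tape_inj by blast
  next
    assume *: "(u, v) \<in> word_equiv (set as) (set rs)"
    have "eqv L (tape u) (tape v)"
      using eqv_append[OF word_equiv_eqv[OF *]] by (simp add: tape_def)
    then show "(u, v) \<in> recognised M"
      using run word_equiv_lists[OF pres *] by (simp add: recognised_def machine_def)
  qed
  then show ?thesis by (simp add: set_eq_iff split_paired_all)
qed

end

section \<open>Computable functions\<close>

text \<open>Injectivity suffices, since functions only have to act correctly on codes. The instances
  are chosen to agree with the prescribed codes of presentations and automata.\<close>

class encodable =
  fixes encode :: "'a \<Rightarrow> nat"
  assumes inj_encode: "inj encode"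
begin

lemma encode_eq_iff [simp]: "encode x = encode y \<longleftrightarrow> x = y"
  using inj_encode by (auto dest: injD)

end

instantiation nat :: encodable
begin
definition encode_nat_def [simp]: "encode (n::nat) = n"
instance by standard (simp add: inj_def)
end

instantiation bool :: encodable
begin
definition encode_bool_def [simp]: "encode (b::bool) = (if b then 1 else 0)"
instance by standard (auto simp: inj_def split: if_splits)
end

instantiation prod :: (encodable, encodable) encodable
begin
definition encode_prod_def: "encode p = prod_encode (encode (fst p), encode (snd p))"
instance by standard (auto simp: inj_def encode_prod_def)
end

instantiation list :: (encodable) encodable
begin
definition encode_list_def: "encode xs = list_encode (map encode xs)"
instance
proof
  show "inj (encode :: 'a list \<Rightarrow> nat)"
    by (auto simp: encode_list_def list_encode_eq inj_map_eq_map[OF inj_encode] intro!: injI)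
qed
end

instantiation option :: (encodable) encodable
begin
definition encode_option_def: "encode x = (case x of None \<Rightarrow> 0 | Some y \<Rightarrow> Suc (encode y))"
instance by standard (auto simp: inj_def encode_option_def split: option.splits)
end

instantiation tape_symbol :: (encodable) encodable
begin
definition encode_tape_symbol_def:
  "encode x = (case x of End_Marker \<Rightarrow> 0 | Letter a \<Rightarrow> Suc (encode a))"
instance by standard (auto simp: inj_def encode_tape_symbol_def split: tape_symbol.splits)
end

text \<open>Realisers are total, also on numbers that code nothing: a recursion over a code runs through all
  smaller numbers, and one undefined value would make it diverge.\<close>

definition total_recursive :: "(nat \<Rightarrow> nat) \<Rightarrow> bool" where
  "total_recursive f \<longleftrightarrow> partial_recursive (\<lambda>n. Some (f n))"

lemma total_recursive_comp:
  "total_recursive f \<Longrightarrow> total_recursive g \<Longrightarrow> total_recursive (\<lambda>n. f (g n))"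
  using partial_recursive.comp[of "\<lambda>n. Some (f n)" "\<lambda>n. Some (g n)"]
  by (simp add: total_recursive_def)

lemma total_recursive_pair:
  "total_recursive f \<Longrightarrow> total_recursive g \<Longrightarrow> total_recursive (\<lambda>n. prod_encode (f n, g n))"
  using partial_recursive.pair[of "\<lambda>n. Some (f n)" "\<lambda>n. Some (g n)"]
  by (simp add: total_recursive_def)

lemma total_recursive_fst: "total_recursive (\<lambda>n. fst (prod_decode n))"
  and total_recursive_snd: "total_recursive (\<lambda>n. snd (prod_decode n))"
  and total_recursive_Suc: "total_recursive Suc"
  using partial_recursive.left partial_recursive.right partial_recursive.succ
  by (simp_all add: total_recursive_def)

lemma total_recursive_id: "total_recursive (\<lambda>n. n)"
  using total_recursive_pair[OF total_recursive_fst total_recursive_snd] by simp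

lemma total_recursive_const: "total_recursive (\<lambda>_. k)"
proof (induction k)
  case 0
  then show ?case using partial_recursive.zero by (simp add: total_recursive_def)
next
  case (Suc k)
  then show ?case using total_recursive_comp[OF total_recursive_Suc Suc] by simp
qed

lemma total_recursive_rec_nat:
  assumes "total_recursive f" "total_recursive g" "total_recursive a" "total_recursive k"
  shows "total_recursive (\<lambda>n. rec_nat (f (a n)) (\<lambda>i r. g (prod_encode (a n, prod_encode (i, r)))) (k n))"
proof -
  have "prim_rec (\<lambda>n. Some (f n)) (\<lambda>n. Some (g n)) b i =
    Some (rec_nat (f b) (\<lambda>i r. g (prod_encode (b, prod_encode (i, r)))) i)" for b i
    by (induction i) auto
  then have "total_recursive (\<lambda>n. case prod_decode n of
    (b, i) \<Rightarrow> rec_nat (f b) (\<lambda>i r. g (prod_encode (b, prod_encode (i, r)))) i)"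
    using partial_recursive.prim_rec[OF assms(1,2)[unfolded total_recursive_def]]
    by (simp add: total_recursive_def split_beta)
  from total_recursive_comp[OF this total_recursive_pair[OF assms(3,4)]] show ?thesis by simp
qed

text \<open>The rules below speak of functions of one context \<open>x\<close>, so that
  \<open>intro\<close> follows the syntax of a functional program. Under a binder the context
  becomes a tuple of \<open>x\<close> and the bound variables, hence the premises with
  \<open>fst\<close> and \<open>snd\<close>.\<close>

definition computable :: "('a::encodable \<Rightarrow> 'b::encodable) \<Rightarrow> bool" where
  "computable f \<longleftrightarrow> (\<exists>g. total_recursive g \<and> (\<forall>x. g (encode x) = encode (f x)))"

named_theorems computable_intros

section \<open>Closure rules for computable functions\<close>

lemma computable_cong: "computable f \<Longrightarrow> (\<And>x. f x = g x) \<Longrightarrow> computable g"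
  by (simp add: computable_def)

lemma computable_comp: "computable f \<Longrightarrow> computable g \<Longrightarrow> computable (\<lambda>x. f (g x))"
  unfolding computable_def using total_recursive_comp by metis

lemma computable_id [computable_intros]: "computable (\<lambda>x. x)"
  unfolding computable_def using total_recursive_id by metis

lemma computable_const [computable_intros]: "computable (\<lambda>x. c)"
  unfolding computable_def using total_recursive_const by metis

lemma computable_Pair [computable_intros]:
  assumes "computable f" "computable g"
  shows "computable (\<lambda>x. (f x, g x))"
proof -
  obtain f' g' where "total_recursive f'" "\<forall>x. f' (encode x) = encode (f x)"
    "total_recursive g'" "\<forall>x. g' (encode x) = encode (g x)"
    using assms unfolding computable_def by blast
  then show ?thesis
    unfolding computable_def using total_recursive_pair[of f' g']
    by (intro exI[of _ "\<lambda>n. prod_encode (f' n, g' n)"]) (simp add: encode_prod_def)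
qed

lemma computable_fst [computable_intros]: "computable f \<Longrightarrow> computable (\<lambda>x. fst (f x))"
proof (erule computable_comp[rotated])
  show "computable (fst :: 'b \<times> 'c \<Rightarrow> 'b)"
    unfolding computable_def using total_recursive_fst
    by (intro exI[of _ "\<lambda>n. fst (prod_decode n)"]) (simp add: encode_prod_def)
qed

lemma computable_snd [computable_intros]: "computable f \<Longrightarrow> computable (\<lambda>x. snd (f x))"
proof (erule computable_comp[rotated])
  show "computable (snd :: 'b \<times> 'c \<Rightarrow> 'c)"
    unfolding computable_def using total_recursive_snd
    by (intro exI[of _ "\<lambda>n. snd (prod_decode n)"]) (simp add: encode_prod_def)
qed

lemma computable_encode [computable_intros]: "computable f \<Longrightarrow> computable (\<lambda>x. encode (f x))"
  by (simp add: computable_def)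

lemma computable_encodeD: "computable (\<lambda>x. encode (f x)) \<Longrightarrow> computable f"
  by (simp add: computable_def)

lemma computable_Suc [computable_intros]: "computable f \<Longrightarrow> computable (\<lambda>x. Suc (f x))"
  by (rule computable_comp[of Suc])
    (auto simp: computable_def intro!: exI[of _ Suc] total_recursive_Suc)

lemma computable_Some [computable_intros]: "computable f \<Longrightarrow> computable (\<lambda>x. Some (f x))"
  by (rule computable_encodeD)
    (simp add: encode_option_def computable_Suc computable_encode)

lemma computable_Letter [computable_intros]: "computable f \<Longrightarrow> computable (\<lambda>x. Letter (f x))"
  by (rule computable_encodeD)
    (simp add: encode_tape_symbol_def computable_Suc computable_encode)

lemma encode_Nil: "encode [] = 0"
  and encode_Cons: "encode (x # xs) = Suc (encode (x, xs))"
  by (simp_all add: encode_list_def encode_prod_def)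

lemma computable_Cons [computable_intros]:
  "computable f \<Longrightarrow> computable g \<Longrightarrow> computable (\<lambda>x. f x # g x)"
  by (rule computable_encodeD)
    (simp add: encode_Cons computable_Suc computable_encode computable_Pair)

lemma computable_rec_nat [computable_intros]:
  assumes "computable a" "computable (\<lambda>t. g (fst t) (fst (snd t)) (snd (snd t)))" "computable k"
  shows "computable (\<lambda>x. rec_nat (a x) (g x) (k x))"
proof -
  obtain a' where a': "total_recursive a'" "\<And>x. a' (encode x) = encode (a x)"
    using assms(1) unfolding computable_def by blast
  obtain g' where g': "total_recursive g'"
    "\<And>t. g' (encode t) = encode (g (fst t) (fst (snd t)) (snd (snd t)))"
    using assms(2) unfolding computable_def by blast
  obtain k' where k': "total_recursive k'" "\<And>x. k' (encode x) = k x"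
    using assms(3) unfolding computable_def by auto
  have eq: "rec_nat (a' (encode x)) (\<lambda>i r. g' (prod_encode (encode x, prod_encode (i, r)))) n =
    encode (rec_nat (a x) (g x) n)" for x n
  proof (induction n)
    case (Suc n)
    then show ?case using g'(2)[of "(x, n, rec_nat (a x) (g x) n)"] by (simp add: encode_prod_def)
  qed (simp add: a')
  show ?thesis
    unfolding computable_def
    by (rule exI, rule conjI, rule total_recursive_rec_nat[OF a'(1) g'(1) total_recursive_id k'(1)])
      (simp only: eq k'(2) simp_thms)
qed

text \<open>Constructors with one argument are coded as successors, so a case distinction on such a
  code is a primitive recursion that ignores the value of the recursive call.\<close>

lemma computable_case_code:
  fixes c :: "'a::encodable \<Rightarrow> 'b::encodable option" and g :: "'a \<Rightarrow> 'b \<Rightarrow> 'c::encodable"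
  assumes "computable a" "computable (\<lambda>t. g (fst t) (snd t))" "computable c"
  shows "computable (\<lambda>x. case c x of None \<Rightarrow> a x | Some y \<Rightarrow> g x y)"
proof -
  obtain a' where a': "total_recursive a'" "\<And>x. a' (encode x) = encode (a x)"
    using assms(1) unfolding computable_def by blast
  obtain g' where g': "total_recursive g'" "\<And>t. g' (encode t) = encode (g (fst t) (snd t))"
    using assms(2) unfolding computable_def by blast
  obtain c' where c': "total_recursive c'" "\<And>x. c' (encode x) = encode (c x)"
    using assms(3) unfolding computable_def by blast
  let ?g = "\<lambda>n. g' (prod_encode (fst (prod_decode n), fst (prod_decode (snd (prod_decode n)))))"
  have g: "total_recursive ?g"
    by (intro total_recursive_comp[OF g'(1)] total_recursive_pair total_recursive_fst
        total_recursive_comp[OF total_recursive_fst total_recursive_snd])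
  have eq: "rec_nat (a' (encode x)) (\<lambda>i r. ?g (prod_encode (encode x, prod_encode (i, r)))) (c' (encode x)) =
    encode (case c x of None \<Rightarrow> a x | Some y \<Rightarrow> g x y)" for x
  proof (cases "c x")
    case (Some y)
    then show ?thesis using g'(2)[of "(x, y)"] by (simp add: c'(2) encode_option_def encode_prod_def)
  qed (simp add: a' c'(2) encode_option_def)
  show ?thesis
    unfolding computable_def
    by (rule exI, rule conjI, rule total_recursive_rec_nat[OF a'(1) g total_recursive_id c'(1)])
      (simp only: eq simp_thms)
qed

lemma computable_case_option [computable_intros]:
  assumes "computable c" "computable a" "computable (\<lambda>t. g (fst t) (snd t))"
  shows "computable (\<lambda>x. case c x of None \<Rightarrow> a x | Some y \<Rightarrow> g x y)"
  by (rule computable_case_code[OF assms(2,3,1)])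

lemma computable_case_list [computable_intros]:
  assumes "computable c" "computable a" "computable (\<lambda>t. g (fst t) (fst (snd t)) (snd (snd t)))"
  shows "computable (\<lambda>x. case c x of [] \<Rightarrow> a x | y # ys \<Rightarrow> g x y ys)"
proof -
  let ?c = "\<lambda>x. case c x of [] \<Rightarrow> None | y # ys \<Rightarrow> Some (y, ys)"
  have "encode (?c x) = encode (c x)" for x
    by (cases "c x") (simp_all add: encode_Nil encode_Cons encode_option_def)
  then have "computable ?c"
    using computable_encodeD[of ?c] computable_encode[OF assms(1)] by simp
  from computable_case_option[OF this assms(2,3)]
  show ?thesis by (rule computable_cong) (auto split: list.splits)
qed

lemma computable_case_prod [computable_intros]:
  "computable (\<lambda>x. f x (fst (p x)) (snd (p x))) \<Longrightarrow> computable (\<lambda>x. case p x of (a, b) \<Rightarrow> f x a b)"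
  by (simp add: split_beta)

lemma computable_Let [computable_intros]:
  assumes "computable a" "computable (\<lambda>t. f (fst t) (snd t))"
  shows "computable (\<lambda>x. let y = a x in f x y)"
  using computable_comp[OF assms(2) computable_Pair[OF computable_id assms(1)]] by simp

lemma computable_If [computable_intros]:
  assumes "computable b" "computable f" "computable g"
  shows "computable (\<lambda>x. if b x then f x else g x)"
proof -
  have "computable (\<lambda>x. rec_nat (g x) (\<lambda>_ _. f x) (encode (b x)))"
    \<comment> \<open>Inside the recursion the context is a tuple containing \<open>x\<close>;
      \<open>assms[THEN computable_comp]\<close> handles \<open>f\<close> applied to a projection of
      it.\<close>
    by (intro computable_intros assms assms[THEN computable_comp])
  then show ?thesis by (rule computable_cong) auto
qed

lemma computable_conj [computable_intros]:
  "computable f \<Longrightarrow> computable g \<Longrightarrow> computable (\<lambda>x. f x \<and> g x)"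
  by (rule computable_cong[OF computable_If[OF _ _ computable_const[of False]], of f g]) auto

lemma computable_not [computable_intros]: "computable f \<Longrightarrow> computable (\<lambda>x. \<not> f x)"
  by (rule computable_cong[OF computable_If[OF _ computable_const[of False] computable_const[of True]], of f])
    auto

lemma computable_disj [computable_intros]:
  assumes "computable f" "computable g"
  shows "computable (\<lambda>x. f x \<or> g x)"
proof -
  have "computable (\<lambda>x. \<not> (\<not> f x \<and> \<not> g x))" by (intro computable_intros assms)
  then show ?thesis by simp
qed

lemma computable_funpow [computable_intros]:
  fixes F :: "'a::encodable \<Rightarrow> 'b::encodable \<Rightarrow> 'b"
  assumes "computable (\<lambda>t. F (fst t) (snd t))" "computable n" "computable z"
  shows "computable (\<lambda>x. (F x ^^ n x) (z x))"
proof -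
  have "computable (\<lambda>x. rec_nat (z x) (\<lambda>_. F x) (n x))"
    using assms(2,3) computable_comp[OF assms(1) computable_Pair[OF computable_fst[OF computable_id]
      computable_snd[OF computable_snd[OF computable_id]]]]
    by (intro computable_intros) simp_all
  moreover have "rec_nat y (\<lambda>_. G) k = (G ^^ k) y" for G :: "'b \<Rightarrow> 'b" and y k
    by (induction k) auto
  ultimately show ?thesis by simp
qed

lemma computable_diff [computable_intros]:
  assumes "computable f" "computable g"
  shows "computable (\<lambda>x. f x - g x :: nat)"
proof -
  \<comment> \<open>The inner recursion is the predecessor; iterating it yields truncated
    subtraction.\<close>
  have "computable (\<lambda>x. ((\<lambda>k. rec_nat 0 (\<lambda>i _. i) k) ^^ g x) (f x))"
    by (intro computable_intros assms)
  moreover have "((\<lambda>k. rec_nat 0 (\<lambda>i _. i) k) ^^ n) m = m - n" for n m :: nat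
  proof (induction n)
    case (Suc n)
    then show ?case by (cases "m - n") auto
  qed simp
  ultimately show ?thesis by simp
qed

lemma computable_plus [computable_intros]:
  assumes "computable f" "computable g"
  shows "computable (\<lambda>x. f x + g x :: nat)"
proof -
  have "computable (\<lambda>x. ((\<lambda>k. Suc k) ^^ g x) (f x))" by (intro computable_intros assms)
  then show ?thesis by (simp add: add.commute)
qed

lemma computable_times [computable_intros]:
  assumes "computable f" "computable g"
  shows "computable (\<lambda>x. f x * g x :: nat)"
proof -
  have "computable (\<lambda>x. ((\<lambda>k. k + f x) ^^ g x) 0)"
    by (intro computable_intros assms assms[THEN computable_comp])
  moreover have "((\<lambda>k. k + m) ^^ n) 0 = m * n" for m n :: nat by (induction n) auto
  ultimately show ?thesis by simp
qed

lemma computable_zero: 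
  assumes "computable f"
  shows "computable (\<lambda>x. f x = (0::nat))"
proof -
  have "computable (\<lambda>x. rec_nat True (\<lambda>_ _. False) (f x))" by (intro computable_intros assms)
  moreover have "rec_nat True (\<lambda>_ _. False) n \<longleftrightarrow> n = 0" for n by (cases n) auto
  ultimately show ?thesis by simp
qed

lemma computable_le [computable_intros]:
  "computable f \<Longrightarrow> computable g \<Longrightarrow> computable (\<lambda>x. f x \<le> (g x :: nat))"
  using computable_zero[OF computable_diff[of f g]] by simp

lemma computable_less [computable_intros]:
  "computable f \<Longrightarrow> computable g \<Longrightarrow> computable (\<lambda>x. f x < (g x :: nat))"
  using computable_le[OF computable_Suc[of f], of g] by (simp add: Suc_le_eq)

text \<open>As codes are injective, two comparisons of numbers decide equality of values of any
  encodable type.\<close>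

lemma computable_eq [computable_intros]:
  assumes "computable f" "computable g"
  shows "computable (\<lambda>x. f x = g x)"
proof -
  have "computable (\<lambda>x. encode (f x) \<le> encode (g x) \<and> encode (g x) \<le> encode (f x))"
    by (intro computable_intros assms)
  then show ?thesis by (simp flip: order_eq_iff)
qed

section \<open>List programs by iteration\<close>

lemma length_le_encode: "length xs \<le> encode xs"
proof (induction xs)
  case (Cons x xs)
  then show ?case
    using le_prod_encode_2[of "encode xs" "encode x"] by (simp add: encode_Cons encode_prod_def)
qed simp

text \<open>List recursion becomes iteration: \<open>G\<close> consumes one element and idles on the
  empty list, so any large enough number of rounds will do. The code of the list is such a number
  and is available before \<open>length\<close> is known to be computable.\<close>

lemma computable_fold [computable_intros]:
  assumes "computable (\<lambda>t. F (fst t) (fst (snd t)) (snd (snd t)))" "computable xs" "computable z"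
  shows "computable (\<lambda>x. fold (F x) (xs x) (z x))"
proof -
  define G where "G x s = (case fst s of [] \<Rightarrow> s | y # ys \<Rightarrow> (ys, F x y (snd s)))" for x s
  have "computable (\<lambda>t. G (fst t) (snd t))"
    unfolding G_def
    by (intro computable_intros computable_comp[OF assms(1),
        of "\<lambda>t. (fst (fst t), fst (snd t), snd (snd (fst t)))", simplified])
  then have "computable (\<lambda>x. snd ((G x ^^ encode (xs x)) (xs x, z x)))"
    by (intro computable_intros assms)
  moreover have "snd ((G x ^^ n) (ys, y)) = fold (F x) ys y" if "length ys \<le> n" for x n ys y
    using that
  proof (induction n arbitrary: ys y)
    case (Suc n)
    show ?case
    proof (cases ys)
      case Nil
      have "(G x ^^ k) ([], y) = ([], y)" for k by (induction k) (simp_all add: G_def)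
      from this[of "Suc n"] show ?thesis using Nil by (simp del: funpow.simps)
    next
      case (Cons w ws)
      then show ?thesis
        using Suc by (simp add: funpow_Suc_right G_def del: funpow.simps)
    qed
  qed simp
  ultimately show ?thesis by (elim computable_cong) (simp add: length_le_encode)
qed

lemma computable_rev [computable_intros]:
  assumes "computable f"
  shows "computable (\<lambda>x. rev (f x))"
proof -
  have "computable (\<lambda>x. fold (\<lambda>y ys. y # ys) (f x) [])" by (intro computable_intros assms)
  then show ?thesis by (simp add: fold_Cons_rev)
qed

lemma computable_foldr [computable_intros]:
  assumes "computable (\<lambda>t. F (fst t) (fst (snd t)) (snd (snd t)))" "computable xs" "computable z"
  shows "computable (\<lambda>x. foldr (F x) (xs x) (z x))"
  unfolding foldr_conv_fold by (intro computable_intros assms)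

lemma computable_append [computable_intros]:
  assumes "computable f" "computable g"
  shows "computable (\<lambda>x. f x @ g x)"
proof -
  have "computable (\<lambda>x. foldr (\<lambda>y ys. y # ys) (f x) (g x))" by (intro computable_intros assms)
  moreover have "foldr (#) xs ys = xs @ ys" for xs ys :: "'b list" by (induction xs) auto
  ultimately show ?thesis by simp
qed

lemma computable_map [computable_intros]:
  assumes "computable (\<lambda>t. F (fst t) (snd t))" "computable xs"
  shows "computable (\<lambda>x. map (F x) (xs x))"
proof -
  have "computable (\<lambda>x. foldr (\<lambda>y ys. F x y # ys) (xs x) [])"
    by (intro computable_intros assms computable_comp[OF assms(1),
          of "\<lambda>t. (fst t, fst (snd t))", simplified])
  moreover have "foldr (\<lambda>y ys. G y # ys) zs [] = map G zs" for G :: "'b \<Rightarrow> 'c" and zs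
    by (induction zs) auto
  ultimately show ?thesis by simp
qed

lemma computable_filter [computable_intros]:
  assumes "computable (\<lambda>t. F (fst t) (snd t))" "computable xs"
  shows "computable (\<lambda>x. filter (F x) (xs x))"
proof -
  have "computable (\<lambda>x. foldr (\<lambda>y ys. if F x y then y # ys else ys) (xs x) [])"
    by (intro computable_intros assms computable_comp[OF assms(1),
          of "\<lambda>t. (fst t, fst (snd t))", simplified])
  moreover have "foldr (\<lambda>y ys. if G y then y # ys else ys) zs [] = filter G zs" for G :: "'b \<Rightarrow> bool" and zs
    by (induction zs) auto
  ultimately show ?thesis by simp
qed

lemma computable_find [computable_intros]:
  assumes "computable (\<lambda>t. F (fst t) (snd t))" "computable xs"
  shows "computable (\<lambda>x. find (F x) (xs x))"
proof -
  have "computable (\<lambda>x. foldr (\<lambda>y r. if F x y then Some y else r) (xs x) None)"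
    by (intro computable_intros assms computable_comp[OF assms(1),
          of "\<lambda>t. (fst t, fst (snd t))", simplified])
  moreover have "foldr (\<lambda>y r. if G y then Some y else r) zs None = find G zs" for G :: "'b \<Rightarrow> bool" and zs
    by (induction zs) auto
  ultimately show ?thesis by simp
qed

lemma computable_Bex [computable_intros]:
  assumes "computable (\<lambda>t. F (fst t) (snd t))" "computable xs"
  shows "computable (\<lambda>x. \<exists>y\<in>set (xs x). F x y)"
proof -
  have "computable (\<lambda>x. \<not> find (F x) (xs x) = None)" by (intro computable_intros assms)
  then show ?thesis by (rule computable_cong) (auto simp: find_None_iff)
qed

lemma computable_member [computable_intros]:
  assumes "computable f" "computable xs"
  shows "computable (\<lambda>x. f x \<in> set (xs x))"
proof -
  have "computable (\<lambda>x. \<exists>y\<in>set (xs x). y = f x)"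
    by (intro computable_intros assms assms[THEN computable_comp])
  then show ?thesis by simp
qed

lemma computable_concat [computable_intros]:
  assumes "computable f"
  shows "computable (\<lambda>x. concat (f x))"
proof -
  have "computable (\<lambda>x. foldr (\<lambda>y ys. y @ ys) (f x) [])" by (intro computable_intros assms)
  moreover have "foldr (@) zs [] = concat zs" for zs :: "'b list list" by (induction zs) auto
  ultimately show ?thesis by simp
qed

lemma computable_sum_list [computable_intros]:
  assumes "computable f"
  shows "computable (\<lambda>x. sum_list (f x) :: nat)"
proof -
  have "computable (\<lambda>x. foldr (\<lambda>y z. y + z) (f x) 0)" by (intro computable_intros assms)
  moreover have "foldr (+) zs 0 = sum_list zs" for zs :: "nat list" by (induction zs) auto
  ultimately show ?thesis by simp
qed

lemma computable_length [computable_intros]: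
  assumes "computable f"
  shows "computable (\<lambda>x. length (f x))"
proof -
  have "computable (\<lambda>x. sum_list (map (\<lambda>_. 1::nat) (f x)))" by (intro computable_intros assms)
  then show ?thesis by (rule computable_cong) (simp add: sum_list_triv)
qed

lemma computable_upt [computable_intros]:
  assumes "computable f"
  shows "computable (\<lambda>x. [0..<f x])"
proof -
  have "computable (\<lambda>x. rec_nat [] (\<lambda>n ns. ns @ [n]) (f x))" by (intro computable_intros assms)
  moreover have "rec_nat [] (\<lambda>n ns. ns @ [n]) k = [0..<k]" for k by (induction k) auto
  ultimately show ?thesis by simp
qed

lemma computable_tl [computable_intros]:
  assumes "computable f"
  shows "computable (\<lambda>x. tl (f x))"
  unfolding tl_def by (intro computable_intros assms)

lemma computable_hd [computable_intros]:
  assumes "computable f"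
  shows "computable (\<lambda>x. hd (f x))"
proof -
  \<comment> \<open>The unspecified \<open>hd []\<close> is some fixed value, and constant functions
    are computable.\<close>
  have "computable (\<lambda>x. case f x of [] \<Rightarrow> hd [] | y # ys \<Rightarrow> y)" by (intro computable_intros assms)
  then show ?thesis by (rule computable_cong) (auto split: list.splits)
qed

lemma computable_drop [computable_intros]:
  assumes "computable n" "computable f"
  shows "computable (\<lambda>x. drop (n x) (f x))"
proof -
  have "computable (\<lambda>x. ((\<lambda>ys. tl ys) ^^ n x) (f x))" by (intro computable_intros assms)
  moreover have "(tl ^^ k) ys = drop k ys" for k and ys :: "'b list"
    by (induction k) (simp_all add: drop_Suc tl_drop)
  ultimately show ?thesis by simp
qed

lemma computable_take [computable_intros]:
  assumes "computable n" "computable f"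
  shows "computable (\<lambda>x. take (n x) (f x))"
proof -
  have "computable (\<lambda>x. rev (drop (length (f x) - n x) (rev (f x))))"
    by (intro computable_intros assms)
  moreover have "take (length ys - (length ys - k)) ys = take k ys" for k and ys :: "'b list"
    by (cases "k \<le> length ys") auto
  ultimately show ?thesis by (simp add: drop_rev)
qed

lemma computable_prefix [computable_intros]:
  assumes "computable f" "computable g"
  shows "computable (\<lambda>x. prefix (f x) (g x))"
proof -
  have "computable (\<lambda>x. take (length (f x)) (g x) = f x)" by (intro computable_intros assms)
  then show ?thesis
    by (rule computable_cong) (metis append_eq_conv_conj append_take_drop_id prefix_def)
qed

lemma computable_suffix [computable_intros]:
  "computable f \<Longrightarrow> computable g \<Longrightarrow> computable (\<lambda>x. suffix (f x) (g x))"
  unfolding suffix_to_prefix by (intro computable_intros)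

text \<open>The bound replaces minimisation, which might diverge, by a search through a
  list.\<close>

lemma computable_Least:
  fixes F :: "'a::encodable \<Rightarrow> nat \<Rightarrow> bool"
  assumes "computable (\<lambda>t. F (fst t) (snd t))" "computable b" "\<And>x. \<exists>n\<le>b x. F x n"
  shows "computable (\<lambda>x. LEAST n. F x n)"
proof -
  have "computable (\<lambda>x. case find (F x) [0..<Suc (b x)] of None \<Rightarrow> 0 | Some n \<Rightarrow> n)"
    by (intro computable_intros assms)
  moreover have "find (F x) [0..<Suc (b x)] = Some (LEAST n. F x n)" for x
  proof -
    obtain n where n: "n \<le> b x" "F x n" using assms(3) by blast
    then have "F x (LEAST n. F x n)" "(LEAST n. F x n) \<le> b x"
      using LeastI[of "F x"] Least_le[of "F x" n] by auto
    then show ?thesis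
      unfolding find_Some_iff
      by (intro exI[of _ "LEAST n. F x n"]) (auto simp del: upt_Suc dest: not_less_Least)
  qed
  ultimately show ?thesis by simp
qed

section \<open>Computing the automaton\<close>

lemma computable_word_list [computable_intros]:
  assumes "computable rs"
  shows "computable (\<lambda>x. word_list (rs x))"
  unfolding word_list_def by (intro computable_intros assms)

text \<open>The text in front of an occurrence is replaced by its length, which turns the definition
  into a finite search.\<close>

lemma piece_set_iff:
  "piece (set rs) p \<longleftrightarrow> p = [] \<or> (\<exists>w\<in>set (word_list rs). \<exists>w'\<in>set (word_list rs).
     \<exists>i\<in>set [0..<Suc (length w)]. \<exists>j\<in>set [0..<Suc (length w')].
       prefix p (drop i w) \<and> prefix p (drop j w') \<and> (w \<noteq> w' \<or> i \<noteq> j))"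
proof
  assume "piece (set rs) p"
  show "p = [] \<or> (\<exists>w\<in>set (word_list rs). \<exists>w'\<in>set (word_list rs).
     \<exists>i\<in>set [0..<Suc (length w)]. \<exists>j\<in>set [0..<Suc (length w')].
       prefix p (drop i w) \<and> prefix p (drop j w') \<and> (w \<noteq> w' \<or> i \<noteq> j))"
  proof (cases "p = []")
    case False
    with \<open>piece (set rs) p\<close> obtain w w' x y x' y' where *: "w \<in> relation_words (set rs)"
      "w' \<in> relation_words (set rs)" "w = x @ p @ y" "w' = x' @ p @ y'" "w \<noteq> w' \<or> x \<noteq> x'"
      by (rule pieceE)
    then have "w \<noteq> w' \<or> length x \<noteq> length x'" by auto
    then show ?thesis
      using * by (intro disjI2 bexI[of _ w] bexI[of _ w'] bexI[of _ "length x"] bexI[of _ "length x'"])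
        (auto simp del: upt_Suc)
  qed simp
next
  assume asm: "p = [] \<or> (\<exists>w\<in>set (word_list rs). \<exists>w'\<in>set (word_list rs).
     \<exists>i\<in>set [0..<Suc (length w)]. \<exists>j\<in>set [0..<Suc (length w')].
       prefix p (drop i w) \<and> prefix p (drop j w') \<and> (w \<noteq> w' \<or> i \<noteq> j))"
  show "piece (set rs) p"
  proof (cases "p = []")
    case False
    with asm obtain w w' i j where *: "w \<in> set (word_list rs)" "w' \<in> set (word_list rs)"
      "i \<in> set [0..<Suc (length w)]" "j \<in> set [0..<Suc (length w')]" "prefix p (drop i w)"
      "prefix p (drop j w')" and ne: "w \<noteq> w' \<or> i \<noteq> j"
      by blast
    obtain y y' where y: "drop i w = p @ y" "drop j w' = p @ y'" using * by (auto elim!: prefixE)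
    have ij: "i \<le> length w" "j \<le> length w'" using * by auto
    have "w \<noteq> w' \<or> take i w \<noteq> take j w'"
      using ne ij by (metis length_take min.absorb2)
    moreover have "w = take i w @ p @ y" "w' = take j w' @ p @ y'"
      using y by (metis append_take_drop_id)+
    ultimately show ?thesis
      using * by (intro pieceI[of w _ w' "take i w" p y "take j w'" y']) auto
  qed simp
qed

lemma computable_piece [computable_intros]:
  assumes "computable rs" "computable p"
  shows "computable (\<lambda>x. piece (set (rs x)) (p x))"
  unfolding piece_set_iff by (intro computable_intros assms assms[THEN computable_comp])

lemma computable_stem_length [computable_intros]:
  assumes "computable rs" "computable r"
  shows "computable (\<lambda>x. stem_length (set (rs x)) (r x))"
  unfolding stem_length_def
proof (rule computable_Least[of _ "\<lambda>x. length (r x)"])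
  show "\<exists>n\<le>length (r x). piece (set (rs x)) (drop n (r x))" for x
    by (intro exI[of _ "length (r x)"]) simp
qed (intro computable_intros assms assms[THEN computable_comp])+

lemma computable_stem [computable_intros]:
  assumes "computable rs" "computable r"
  shows "computable (\<lambda>x. stem (set (rs x)) (r x))"
  unfolding stem_def by (intro computable_intros assms)

lemma computable_tail [computable_intros]:
  assumes "computable rs" "computable r"
  shows "computable (\<lambda>x. tail (set (rs x)) (r x))"
  unfolding tail_def by (intro computable_intros assms)

definition add_related :: "('a \<times> 'a) list \<Rightarrow> 'a list \<Rightarrow> 'a list" where
  "add_related rs xs = xs @ concat (map (\<lambda>p. (if fst p \<in> set xs then [snd p] else []) @
     (if snd p \<in> set xs then [fst p] else [])) rs)"

lemma set_add_related: "set (add_related rs xs) = set xs \<union> (set rs \<union> (set rs)\<inverse>) `` set xs"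
  by (force simp: add_related_def)

lemma set_add_related_funpow:
  "set ((add_related rs ^^ n) [r]) = {s. \<exists>k\<le>n. (r, s) \<in> (set rs \<union> (set rs)\<inverse>) ^^ k}"
proof (induction n)
  case (Suc n)
  let ?S = "set rs \<union> (set rs)\<inverse>"
  have "(\<exists>k\<le>Suc n. (r, s) \<in> ?S ^^ k) \<longleftrightarrow>
    (\<exists>k\<le>n. (r, s) \<in> ?S ^^ k) \<or> (\<exists>t. (\<exists>k\<le>n. (r, t) \<in> ?S ^^ k) \<and> (t, s) \<in> ?S)" (is "?L \<longleftrightarrow> ?R") for s
  proof
    assume ?L
    then obtain k where k: "k \<le> Suc n" "(r, s) \<in> ?S ^^ k" by blast
    show ?R
    proof (cases "k \<le> n")
      case False
      then have "(r, s) \<in> ?S ^^ Suc n" using k le_antisym by fastforce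
      then obtain t where "(r, t) \<in> ?S ^^ n" "(t, s) \<in> ?S"
        unfolding relpow.simps by blast
      then show ?R by blast
    qed (use k in blast)
  next
    assume ?R
    then show ?L using le_SucI relpow_Suc_I[of r _ _ ?S] by (metis Suc_le_mono)
  qed
  then show ?case unfolding funpow.simps o_apply set_add_related Suc by blast
qed auto

text \<open>Reachability needs at most as many steps as there are pairs, and the symmetrised
  relation has at most \<open>length rs + length rs\<close>.\<close>

lemma sim_set_iff:
  "sim (set rs) r s \<longleftrightarrow>
     r \<in> set (word_list rs) \<and> s \<in> set ((add_related rs ^^ (length rs + length rs)) [r])"
proof -
  let ?S = "set rs \<union> (set rs)\<inverse>"
  have "card ?S \<le> card (set rs) + card ((set rs)\<inverse>)" by (rule card_Un_le)
  then have "card ?S \<le> length rs + length rs"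
    using card_length[of rs] by (simp add: card_inverse)
  moreover have "?S\<^sup>* = (\<Union>n\<in>{n. n \<le> card ?S}. ?S ^^ n)"
    by (rule rtrancl_finite_eq_relpow) simp
  ultimately have "(r, s) \<in> ?S\<^sup>* \<longleftrightarrow> (\<exists>k\<le>length rs + length rs. (r, s) \<in> ?S ^^ k)"
    using relpow_imp_rtrancl[of "(r, s)" _ ?S] by (metis (no_types, lifting) UN_E mem_Collect_eq order_trans)
  then show ?thesis by (simp add: sim_def set_add_related_funpow)
qed

lemma computable_sim [computable_intros]:
  assumes "computable rs" "computable r" "computable s"
  shows "computable (\<lambda>x. sim (set (rs x)) (r x) (s x))"
  unfolding sim_set_iff add_related_def by (intro computable_intros assms assms[THEN computable_comp])

lemma clean_set_iff:
  "clean (set rs) u r \<longleftrightarrow> prefix (stem (set rs) r) u \<and>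
     \<not> (\<exists>s\<in>set (word_list rs). \<exists>i\<in>set [0..<length (stem (set rs) r)].
          0 < i \<and> prefix (stem (set rs) s) (drop i u))"
  unfolding clean_def set_word_list set_upt atLeast0LessThan Bex_def lessThan_iff by blast

lemma computable_clean [computable_intros]:
  assumes "computable rs" "computable u" "computable r"
  shows "computable (\<lambda>x. clean (set (rs x)) (u x) (r x))"
  unfolding clean_set_iff by (intro computable_intros assms assms[THEN computable_comp])

lemma computable_starts_stem [computable_intros]:
  assumes "computable rs" "computable z" "computable q"
  shows "computable (\<lambda>x. starts_stem (set (rs x)) (z x) (q x))"
  unfolding starts_stem_def set_word_list[symmetric]
  by (intro computable_intros assms assms[THEN computable_comp])

lemma computable_tails [computable_intros]:
  assumes "computable f"
  shows "computable (\<lambda>x. tails (f x))"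
  unfolding tails_def by (intro computable_intros assms assms[THEN computable_comp])

lemma computable_tail_suffixes [computable_intros]:
  assumes "computable rs" "computable r"
  shows "computable (\<lambda>x. tail_suffixes (rs x) (r x))"
  unfolding tail_suffixes_def by (intro computable_intros assms assms[THEN computable_comp])

lemma computable_unshared_length [computable_intros]:
  assumes "computable f" "computable g"
  shows "computable (\<lambda>x. unshared_length (f x) (g x))"
  unfolding unshared_length_def
proof (rule computable_Least[of _ "\<lambda>x. length (f x)"])
  show "\<exists>n\<le>length (f x). suffix (drop n (f x)) (g x)" for x
    by (intro exI[of _ "length (f x)"]) simp
qed (intro computable_intros assms assms[THEN computable_comp])+

lemma computable_reduce_stem [computable_intros]:
  assumes "computable rs" "computable r" "computable r'" "computable p" "computable u" "computable v"
  shows "computable (\<lambda>x. reduce_stem (rs x) (r x) (r' x) (p x) (u x) (v x))"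
  unfolding reduce_stem_def by (intro computable_intros assms assms[THEN computable_comp])

lemma computable_reduce [computable_intros]:
  assumes "computable rs" "computable u" "computable v" "computable p"
  shows "computable (\<lambda>x. reduce (rs x) (u x) (v x) (p x))"
  unfolding reduce_def by (intro computable_intros assms assms[THEN computable_comp])

lemma computable_long [computable_intros]:
  assumes "computable k" "computable u"
  shows "computable (\<lambda>x. long e (k x) (u x))"
  unfolding long_def by (intro computable_intros assms)

lemma computable_size_bound [computable_intros]:
  assumes "computable rs"
  shows "computable (\<lambda>x. size_bound (rs x))"
  unfolding size_bound_def by (intro computable_intros assms)

lemma computable_window [computable_intros]:
  assumes "computable rs"
  shows "computable (\<lambda>x. window (rs x))"
  unfolding window_def by (intro computable_intros assms)

lemma computable_advance [computable_intros]:
  assumes "computable rs" "computable y"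
  shows "computable (\<lambda>x. advance e (rs x) (y x))"
  unfolding advance_def by (intro computable_intros assms assms[THEN computable_comp])

lemma computable_normalise [computable_intros]:
  assumes "computable rs" "computable y"
  shows "computable (\<lambda>x. normalise e (rs x) (y x))"
  unfolding normalise_def fuel_def by (intro computable_intros assms assms[THEN computable_comp])

lemma computable_words_upto [computable_intros]:
  assumes "computable bs" "computable n"
  shows "computable (\<lambda>x. words_upto (bs x) (n x))"
proof -
  have "computable (\<lambda>x. rec_nat [[]] (\<lambda>_ ws. [] # concat (map (\<lambda>w. map (\<lambda>b. b # w) (bs x)) ws)) (n x))"
    by (intro computable_intros assms assms[THEN computable_comp])
  moreover have "words_upto cs k = rec_nat [[]] (\<lambda>_ ws. [] # concat (map (\<lambda>w. map (\<lambda>b. b # w) cs) ws)) k"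
    for cs :: "'b list" and k
    by (induction k) auto
  ultimately show ?thesis by simp
qed

lemma computable_buffer_states [computable_intros]:
  assumes "computable bs" "computable rs"
  shows "computable (\<lambda>x. buffer_states (bs x) (rs x))"
  unfolding buffer_states_def by (intro computable_intros assms assms[THEN computable_comp])

lemma computable_transition [computable_intros]:
  assumes "computable bs" "computable rs" "computable q" "computable s"
  shows "computable (\<lambda>x. transition e (bs x) (rs x) (q x) (s x))"
  unfolding transition_def by (intro computable_intros assms assms[THEN computable_comp])

text \<open>Laid out so that its \<open>encode\<close> is literally the number that
  \<open>codes_automaton\<close> asks for.\<close>

definition machine_code where
  "machine_code as rs =
    (map encode (filter (\<lambda>q. \<not> reads_second rs q) (machine_states as rs)),
     map encode (filter (\<lambda>q. reads_second rs q) (machine_states as rs)),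
     encode ([] :: nat tape_symbol list, [] :: nat tape_symbol list, [] :: nat tape_symbol list),
     [encode ([] :: nat tape_symbol list, [] :: nat tape_symbol list, [] :: nat tape_symbol list)],
     concat (map (\<lambda>q. concat (map (\<lambda>s. case machine_transition as rs q s of
         None \<Rightarrow> [] | Some q' \<Rightarrow> [(encode q, s, encode q')]) (tape_letters as))) (machine_states as rs)))"

lemma computable_machine_code [computable_intros]:
  assumes "computable as" "computable rs"
  shows "computable (\<lambda>x. machine_code (as x) (rs x))"
  unfolding machine_code_def machine_transition_def reads_second_def machine_states_def tape_letters_def
    letter_relations_def map_prod_def
  by (intro computable_intros assms assms[THEN computable_comp])

lemma encode_nat_list: "encode (ns :: nat list) = list_encode ns"
  by (simp add: encode_list_def map_idI)

lemma encode_machine_code: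
  "encode (qs1 :: nat list, qs2 :: nat list, q :: nat, fs :: nat list, ts :: (nat \<times> nat tape_symbol \<times> nat) list) =
    prod_encode (list_encode qs1, prod_encode (list_encode qs2, prod_encode (q, prod_encode (list_encode fs,
      list_encode (map (\<lambda>(q, s, q'). prod_encode (q, prod_encode (symbol_code s, q'))) ts)))))"
proof -
  have "encode s = symbol_code s" for s :: "nat tape_symbol"
    by (cases s) (simp_all add: encode_tape_symbol_def)
  then have "encode = (\<lambda>(q :: nat, s, q' :: nat). prod_encode (q, prod_encode (symbol_code s, q')))"
    by (auto simp: encode_prod_def)
  then have "encode ts = list_encode (map (\<lambda>(q, s, q'). prod_encode (q, prod_encode (symbol_code s, q'))) ts)"
    by (simp add: encode_list_def)
  then show ?thesis by (simp add: encode_prod_def encode_nat_list)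
qed

lemma presentation_code_encode: "presentation_code as rs = encode (as, rs)"
proof -
  have "encode = (\<lambda>(l, r). prod_encode (list_encode l, list_encode (r :: nat list)))"
    by (auto simp: encode_prod_def encode_nat_list)
  then show ?thesis
    by (simp add: presentation_code_def encode_prod_def[of "(as, rs)"] encode_nat_list encode_list_def[of rs])
qed

lemma codes_machine:
  assumes "presented_machine encode as rs"
  shows "codes_automaton (encode (machine_code as rs)) (machine encode as rs)"
proof -
  interpret presented_machine encode as rs by fact
  let ?ts = "concat (map (\<lambda>q. concat (map (\<lambda>s. case machine_transition as rs q s of
     None \<Rightarrow> [] | Some q' \<Rightarrow> [(encode q, s, encode q')]) (tape_letters as))) (machine_states as rs))"
  have "(\<exists>q\<in>Q. \<exists>q'. n = encode q \<and> n' = encode q' \<and> machine_transition as rs q s = Some q') \<longleftrightarrow>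
    (\<exists>q\<in>Q. \<exists>t\<in>set (tape_letters as). (n, s, n') \<in> set (case machine_transition as rs q t of
       None \<Rightarrow> [] | Some q' \<Rightarrow> [(encode q, t, encode q')]))" for n s n'
    using transition_state by (force split: option.splits)
  then have ts: "set ?ts = {(q, s, q'). next_state M q s = Some q'}"
    unfolding next_state_iff by auto
  show ?thesis
    unfolding codes_automaton_def
    by (rule exI[of _ "map encode (filter (\<lambda>q. \<not> reads_second rs q) (machine_states as rs))"],
        rule exI[of _ "map encode (filter (\<lambda>q. reads_second rs q) (machine_states as rs))"],
        rule exI[of _ "[encode ([] :: nat tape_symbol list, [] :: nat tape_symbol list, [] :: nat tape_symbol list)]"],
        rule exI[of _ ?ts], intro conjI ts)
      (simp_all add: machine_def machine_code_def encode_machine_code)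
qed

section \<open>Reversal of presentations\<close>

lemma map_relations_rev_rev: "map_relations rev (map_relations rev R) = R"
  by (force simp: map_relations_def)

text \<open>Reversal exchanges the texts before and after an occurrence; within one word, different
  texts before mean different texts after.\<close>

lemma piece_rev:
  assumes "piece (map_relations rev R) p"
  shows "piece R (rev p)"
proof (cases "p = []")
  case False
  obtain w w' x y x' y' where *: "w \<in> relation_words (map_relations rev R)"
    "w' \<in> relation_words (map_relations rev R)" "w = x @ p @ y" "w' = x' @ p @ y'" "w \<noteq> w' \<or> x \<noteq> x'"
    using assms False by (rule pieceE)
  have "rev w \<in> relation_words R" "rev w' \<in> relation_words R"
    using *(1,2) unfolding relation_words_map by auto
  moreover have "rev w \<noteq> rev w' \<or> rev y \<noteq> rev y'" using *(3-5) by auto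
  ultimately show ?thesis
    using *(3,4) by (intro pieceI[of "rev w" R "rev w'" "rev y" "rev p" "rev x" "rev y'" "rev x'"]) simp_all
qed simp

lemma weakly_C_rev:
  assumes "weakly_C n R"
  shows "weakly_C n (map_relations rev R)"
  unfolding weakly_C_def relation_words_map
proof (intro ballI notI, elim exE conjE imageE)
  fix w ps r
  assume *: "length ps < n" "\<forall>p\<in>set ps. piece (map_relations rev R) p" "w = concat ps" "w = rev r"
    "r \<in> relation_words R"
  have "r = concat (map rev (rev ps))" using *(3,4) by (metis rev_concat rev_rev_ident)
  moreover have "length (map rev (rev ps)) < n" "\<forall>p\<in>set (map rev (rev ps)). piece R p"
    using *(1,2) piece_rev by auto
  ultimately show False using assms *(5) unfolding weakly_C_def by blast
qed

lemma word_equiv_rev: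
  "(u, v) \<in> word_equiv A R \<Longrightarrow> (rev u, rev v) \<in> word_equiv A (map_relations rev R)"
proof (induction rule: word_equiv.induct)
  case (rel u v)
  then show ?case by (intro word_equiv.rel) (force simp: map_relations_def)
qed (auto intro: word_equiv.intros)

lemma reverse_word_equiv: "reverse (word_equiv A R) = word_equiv A (map_relations rev R)"
proof -
  have "(x, y) \<in> reverse (word_equiv A R)" if "(x, y) \<in> word_equiv A (map_relations rev R)" for x y
    using word_equiv_rev[OF that] unfolding map_relations_rev_rev reverse_def
    by (intro CollectI exI[of _ "rev x"] exI[of _ "rev y"]) simp
  then show ?thesis using word_equiv_rev by (fastforce simp: reverse_def)
qed

lemma finite_presentation_rev:
  "finite_presentation A R \<Longrightarrow> finite_presentation A (map_relations rev R)"
  by (auto simp: finite_presentation_def map_relations_def)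

text \<open>Only existence is claimed over an arbitrary alphabet, so the lists and the numbering are
  simply chosen by finiteness.\<close>

lemma deterministic_rational_word_equiv:
  assumes "finite_presentation A R" "weakly_C 4 R"
  shows "deterministic_rational A (word_equiv A R)"
proof -
  obtain as rs where lists: "set as = A" "set rs = R"
    using assms(1) finite_list unfolding finite_presentation_def by metis
  obtain h :: "_ \<Rightarrow> nat" where "inj_on h (set (machine_states as rs))"
    using finite_imp_inj_to_nat_seg[OF finite_set] by metis
  then interpret presented_machine h as rs
    using assms lists by unfold_locales auto
  show ?thesis
    unfolding deterministic_rational_def using automaton recognised lists by blast
qed

theorem theorem3:
  "(\<forall>(A :: 'a set) R. finite_presentation A R \<and> weakly_C 4 R \<longrightarrow>
      deterministic_rational A (word_equiv A R) \<and>
      reverse_deterministic_rational A (word_equiv A R)) \<and>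
   (\<exists>f. partial_recursive f \<and>
      (\<forall>(as :: nat list) rs.
         finite_presentation (set as) (set rs) \<and> weakly_C 4 (set rs) \<longrightarrow>
         (\<exists>c d M N.
            f (presentation_code as rs) = Some (prod_encode (c, d)) \<and>
            codes_automaton c M \<and> two_tape_automaton (set as) M \<and>
            recognised M = word_equiv (set as) (set rs) \<and>
            codes_automaton d N \<and> two_tape_automaton (set as) N \<and>
            recognised N = reverse (word_equiv (set as) (set rs)))))"
proof (intro conjI allI impI; (elim conjE)?)
  fix A :: "'a set" and R
  assume "finite_presentation A R" "weakly_C 4 R"
  then show "deterministic_rational A (word_equiv A R)"
    "reverse_deterministic_rational A (word_equiv A R)"
    unfolding reverse_deterministic_rational_def reverse_word_equiv
    using deterministic_rational_word_equiv finite_presentation_rev weakly_C_rev by blast+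
next
  define rev_rs :: "(nat list \<times> nat list) list \<Rightarrow> _"
    where "rev_rs rs = map (\<lambda>p. (rev (fst p), rev (snd p))) rs" for rs
  have rev_rs: "set (rev_rs rs) = map_relations rev (set rs)" for rs
    by (simp add: rev_rs_def map_relations_def map_prod_def case_prod_beta')
  have "computable (\<lambda>x. (machine_code (fst x) (snd x), machine_code (fst x) (rev_rs (snd x))))"
    unfolding rev_rs_def by (intro computable_intros)
  then obtain g where g: "total_recursive g"
    "\<And>as rs. g (encode (as, rs)) = encode (machine_code as rs, machine_code as (rev_rs rs))"
    unfolding computable_def by auto
  show "\<exists>f. partial_recursive f \<and>
      (\<forall>(as :: nat list) rs.
         finite_presentation (set as) (set rs) \<and> weakly_C 4 (set rs) \<longrightarrow>
         (\<exists>c d M N.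
            f (presentation_code as rs) = Some (prod_encode (c, d)) \<and>
            codes_automaton c M \<and> two_tape_automaton (set as) M \<and>
            recognised M = word_equiv (set as) (set rs) \<and>
            codes_automaton d N \<and> two_tape_automaton (set as) N \<and>
            recognised N = reverse (word_equiv (set as) (set rs))))"
  proof (intro exI[of _ "\<lambda>n. Some (g n)"] conjI allI impI; (elim conjE)?)
    show "partial_recursive (\<lambda>n. Some (g n))" using g(1) by (simp add: total_recursive_def)
    fix as :: "nat list" and rs
    assume pres: "finite_presentation (set as) (set rs)" "weakly_C 4 (set rs)"
    have M: "presented_machine encode as rs"
      using pres inj_on_subset[OF inj_encode] by unfold_locales auto
    have N: "presented_machine encode as (rev_rs rs)"
      using finite_presentation_rev[OF pres(1)] weakly_C_rev[OF pres(2)] inj_on_subset[OF inj_encode]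
      by unfold_locales (auto simp: rev_rs)
    show "\<exists>c d M N. Some (g (presentation_code as rs)) = Some (prod_encode (c, d)) \<and>
            codes_automaton c M \<and> two_tape_automaton (set as) M \<and>
            recognised M = word_equiv (set as) (set rs) \<and>
            codes_automaton d N \<and> two_tape_automaton (set as) N \<and>
            recognised N = reverse (word_equiv (set as) (set rs))"
    proof (intro exI conjI)
      show "Some (g (presentation_code as rs)) =
        Some (prod_encode (encode (machine_code as rs), encode (machine_code as (rev_rs rs))))"
        unfolding presentation_code_encode g(2) by (subst encode_prod_def) simp
      show "codes_automaton (encode (machine_code as rs)) (machine encode as rs)"
        "codes_automaton (encode (machine_code as (rev_rs rs))) (machine encode as (rev_rs rs))"
        using codes_machine M N by blast+
      show "two_tape_automaton (set as) (machine encode as rs)"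
        "recognised (machine encode as rs) = word_equiv (set as) (set rs)"
        using presented_machine.automaton[OF M] presented_machine.recognised[OF M] .
      show "two_tape_automaton (set as) (machine encode as (rev_rs rs))"
        "recognised (machine encode as (rev_rs rs)) = reverse (word_equiv (set as) (set rs))"
        using presented_machine.automaton[OF N] presented_machine.recognised[OF N]
        unfolding reverse_word_equiv rev_rs .
    qed
  qed
qed

end
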